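(* Let $s\in(0,1]$ and $p\in[1,+\infty)$ be such that $sp=N$ and $s\neq p$. Let $\Omega\subset\mathbb{R}^N$ be an open and bounded domain with Lipschitz boundary. Let $\widetilde s\in[0,1]$ and $\widetilde p\in[1,+\infty]$, and exclude the trivial cases $(\widetilde s,\widetilde p)=(s,p)$ and $\widetilde s=s=1$ with $1\le\widetilde p\le p$. If $\widetilde s$ and $\widetilde p$ do not satisfy $$\text{either}\quad\begin{cases}0<\widetilde s<s,\\ 1\le\widetilde p\le\dfrac{N}{\widetilde s},\end{cases}\qquad\text{or}\qquad\begin{cases}\widetilde s=0,\\ 1\le\widetilde p<+\infty,\end{cases}$$ then the space $W^{s,p}(\Omega)$ is not continuously embedded in $W^{\widetilde s,\widetilde p}(\Omega)$.
   Context: $N\ge1$ is an integer and functions are real-valued and measurable. For $s\in[0,1]$ and $p\in[1,+\infty)$ define $[u]_{W^{0,p}(\Omega)}:=\|u\|_{L^p(\Omega)}$, $[u]_{W^{1,p}(\Omega)}:=\|\nabla u\|_{L^p(\Omega)}$ (weak gradient) and, for $s\in(0,1)$, $$[u]_{W^{s,p}(\Omega)}:=\left(c_{N,s,p}\iint_{\Omega\times\Omega}\frac{|u(x)-u(y)|^p}{|x-y|^{N+sp}}\,dx\,dy\right)^{1/p},\qquad c_{N,s,p}:=\frac{s\,2^{2s-1}\,\Gamma\left(\frac{ps+p+N-2}{2}\right)}{\pi^{N/2}\,\Gamma(1-s)}.$$ Set $W^{s,p}(\Omega):=\{u\in L^p(\Omega):[u]_{W^{s,p}(\Omega)}<+\infty\}$,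 with norm $\|u\|_{W^{0,p}(\Omega)}:=\|u\|_{L^p(\Omega)}$ if $s=0$ and $\|u\|_{W^{s,p}(\Omega)}:=\big([u]^p_{W^{s,p}(\Omega)}+\|u\|^p_{L^p(\Omega)}\big)^{1/p}$ if $s\in(0,1]$. For $p=+\infty$: $W^{0,\infty}(\Omega):=L^\infty(\Omega)$ and, for $s\in(0,1]$, $W^{s,\infty}(\Omega):=C^{0,s}(\Omega)$ with norm $\|u\|_{L^\infty(\Omega)}+\sup_{x\neq y\in\Omega}\frac{|u(x)-u(y)|}{|x-y|^s}$ (functions being identified up to a.e. equality). *)

theory Defs
  imports "HOL-Analysis.Analysis" "HOL-Probability.Essential_Supremum"
begin

section \<open>Lipschitz domains\<close>

text \<open>
  Near each boundary point the set is the strict epigraph of a Lipschitz function over the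
  hyperplane orthogonal to a unit vector \<open>e\<close>. The coordinate-free form also covers
  dimension one, where that hyperplane is \<open>{0}\<close>.
\<close>

definition lipschitz_boundary :: "'a::euclidean_space set \<Rightarrow> bool" where
  "lipschitz_boundary \<Omega> \<longleftrightarrow>
     (\<forall>x\<in>frontier \<Omega>. \<exists>r>0. \<exists>e L \<gamma>. norm e = 1 \<and> L-lipschitz_on {z. z \<bullet> e = 0} (\<gamma> :: 'a \<Rightarrow> real) \<and>
        \<Omega> \<inter> ball x r = {y \<in> ball x r. y \<bullet> e > \<gamma> (y - (y \<bullet> e) *\<^sub>R e)})"

definition bounded_lipschitz_domain :: "'a::euclidean_space set \<Rightarrow> bool" where
  "bounded_lipschitz_domain \<Omega> \<longleftrightarrow>
     open \<Omega> \<and> connected \<Omega> \<and> \<Omega> \<noteq> {} \<and> bounded \<Omega> \<and> lipschitz_boundary \<Omega>"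


section \<open>Test functions and weak gradients\<close>

definition partial_deriv :: "'n::finite \<Rightarrow> (real^'n \<Rightarrow> real) \<Rightarrow> real^'n \<Rightarrow> real" where
  "partial_deriv i f x = frechet_derivative f (at x) (axis i 1)"

primrec C_k :: "nat \<Rightarrow> (real^'n::finite \<Rightarrow> real) \<Rightarrow> bool" where
  "C_k 0 f \<longleftrightarrow> continuous_on UNIV f"
| "C_k (Suc k) f \<longleftrightarrow> f differentiable_on UNIV \<and> (\<forall>i. C_k k (partial_deriv i f))"

definition test_function :: "(real^'n::finite) set \<Rightarrow> (real^'n \<Rightarrow> real) \<Rightarrow> bool" where
  "test_function \<Omega> \<phi> \<longleftrightarrow>
     (\<forall>k. C_k k \<phi>) \<and> compact (closure {x. \<phi> x \<noteq> 0}) \<and> closure {x. \<phi> x \<noteq> 0} \<subseteq> \<Omega>"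

definition locally_integrable_on ::
    "(real^'n::finite \<Rightarrow> 'b::{banach, second_countable_topology}) \<Rightarrow> (real^'n) set \<Rightarrow> bool" where
  "locally_integrable_on f \<Omega> \<longleftrightarrow> (\<forall>K. compact K \<and> K \<subseteq> \<Omega> \<longrightarrow> integrable (lebesgue_on K) f)"

definition weak_gradient ::
    "(real^'n::finite) set \<Rightarrow> (real^'n \<Rightarrow> real) \<Rightarrow> (real^'n \<Rightarrow> real^'n) \<Rightarrow> bool" where
  "weak_gradient \<Omega> u g \<longleftrightarrow>
     locally_integrable_on u \<Omega> \<and> locally_integrable_on g \<Omega> \<and>
     (\<forall>\<phi> i. test_function \<Omega> \<phi> \<longrightarrow>
        (LINT x|lebesgue_on \<Omega>. u x * partial_deriv i \<phi> x) = - (LINT x|lebesgue_on \<Omega>. g x $ i * \<phi> x))"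


section \<open>Norms and seminorms, with value infinity outside the respective space\<close>

definition epowr :: "ennreal \<Rightarrow> real \<Rightarrow> ennreal" where
  "epowr a r = (if a = \<infinity> then \<infinity> else ennreal (enn2real a powr r))"
  \<comment> \<open>only used for \<open>r > 0\<close>\<close>

definition Lp_norm :: "ereal \<Rightarrow> (real^'n::finite) set \<Rightarrow> (real^'n \<Rightarrow> 'b::real_normed_vector) \<Rightarrow> ennreal" where
  "Lp_norm p \<Omega> f =
     (if p = \<infinity> then esssup (lebesgue_on \<Omega>) (\<lambda>x. ennreal (norm (f x)))
      else epowr (\<integral>\<^sup>+ x. ennreal (norm (f x) powr real_of_ereal p) \<partial>lebesgue_on \<Omega>)
                 (1 / real_of_ereal p))"

definition c_const :: "nat \<Rightarrow> real \<Rightarrow> real \<Rightarrow> real" where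
  "c_const N s p =
     s * 2 powr (2 * s - 1) * Gamma ((p * s + p + real N - 2) / 2) / (pi powr (real N / 2) * Gamma (1 - s))"

text \<open>
  The \<open>W\<^sup>s\<^sup>,\<^sup>p\<close> seminorm for finite \<open>p\<close>. Weak gradients are unique
  almost everywhere, so for \<open>s = 1\<close> the infimum is the \<open>L\<^sup>p\<close> norm of the weak gradient
  if there is one, and \<open>\<infinity>\<close> (infimum of the empty set) otherwise. In the fractional case
  the quotient is \<open>0\<close> on the (null) diagonal.
\<close>

definition sobolev_seminorm :: "real \<Rightarrow> real \<Rightarrow> (real^'n::finite) set \<Rightarrow> (real^'n \<Rightarrow> real) \<Rightarrow> ennreal" where
  "sobolev_seminorm s p \<Omega> u =
     (if s = 0 then Lp_norm (ereal p) \<Omega> u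
      else if s = 1 then (INF g\<in>{g. weak_gradient \<Omega> u g}. Lp_norm (ereal p) \<Omega> g)
      else epowr (ennreal (c_const CARD('n) s p) *
             (\<integral>\<^sup>+ (x, y). ennreal (\<bar>u x - u y\<bar> powr p / norm (x - y) powr (real CARD('n) + s * p))
                \<partial>(lebesgue_on \<Omega> \<Otimes>\<^sub>M lebesgue_on \<Omega>))) (1 / p))"

definition hoelder_seminorm :: "real \<Rightarrow> (real^'n::finite) set \<Rightarrow> (real^'n \<Rightarrow> real) \<Rightarrow> ennreal" where
  "hoelder_seminorm s \<Omega> u =
     (SUP (x, y)\<in>{(x, y). x \<in> \<Omega> \<and> y \<in> \<Omega> \<and> x \<noteq> y}. ennreal (\<bar>u x - u y\<bar> / norm (x - y) powr s))"

definition sobolev_norm :: "real \<Rightarrow> ereal \<Rightarrow> (real^'n::finite) set \<Rightarrow> (real^'n \<Rightarrow> real) \<Rightarrow> ennreal" where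
  "sobolev_norm s p \<Omega> u =
     (if s = 0 then Lp_norm p \<Omega> u
      else if p = \<infinity> then Lp_norm \<infinity> \<Omega> u + hoelder_seminorm s \<Omega> u
      else epowr (epowr (sobolev_seminorm s (real_of_ereal p) \<Omega> u) (real_of_ereal p)
                  + epowr (Lp_norm p \<Omega> u) (real_of_ereal p)) (1 / real_of_ereal p))"


section \<open>The spaces and continuous embeddings\<close>

definition sobolev_space :: "real \<Rightarrow> ereal \<Rightarrow> (real^'n::finite) set \<Rightarrow> (real^'n \<Rightarrow> real) set" where
  "sobolev_space s p \<Omega> =
     {u \<in> borel_measurable (lebesgue_on \<Omega>).
        Lp_norm p \<Omega> u < \<infinity> \<and>
        (if p = \<infinity> then s = 0 \<or> hoelder_seminorm s \<Omega> u < \<infinity>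
         else sobolev_seminorm s (real_of_ereal p) \<Omega> u < \<infinity>)}"

text \<open>
  Functions are identified up to equality almost everywhere. The representative \<open>v\<close> matters
  only if the target is a Hoelder space: all other norms are invariant under this identification.
\<close>

definition continuously_embedded ::
    "(real^'n::finite) set \<Rightarrow> real \<Rightarrow> ereal \<Rightarrow> real \<Rightarrow> ereal \<Rightarrow> bool" where
  "continuously_embedded \<Omega> s p s' p' \<longleftrightarrow>
     (\<exists>C::real. \<forall>u\<in>sobolev_space s p \<Omega>. \<exists>v\<in>sobolev_space s' p' \<Omega>.
        (AE x in lebesgue_on \<Omega>. v x = u x) \<and>
        sobolev_norm s' p' \<Omega> v \<le> ennreal C * sobolev_norm s p \<Omega> u)"

end

theory Submission
  imports Defs "HOL-Real_Asymp.Real_Asymp"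
begin

text \<open>
  Every excluded target fails on one of two explicit families. The profiles
  \<open>- ln (norm (\<epsilon>, x - x0))\<close> have \<open>p\<close>-energy of order \<open>1 + ln (1 / \<epsilon>)\<close> in the critical space
  \<open>s p = N\<close>, while their supremum is of order \<open>ln (1 / \<epsilon>)\<close>, and this is not controlled by the
  \<open>p\<close>-th root of the energy since \<open>p > 1\<close>; by scaling, their \<open>q\<close>-energy of order \<open>s'\<close> is at least
  of order \<open>\<epsilon> powr (N - s' q)\<close>, a negative power of \<open>\<epsilon>\<close> if \<open>s' q > N\<close>. In the remaining cases
  \<open>s < 1\<close> and either \<open>s' > s\<close>, or \<open>s' = s\<close> and \<open>q < p\<close>. There one tests with the lacunary sums
  \<open>\<Sum>j<J. l powr (- s j) * cos (l ^ j * x\<^sub>k)\<close> and their sine analogues: their \<open>p\<close>-energy of order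
  \<open>s\<close> is \<open>O(1 + J)\<close>, whereas each of the \<open>J\<close> scales contributes \<open>l powr (j q (s' - s))\<close> to the sum of the
  two \<open>q\<close>-energies of order \<open>s'\<close>. For \<open>s' = 1\<close> the weak gradients are bounded from below by
  testing them with smooth bumps, for which the lacunary sum can be replaced by a single frequency.
\<close>

section \<open>Radial integrals\<close>

text \<open>The representative \<open>v\<close> in the target agrees with the test function only
  almost everywhere, so every lower bound must ignore null sets: Gagliardo energies are invariant
  under such a change, a supremum is read off on a ball of positive measure, and a weak gradient is
  seen only through integrals against bumps. If s' q > N or s' > s, a power of the scale is compared
  with a power of a logarithm, and constants and roots may be estimated crudely. In the two
  borderline cases, exponent infinity and s' = s with q < p, only logarithms meet, and everything
  depends on the exponents 1 / p and q / p being smaller than 1. A cosine sum alone may have tiny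
  increments at unfavourable phases. Together with the sine sum, the increment of one frequency
  becomes a chord of the unit circle, whose length does not depend on the phase. So the two energies
  together have a pointwise lower bound, and no averaging over oscillations is needed. For s' = 1
  the identity cos^2 + sin^2 = 1 plays the same role.\<close>

lemma distr_lborel_norm:
  "distr lborel borel (norm :: 'a::euclidean_space \<Rightarrow> real) =
    density lborel (\<lambda>r. ennreal (DIM('a) * unit_ball_vol (real DIM('a)) * r ^ (DIM('a) - 1)) * indicator {0..} r)"
    (is "?M = ?N")
proof (rule measure_eqI_generator_eq[where E = "range atMost" and \<Omega> = UNIV and A = "\<lambda>i. {..real i}"])
  show "Int_stable (range (atMost :: real \<Rightarrow> real set))"
    by (auto simp: Int_stable_def)
  show "range (atMost :: real \<Rightarrow> real set) \<subseteq> Pow UNIV" by auto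
  have *: "sets borel = sigma_sets UNIV (range (atMost :: real \<Rightarrow> real set))"
    by (subst borel_eq_atMost) (auto simp: full_SetCompr_eq)
  then show "sets ?M = sigma_sets UNIV (range atMost)" "sets ?N = sigma_sets UNIV (range atMost)"
    by auto
  have M: "emeasure ?M {..r} = (if r \<ge> 0 then ennreal (unit_ball_vol (real DIM('a)) * r ^ DIM('a)) else 0)" for r
  proof -
    have "norm -` {..r} \<inter> space (lborel :: 'a measure) = cball 0 r" by auto
    then have "emeasure ?M {..r} = emeasure lborel (cball (0::'a) r)"
      by (subst emeasure_distr) auto
    then show ?thesis by (simp add: emeasure_cball)
  qed
  \<comment> \<open>The density is the derivative of the ball volume in the radius, so both measures
    agree on half-lines.\<close>
  have N: "emeasure ?N {..r} = (if r \<ge> 0 then ennreal (unit_ball_vol (real DIM('a)) * r ^ DIM('a)) else 0)" for r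
  proof (cases "r \<ge> 0")
    case True
    have "emeasure ?N {..r} = (\<integral>\<^sup>+x. ennreal (DIM('a) * unit_ball_vol (real DIM('a)) * x ^ (DIM('a) - 1)) * indicator {0..r} x \<partial>lborel)"
      by (subst emeasure_density) (auto intro!: nn_integral_cong split: split_indicator)
    also have "\<dots> = unit_ball_vol (real DIM('a)) * r ^ DIM('a) - unit_ball_vol (real DIM('a)) * 0 ^ DIM('a)"
      by (intro nn_integral_FTC_Icc) (auto intro!: derivative_eq_intros simp: True)
    finally show ?thesis using True by simp
  next
    case False
    have "emeasure ?N {..r} = (\<integral>\<^sup>+x. ennreal (DIM('a) * unit_ball_vol (real DIM('a)) * x ^ (DIM('a) - 1))
        * indicator {0..} x * indicator {..r} x \<partial>lborel)"
      by (subst emeasure_density) auto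
    also have "\<dots> = (\<integral>\<^sup>+x. 0 \<partial>(lborel :: real measure))"
      by (intro nn_integral_cong) (use False in \<open>auto split: split_indicator\<close>)
    finally show ?thesis using False by simp
  qed
  show "emeasure ?M X = emeasure ?N X" if "X \<in> range atMost" for X
    using that M N by auto
  show "range (\<lambda>i. {..real i}) \<subseteq> range atMost" by auto
  show "(\<Union>i. {..real i}) = UNIV"
    by (auto simp: real_arch_simple)
  show "emeasure ?M {..real i} \<noteq> \<infinity>" for i using M[of "real i"] by auto
qed

lemma nn_integral_radial:
  fixes f :: "real \<Rightarrow> ennreal"
  assumes [measurable]: "f \<in> borel_measurable borel"
  shows "(\<integral>\<^sup>+x. f (norm (x::'a::euclidean_space)) \<partial>lborel) =
    (\<integral>\<^sup>+r. ennreal (DIM('a) * unit_ball_vol (real DIM('a)) * r ^ (DIM('a) - 1)) * indicator {0..} r * f r \<partial>lborel)"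
proof -
  have "(\<integral>\<^sup>+x. f (norm (x::'a)) \<partial>lborel) = (\<integral>\<^sup>+r. f r \<partial>distr lborel borel (norm :: 'a \<Rightarrow> real))"
    by (subst nn_integral_distr) auto
  then show ?thesis
    unfolding distr_lborel_norm by (simp add: nn_integral_density)
qed

lemma power_times_powr_Suc:
  "0 < r \<Longrightarrow> 0 < n \<Longrightarrow> r ^ (n - 1) * r powr (a - real n) = r powr (a - 1)"
  by (simp add: powr_add[symmetric] flip: powr_realpow)

text \<open>In polar coordinates the integrand is a constant times r powr (a - 1), so
  \<open>0 < a\<close> is integrability at the origin. Splitting the dimension off the exponent lets
  the result scale visibly as r powr a.\<close>

lemma nn_integral_norm_powr_near_0:
  fixes a r :: real
  assumes "0 < a" "0 \<le> r"
  shows "(\<integral>\<^sup>+h. ennreal (norm (h::'a::euclidean_space) powr (a - real DIM('a))) * indicator {..r} (norm h) \<partial>lborel)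
    = ennreal (DIM('a) * unit_ball_vol (real DIM('a)) * r powr a / a)"
proof -
  let ?C = "DIM('a) * unit_ball_vol (real DIM('a))"
  have hi: "((\<lambda>x. x powr (a - 1)) has_integral (r powr a / a)) {0..r}"
    using has_integral_powr_from_0[of "a - 1" r] assms by simp
  have "(\<integral>\<^sup>+h. ennreal (norm (h::'a) powr (a - real DIM('a))) * indicator {..r} (norm h) \<partial>lborel)
     = (\<integral>\<^sup>+t. ennreal ?C * (ennreal (t powr (a - 1)) * indicator {0..r} t) \<partial>lborel)"
    unfolding nn_integral_radial[where f = "\<lambda>t. ennreal (t powr (a - real DIM('a))) * indicator {..r} t", simplified]
  proof (intro nn_integral_cong_AE)
    have *: "ennreal (?C * t ^ (DIM('a) - Suc 0)) * indicator {0..} t * (ennreal (t powr (a - DIM('a))) * indicator {..r} t)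
      = ennreal ?C * (ennreal (t powr (a - 1)) * indicator {0..r} t)" if "t \<noteq> 0" for t
    proof (cases "0 < t \<and> t \<le> r")
      case True
      then have "?C * t ^ (DIM('a) - Suc 0) * t powr (a - DIM('a)) = ?C * t powr (a - 1)"
        using power_times_powr_Suc[of t "DIM('a)" a] by simp
      with True show ?thesis by (simp flip: ennreal_mult del: mult_cancel_left mult_cancel_right)
    qed (use that in \<open>auto split: split_indicator\<close>)
    show "AE t in lborel. ennreal (?C * t ^ (DIM('a) - Suc 0)) * indicator {0..} t * (ennreal (t powr (a - DIM('a))) * indicator {..r} t)
      = ennreal ?C * (ennreal (t powr (a - 1)) * indicator {0..r} t)"
      using AE_lborel_singleton[of 0] by eventually_elim (rule *)
  qed
  also have "\<dots> = ennreal ?C * ennreal (r powr a / a)"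
    using nn_integral_has_integral_lebesgue'[OF _ hi] by (subst nn_integral_cmult) auto
  finally show ?thesis using assms by (simp flip: ennreal_mult)
qed

lemma nn_integral_norm_powr_near_infinity:
  fixes a r :: real
  assumes "0 < a" "0 < r"
  shows "(\<integral>\<^sup>+h. ennreal (norm (h::'a::euclidean_space) powr (- a - real DIM('a))) * indicator {r..} (norm h) \<partial>lborel)
    = ennreal (DIM('a) * unit_ball_vol (real DIM('a)) * r powr (- a) / a)"
proof -
  let ?C = "DIM('a) * unit_ball_vol (real DIM('a))"
  have hi: "((\<lambda>x. x powr (- a - 1)) has_integral (r powr (- a) / a)) {r..}"
    using has_integral_powr_to_inf[of "- a - 1" r] assms by simp
  have "(\<integral>\<^sup>+h. ennreal (norm (h::'a) powr (- a - real DIM('a))) * indicator {r..} (norm h) \<partial>lborel)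
     = (\<integral>\<^sup>+t. ennreal ?C * (ennreal (t powr (- a - 1)) * indicator {r..} t) \<partial>lborel)"
    unfolding nn_integral_radial[where f = "\<lambda>t. ennreal (t powr (- a - real DIM('a))) * indicator {r..} t", simplified]
  proof (intro nn_integral_cong)
    fix t :: real
    show "ennreal (?C * t ^ (DIM('a) - Suc 0)) * indicator {0..} t * (ennreal (t powr (- a - DIM('a))) * indicator {r..} t)
      = ennreal ?C * (ennreal (t powr (- a - 1)) * indicator {r..} t)"
    proof (cases "t \<ge> r")
      case True
      then have "?C * t ^ (DIM('a) - Suc 0) * t powr (- a - DIM('a)) = ?C * t powr (- a - 1)"
        using power_times_powr_Suc[of t "DIM('a)" "-a"] assms by simp
      with True assms show ?thesis by (simp flip: ennreal_mult del: mult_cancel_left mult_cancel_right)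
    qed auto
  qed
  also have "\<dots> = ennreal ?C * ennreal (r powr (- a) / a)"
    using nn_integral_has_integral_lebesgue'[OF _ hi] by (subst nn_integral_cmult) auto
  finally show ?thesis using assms by (simp flip: ennreal_mult)
qed

text \<open>The critical exponent: minus the dimension is integrable neither at 0 nor at infinity.
  The ball of radius \<epsilon> contributes its volume times \<epsilon> powr (- dimension), a
  constant, and the shell between \<epsilon> and R contributes the logarithm. All logarithms in the
  energy bounds come from here.\<close>

lemma nn_integral_truncated_norm_powr_le:
  fixes \<epsilon> R :: real
  assumes "0 < \<epsilon>" "\<epsilon> \<le> R"
  shows "(\<integral>\<^sup>+h. ennreal (max \<epsilon> (norm (h::'a::euclidean_space)) powr (- real DIM('a))) * indicator {..R} (norm h) \<partial>lborel)
    \<le> ennreal (unit_ball_vol (real DIM('a)) * (1 + DIM('a) * ln (R / \<epsilon>)))"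
proof -
  let ?V = "unit_ball_vol (real DIM('a))"
  let ?C = "DIM('a) * ?V"
  have "(\<integral>\<^sup>+h. ennreal (max \<epsilon> (norm (h::'a)) powr (- real DIM('a))) * indicator {..R} (norm h) \<partial>lborel)
    = (\<integral>\<^sup>+r. ennreal (?C * r ^ (DIM('a) - 1)) * indicator {0..} r *
        (ennreal (max \<epsilon> r powr (- real DIM('a))) * indicator {..R} r) \<partial>lborel)"
    by (rule nn_integral_radial[where f = "\<lambda>t. ennreal (max \<epsilon> t powr (- real DIM('a))) * indicator {..R} t"]) simp
  also have "\<dots> \<le> (\<integral>\<^sup>+r. ennreal (?C * r ^ (DIM('a) - 1) * \<epsilon> powr (- real DIM('a))) * indicator {0..\<epsilon>} r
      + ennreal (?C / r) * indicator {\<epsilon>..R} r \<partial>lborel)"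
  proof (intro nn_integral_mono)
    fix r :: real
    consider "r < 0 \<or> r > R" | "0 \<le> r" "r \<le> \<epsilon>" | "\<epsilon> < r" "r \<le> R" by linarith
    then show "ennreal (?C * r ^ (DIM('a) - 1)) * indicator {0..} r *
        (ennreal (max \<epsilon> r powr (- real DIM('a))) * indicator {..R} r) \<le>
        ennreal (?C * r ^ (DIM('a) - 1) * \<epsilon> powr (- real DIM('a))) * indicator {0..\<epsilon>} r
      + ennreal (?C / r) * indicator {\<epsilon>..R} r"
    proof cases
      case 2
      then have "max \<epsilon> r = \<epsilon>" by simp
      with 2 assms show ?thesis by (simp add: max_def flip: ennreal_mult)
    next
      case 3
      have "?C * r ^ (DIM('a) - Suc 0) * r powr (- real DIM('a)) = ?C / r"
        using arg_cong[OF power_times_powr_Suc[of r "DIM('a)" 0], of "(*) ?C"] 3 assms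
        by (simp add: powr_minus_divide del: mult_cancel_left)
      with 3 assms show ?thesis
        by (simp add: max_def powr_minus_divide flip: ennreal_mult del: mult_cancel_left mult_cancel_right)
    qed (use assms in auto)
  qed
  also have "\<dots> = (\<integral>\<^sup>+r. ennreal (?C * r ^ (DIM('a) - 1) * \<epsilon> powr (- real DIM('a))) * indicator {0..\<epsilon>} r \<partial>lborel)
      + (\<integral>\<^sup>+r. ennreal (?C / r) * indicator {\<epsilon>..R} r \<partial>lborel)"
    by (intro nn_integral_add) auto
  also have "(\<integral>\<^sup>+r. ennreal (?C * r ^ (DIM('a) - 1) * \<epsilon> powr (- real DIM('a))) * indicator {0..\<epsilon>} r \<partial>lborel)
     = ?V * \<epsilon> ^ DIM('a) * \<epsilon> powr (- real DIM('a)) - ?V * 0 ^ DIM('a) * \<epsilon> powr (- real DIM('a))"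
    by (intro nn_integral_FTC_Icc) (use assms in \<open>auto intro!: derivative_eq_intros\<close>)
  also have "\<dots> = ennreal ?V"
    using assms by (simp add: powr_minus powr_realpow zero_power)
  also have "(\<integral>\<^sup>+r. ennreal (?C / r) * indicator {\<epsilon>..R} r \<partial>lborel) = ?C * ln R - ?C * ln \<epsilon>"
    by (intro nn_integral_FTC_Icc) (use assms in \<open>auto intro!: derivative_eq_intros\<close>)
  also have "ennreal ?V + ennreal (?C * ln R - ?C * ln \<epsilon>) = ennreal (?V + (?C * ln R - ?C * ln \<epsilon>))"
    using assms by (intro ennreal_plus[symmetric]) (auto intro!: mult_left_mono)
  also have "?V + (?C * ln R - ?C * ln \<epsilon>) = ?V * (1 + DIM('a) * ln (R / \<epsilon>))"
    using assms by (simp add: ln_div algebra_simps)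
  finally show ?thesis .
qed

section \<open>Sobolev norms\<close>

text \<open>The fractional seminorm without \<open>c_const\<close> and without the root, so that
  energies of different functions can be added.\<close>

definition gagliardo :: "real \<Rightarrow> real \<Rightarrow> (real^'n::finite) set \<Rightarrow> (real^'n \<Rightarrow> real) \<Rightarrow> ennreal" where
  "gagliardo s p \<Omega> u =
     (\<integral>\<^sup>+ (x, y). ennreal (\<bar>u x - u y\<bar> powr p / norm (x - y) powr (real CARD('n) + s * p))
        \<partial>(lebesgue_on \<Omega> \<Otimes>\<^sub>M lebesgue_on \<Omega>))"

lemma epowr_ennreal [simp]: "0 \<le> a \<Longrightarrow> epowr (ennreal a) r = ennreal (a powr r)"
  by (simp add: epowr_def)

lemma epowr_mono: "a \<le> b \<Longrightarrow> 0 < r \<Longrightarrow> epowr a r \<le> epowr b r"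
  unfolding epowr_def
  by (cases a; cases b) (auto simp: top_unique intro!: ennreal_leI powr_mono2)

lemma epowr_epowr: "epowr (epowr a r) t = epowr a (r * t)"
  by (cases a) (auto simp: epowr_def powr_powr)

lemma epowr_1 [simp]: "epowr a 1 = a"
  by (cases a) (auto simp: epowr_def)

lemma epowr_inverse_le_iff:
  assumes "0 < q" "0 \<le> B"
  shows "epowr a (1 / q) \<le> ennreal B \<longleftrightarrow> a \<le> ennreal (B powr q)"
proof
  assume "epowr a (1 / q) \<le> ennreal B"
  from epowr_mono[OF this \<open>0 < q\<close>] show "a \<le> ennreal (B powr q)"
    using assms by (simp add: epowr_epowr)
next
  assume "a \<le> ennreal (B powr q)"
  from epowr_mono[OF this, of "1 / q"] show "epowr a (1 / q) \<le> ennreal B"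
    using assms by (simp add: powr_powr)
qed

text \<open>The first Gamma argument is positive since p + N is at least 2 and p * s is positive.
  Positivity allows division by the constant when a norm bound is turned into an energy
  bound.\<close>

lemma c_const_pos:
  assumes "0 < s" "s < 1" "1 \<le> p" "1 \<le> N"
  shows "0 < c_const N s p"
proof -
  have "0 < p * s" using assms by simp
  moreover have "1 \<le> real N" using assms by simp
  ultimately have "0 < p * s + p + real N - 2" using assms(3) by linarith
  then have "0 < (p * s + p + real N - 2) / 2" by simp
  then have "0 < Gamma ((p * s + p + real N - 2) / 2)" by (rule Gamma_real_pos)
  moreover have "0 < Gamma (1 - s)" using assms by (intro Gamma_real_pos) simp
  ultimately show ?thesis using assms unfolding c_const_def by simp
qed

lemma sobolev_norm_fractional_eq:
  fixes u :: "real^'n::finite \<Rightarrow> real"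
  assumes "0 < s" "s < 1" "1 \<le> q"
  shows "sobolev_norm s (ereal q) \<Omega> u =
    epowr (ennreal (c_const CARD('n) s q) * gagliardo s q \<Omega> u
      + (\<integral>\<^sup>+ x. ennreal (\<bar>u x\<bar> powr q) \<partial>lebesgue_on \<Omega>)) (1 / q)"
  using assms
  by (simp add: sobolev_norm_def sobolev_seminorm_def Lp_norm_def epowr_epowr gagliardo_def)

lemma sobolev_norm_fractional_le:
  fixes u :: "real^'n::finite \<Rightarrow> real"
  assumes s: "0 < s" "s < 1" "1 \<le> p" and A: "0 \<le> A"
    and u: "u \<in> borel_measurable (lebesgue_on \<Omega>)"
    and E: "gagliardo s p \<Omega> u \<le> ennreal A" "(\<integral>\<^sup>+ x. ennreal (\<bar>u x\<bar> powr p) \<partial>lebesgue_on \<Omega>) \<le> ennreal A"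
  shows "u \<in> sobolev_space s (ereal p) \<Omega> \<and>
    sobolev_norm s (ereal p) \<Omega> u \<le> ennreal (((c_const CARD('n) s p + 1) * A) powr (1 / p))"
proof -
  have c: "0 < c_const CARD('n) s p" using s by (intro c_const_pos) (auto simp: Suc_leI)
  have 1: "ennreal (c_const CARD('n) s p) * gagliardo s p \<Omega> u \<le> ennreal (c_const CARD('n) s p * A)"
    using c A mult_left_mono[OF E(1), of "ennreal (c_const CARD('n) s p)"] by (simp add: ennreal_mult)
  have fin: "epowr a r < \<infinity>" if "a \<le> ennreal b" for a b r
    using that by (auto simp: epowr_def top_unique)
  have "ennreal (c_const CARD('n) s p) * gagliardo s p \<Omega> u + (\<integral>\<^sup>+ x. ennreal (\<bar>u x\<bar> powr p) \<partial>lebesgue_on \<Omega>)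
    \<le> ennreal ((c_const CARD('n) s p + 1) * A)"
    using add_mono[OF 1 E(2)] c A by (simp add: algebra_simps flip: ennreal_plus)
  then have "sobolev_norm s (ereal p) \<Omega> u \<le> ennreal (((c_const CARD('n) s p + 1) * A) powr (1 / p))"
    unfolding sobolev_norm_fractional_eq[OF s]
    using s A c by (subst epowr_inverse_le_iff) (auto simp: powr_powr)
  then show ?thesis
    using u s fin[OF E(2)] fin[OF 1]
    by (auto simp: sobolev_space_def Lp_norm_def sobolev_seminorm_def gagliardo_def)
qed

lemma gagliardo_le_of_sobolev_norm_le:
  fixes v :: "real^'n::finite \<Rightarrow> real"
  assumes s: "0 < s" "s < 1" "1 \<le> q" and "0 \<le> B"
    and "sobolev_norm s (ereal q) \<Omega> v \<le> ennreal B"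
  shows "gagliardo s q \<Omega> v \<le> ennreal (B powr q / c_const CARD('n) s q)"
proof -
  have c: "0 < c_const CARD('n) s q" using s by (intro c_const_pos) (auto simp: Suc_leI)
  have "ennreal (c_const CARD('n) s q) * gagliardo s q \<Omega> v
      + (\<integral>\<^sup>+ x. ennreal (\<bar>v x\<bar> powr q) \<partial>lebesgue_on \<Omega>) \<le> ennreal (B powr q)"
    using assms unfolding sobolev_norm_fractional_eq[OF s] by (subst (asm) epowr_inverse_le_iff) auto
  then have *: "ennreal (c_const CARD('n) s q) * gagliardo s q \<Omega> v \<le> ennreal (B powr q)"
    by (rule order_trans[rotated]) (rule add_increasing2[OF zero_le order_refl])
  show ?thesis
  proof (cases "gagliardo s q \<Omega> v")
    case (real r)
    with * c show ?thesis by (simp add: field_simps flip: ennreal_mult)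
  next
    case top
    with * c show ?thesis by (simp add: ennreal_mult_top top_unique)
  qed
qed

lemma sobolev_norm_gradient_le:
  fixes u :: "real^'n::finite \<Rightarrow> real"
  assumes p: "1 \<le> p" and A: "0 \<le> A" and u: "u \<in> borel_measurable (lebesgue_on \<Omega>)"
    and g: "weak_gradient \<Omega> u g"
    and E: "(\<integral>\<^sup>+ x. ennreal (norm (g x) powr p) \<partial>lebesgue_on \<Omega>) \<le> ennreal A"
      "(\<integral>\<^sup>+ x. ennreal (\<bar>u x\<bar> powr p) \<partial>lebesgue_on \<Omega>) \<le> ennreal A"
  shows "u \<in> sobolev_space 1 (ereal p) \<Omega> \<and> sobolev_norm 1 (ereal p) \<Omega> u \<le> ennreal ((2 * A) powr (1 / p))"
proof -
  have s: "sobolev_seminorm 1 p \<Omega> u \<le> epowr (\<integral>\<^sup>+ x. ennreal (norm (g x) powr p) \<partial>lebesgue_on \<Omega>) (1 / p)"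
    unfolding sobolev_seminorm_def using g by (auto simp: Lp_norm_def intro!: INF_lower2[of g])
  also have "\<dots> \<le> ennreal (A powr (1 / p))"
    using epowr_mono[OF E(1), of "1 / p"] p A by simp
  finally have 1: "sobolev_seminorm 1 p \<Omega> u \<le> ennreal (A powr (1 / p))" .
  have 2: "Lp_norm (ereal p) \<Omega> u \<le> ennreal (A powr (1 / p))"
    using epowr_mono[OF E(2), of "1 / p"] p A by (simp add: Lp_norm_def)
  have "sobolev_norm 1 (ereal p) \<Omega> u =
    epowr (epowr (sobolev_seminorm 1 p \<Omega> u) p + epowr (Lp_norm (ereal p) \<Omega> u) p) (1 / p)"
    by (simp add: sobolev_norm_def)
  also have "\<dots> \<le> ennreal ((2 * A) powr (1 / p))"
    using add_mono[OF epowr_mono[OF 1, of p] epowr_mono[OF 2, of p]] p A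
    by (subst epowr_inverse_le_iff) (auto simp: powr_powr simp flip: ennreal_plus)
  finally show ?thesis
    using u 1 2 by (auto simp: sobolev_space_def intro: le_less_trans)
qed

text \<open>The seminorm of order 1 is an infimum, so a near-minimizer is chosen; the strict slack
  \<open>B + 1\<close> is what guarantees one. This is the origin of the \<open>+ 1\<close> in the
  later growth comparison.\<close>

lemma weak_gradient_of_sobolev_norm_le:
  fixes v :: "real^'n::finite \<Rightarrow> real"
  assumes q: "1 \<le> q" and B: "0 \<le> B" and v: "sobolev_norm 1 (ereal q) \<Omega> v \<le> ennreal B"
  obtains g where "weak_gradient \<Omega> v g"
    "(\<integral>\<^sup>+ x. ennreal (norm (g x) powr q) \<partial>lebesgue_on \<Omega>) \<le> ennreal ((B + 1) powr q)"
proof -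
  have "epowr (epowr (sobolev_seminorm 1 q \<Omega> v) q + epowr (Lp_norm (ereal q) \<Omega> v) q) (1 / q) \<le> ennreal B"
    using v by (simp add: sobolev_norm_def)
  then have "epowr (sobolev_seminorm 1 q \<Omega> v) q + epowr (Lp_norm (ereal q) \<Omega> v) q \<le> ennreal (B powr q)"
    using q B by (subst (asm) epowr_inverse_le_iff) auto
  then have "epowr (sobolev_seminorm 1 q \<Omega> v) q \<le> ennreal (B powr q)"
    by (rule order_trans[rotated]) (rule add_increasing2[OF zero_le order_refl])
  from epowr_mono[OF this, of "1 / q"] have "sobolev_seminorm 1 q \<Omega> v \<le> ennreal B"
    using q B by (simp add: epowr_epowr powr_powr)
  also have "\<dots> < ennreal (B + 1)" using B by (simp add: ennreal_less_iff)
  finally have "(INF g\<in>{g. weak_gradient \<Omega> v g}. Lp_norm (ereal q) \<Omega> g) < ennreal (B + 1)"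
    by (simp add: sobolev_seminorm_def)
  then obtain g where g: "weak_gradient \<Omega> v g" "Lp_norm (ereal q) \<Omega> g < ennreal (B + 1)"
    by (auto simp: INF_less_iff)
  then have "(\<integral>\<^sup>+ x. ennreal (norm (g x) powr q) \<partial>lebesgue_on \<Omega>) \<le> ennreal ((B + 1) powr q)"
    using q B by (subst epowr_inverse_le_iff[symmetric]) (auto simp: Lp_norm_def)
  with g(1) show thesis by (rule that)
qed

text \<open>The essential supremum is a summand of the norm for every s, so all targets with
  exponent infinity can be treated at once and the Hoelder part is discarded.\<close>

lemma AE_le_of_sobolev_norm_infinity_le:
  assumes "0 \<le> B" "sobolev_norm s \<infinity> \<Omega> v \<le> ennreal B"
  shows "AE x in lebesgue_on \<Omega>. \<bar>v x\<bar> \<le> B"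
proof -
  have "Lp_norm \<infinity> \<Omega> v \<le> sobolev_norm s \<infinity> \<Omega> v"
    by (auto simp: sobolev_norm_def)
  also note assms(2)
  finally have le: "esssup (lebesgue_on \<Omega>) (\<lambda>x. ennreal (norm (v x))) \<le> ennreal B"
    by (simp add: Lp_norm_def)
  show ?thesis
    using esssup_AE[where M = "lebesgue_on \<Omega>" and f = "\<lambda>x. ennreal (norm (v x))"]
    by eventually_elim (use le assms(1) in \<open>auto dest: order_trans\<close>)
qed

lemma continuously_embeddedE:
  assumes "continuously_embedded \<Omega> s p s' p'"
  obtains C where "0 \<le> C" "\<And>u B. u \<in> sobolev_space s p \<Omega> \<Longrightarrow> sobolev_norm s p \<Omega> u \<le> ennreal B \<Longrightarrow> 0 \<le> B \<Longrightarrow>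
    \<exists>v\<in>sobolev_space s' p' \<Omega>. (AE x in lebesgue_on \<Omega>. v x = u x) \<and> sobolev_norm s' p' \<Omega> v \<le> ennreal (C * B)"
proof -
  obtain C :: real where C: "\<And>u. u \<in> sobolev_space s p \<Omega> \<Longrightarrow> \<exists>v\<in>sobolev_space s' p' \<Omega>.
        (AE x in lebesgue_on \<Omega>. v x = u x) \<and> sobolev_norm s' p' \<Omega> v \<le> ennreal C * sobolev_norm s p \<Omega> u"
    using assms unfolding continuously_embedded_def by blast
  \<comment> \<open>A negative constant acts as 0 under \<open>ennreal\<close>, so truncating it at
    0 changes nothing.\<close>
  show thesis
  proof (rule that[of "max C 0"])
    fix u and B :: real
    assume u: "u \<in> sobolev_space s p \<Omega>" "sobolev_norm s p \<Omega> u \<le> ennreal B" "0 \<le> B"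
    obtain v where v: "v\<in>sobolev_space s' p' \<Omega>" "AE x in lebesgue_on \<Omega>. v x = u x"
      "sobolev_norm s' p' \<Omega> v \<le> ennreal C * sobolev_norm s p \<Omega> u"
      using C[OF u(1)] by blast
    have "sobolev_norm s' p' \<Omega> v \<le> ennreal (max C 0) * ennreal B"
      using v(3) u(2) by (elim order_trans) (auto intro!: mult_mono simp: ennreal_neg max_def)
    also have "\<dots> = ennreal (max C 0 * B)" using u(3) by (simp add: ennreal_mult)
    finally show "\<exists>v\<in>sobolev_space s' p' \<Omega>. (AE x in lebesgue_on \<Omega>. v x = u x) \<and> sobolev_norm s' p' \<Omega> v \<le> ennreal (max C 0 * B)"
      using v by blast
  qed simp
qed

section \<open>Test functions and weak gradients\<close>

text \<open>The whole family in m is introduced because it is closed under differentiation up to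
  linear combinations, whereas exp (- 1 / t) alone is not.\<close>

definition expbump :: "nat \<Rightarrow> real \<Rightarrow> real" where
  "expbump m t = (if t \<le> 0 then 0 else inverse t ^ m * exp (- inverse t))"

lemma DERIV_expbump:
  "(expbump m has_real_derivative (expbump (m + 2) t - real m * expbump (m + 1) t)) (at t)"
proof -
  consider "t < 0" | "t > 0" | "t = 0" by linarith
  then show ?thesis
  proof cases
    case 1
    have "((\<lambda>_. 0) has_real_derivative (expbump (m + 2) t - real m * expbump (m + 1) t)) (at t)"
      using 1 by (simp add: expbump_def)
    then show ?thesis
      by (rule has_field_derivative_transform_within_open[of _ _ _ "{..<0}"])
         (use 1 in \<open>auto simp: expbump_def\<close>)
  next
    case 2
    have "((\<lambda>t. inverse t ^ m * exp (- inverse t)) has_real_derivative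
        (expbump (m + 2) t - real m * expbump (m + 1) t)) (at t)"
    proof -
      \<comment> \<open>For m = 0 the truncated exponent m - 1 is wrong, but the factor
        \<open>real m\<close> removes the term.\<close>
      have "real m * (- (inverse t ^ 2) * inverse t ^ (m - 1)) = - real m * inverse t ^ (m + 1)"
        by (cases m) (simp_all add: power2_eq_square ring_distribs mult.assoc)
      moreover have "((\<lambda>t. inverse t ^ m) has_real_derivative real m * (- (inverse t ^ 2) * inverse t ^ (m - 1))) (at t)"
        using DERIV_power[OF DERIV_inverse[of t UNIV], of m] 2 by (simp add: numeral_2_eq_2)
      ultimately have "((\<lambda>t. inverse t ^ m) has_real_derivative - real m * inverse t ^ (m + 1)) (at t)"
        by (simp only:)
      moreover have "((\<lambda>t. exp (- inverse t)) has_real_derivative inverse t ^ 2 * exp (- inverse t)) (at t)"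
        using 2 by (auto intro!: derivative_eq_intros simp: power2_eq_square)
      ultimately have "((\<lambda>t. inverse t ^ m * exp (- inverse t)) has_real_derivative
          (- real m * inverse t ^ (m + 1)) * exp (- inverse t) + inverse t ^ 2 * exp (- inverse t) * inverse t ^ m) (at t)"
        by (rule DERIV_mult)
      moreover have "(- real m * inverse t ^ (m + 1)) * exp (- inverse t) + inverse t ^ 2 * exp (- inverse t) * inverse t ^ m
          = expbump (m + 2) t - real m * expbump (m + 1) t"
        using 2 by (simp add: expbump_def power2_eq_square)
      ultimately show ?thesis by simp
    qed
    then show ?thesis
      by (rule has_field_derivative_transform_within_open[of _ _ _ "{0<..}"])
         (use 2 in \<open>auto simp: expbump_def\<close>)
  next
    case 3
    have "((\<lambda>h. expbump m h / h) \<longlongrightarrow> 0) (at 0)"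
    proof (rule filterlim_split_at)
      show "((\<lambda>h. expbump m h / h) \<longlongrightarrow> 0) (at_left 0)"
        by (rule tendsto_eventually) (auto simp: expbump_def eventually_at_filter)
      \<comment> \<open>With x = 1 / h the difference quotient at 0 is x ^ (m + 1) / exp x, and x
        tends to infinity.\<close>
      have "((\<lambda>h. inverse h ^ (m + 1) / exp (inverse h)) \<longlongrightarrow> (0::real)) (at_right 0)"
        by (rule filterlim_compose[OF tendsto_power_div_exp_0 filterlim_inverse_at_top_right])
      then show "((\<lambda>h. expbump m h / h) \<longlongrightarrow> 0) (at_right 0)"
        by (rule Lim_transform_eventually)
           (auto simp: expbump_def eventually_at_filter exp_minus field_simps)
    qed
    then show ?thesis using 3 by (simp add: DERIV_def expbump_def)
  qed
qed

lemma expbump_0_bounds: "0 \<le> expbump 0 t" "expbump 0 t \<le> 1"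
  by (auto simp: expbump_def)

text \<open>A class whose partial derivatives stay in the class, so \<open>C_k k\<close> follows for
  all k by one induction and no higher derivative is ever computed. Sine and cosine are included
  because some test functions are a bump times a wave.\<close>

inductive smooth_expr :: "(real^'n::finite \<Rightarrow> real) \<Rightarrow> bool" where
  const: "smooth_expr (\<lambda>x. c)"
| coord: "smooth_expr (\<lambda>x. x $ i)"
| add: "smooth_expr f \<Longrightarrow> smooth_expr g \<Longrightarrow> smooth_expr (\<lambda>x. f x + g x)"
| mult: "smooth_expr f \<Longrightarrow> smooth_expr g \<Longrightarrow> smooth_expr (\<lambda>x. f x * g x)"
| expbump: "smooth_expr f \<Longrightarrow> smooth_expr (\<lambda>x. expbump m (f x))"
| sin: "smooth_expr f \<Longrightarrow> smooth_expr (\<lambda>x. sin (f x))"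
| cos: "smooth_expr f \<Longrightarrow> smooth_expr (\<lambda>x. cos (f x))"

lemma smooth_expr_sum:
  "finite I \<Longrightarrow> (\<And>i. i \<in> I \<Longrightarrow> smooth_expr (f i)) \<Longrightarrow> smooth_expr (\<lambda>x. \<Sum>i\<in>I. f i x)"
  by (induction I rule: finite_induct) (auto intro: smooth_expr.intros)

lemma smooth_expr_has_derivative:
  fixes f :: "real^'n::finite \<Rightarrow> real"
  assumes "smooth_expr f"
  shows "\<exists>D. (\<forall>x. (f has_derivative (\<lambda>h. \<Sum>i\<in>UNIV. D i x * h $ i)) (at x)) \<and> (\<forall>i. smooth_expr (D i))"
  using assms
proof induction
  case (const c)
  show ?case by (rule exI[of _ "\<lambda>i x. 0"]) (auto intro: smooth_expr.intros)
next
  case (coord j)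
  have "(\<Sum>i\<in>UNIV. (if i = j then 1 else 0) * h $ i) = (\<Sum>i\<in>UNIV. if i = j then h $ i else 0)" for h :: "real^'n"
    by (intro sum.cong) auto
  then show ?case
    by (intro exI[of _ "\<lambda>i x. if i = j then 1 else 0"])
       (auto intro: smooth_expr.intros bounded_linear_imp_has_derivative bounded_linear_vec_nth)
next
  case (add f g)
  then obtain D E where D: "\<And>x. (f has_derivative (\<lambda>h. \<Sum>i\<in>UNIV. D i x * h $ i)) (at x)" "\<And>i. smooth_expr (D i)"
    and E: "\<And>x. (g has_derivative (\<lambda>h. \<Sum>i\<in>UNIV. E i x * h $ i)) (at x)" "\<And>i. smooth_expr (E i)"
    by blast
  have "((\<lambda>x. f x + g x) has_derivative (\<lambda>h. \<Sum>i\<in>UNIV. (D i x + E i x) * h $ i)) (at x)" for x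
    using has_derivative_add[OF D(1)[of x] E(1)[of x]] by (simp add: sum.distrib algebra_simps)
  then show ?case
    using D(2) E(2) by (intro exI[of _ "\<lambda>i x. D i x + E i x"]) (auto intro: smooth_expr.intros)
next
  case (mult f g)
  then obtain D E where D: "\<And>x. (f has_derivative (\<lambda>h. \<Sum>i\<in>UNIV. D i x * h $ i)) (at x)" "\<And>i. smooth_expr (D i)"
    and E: "\<And>x. (g has_derivative (\<lambda>h. \<Sum>i\<in>UNIV. E i x * h $ i)) (at x)" "\<And>i. smooth_expr (E i)"
    by blast
  have "((\<lambda>x. f x * g x) has_derivative (\<lambda>h. \<Sum>i\<in>UNIV. (f x * E i x + D i x * g x) * h $ i)) (at x)" for x
    using has_derivative_mult[OF D(1)[of x] E(1)[of x]]
    by (simp add: sum.distrib sum_distrib_left sum_distrib_right algebra_simps)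
  then show ?case
    using D(2) E(2) mult.hyps
    by (intro exI[of _ "\<lambda>i x. f x * E i x + D i x * g x"]) (auto intro!: smooth_expr.intros)
next
  case (expbump f m)
  then obtain D where D: "\<And>x. (f has_derivative (\<lambda>h. \<Sum>i\<in>UNIV. D i x * h $ i)) (at x)" "\<And>i. smooth_expr (D i)"
    by blast
  let ?E = "\<lambda>i x. (expbump (m + 2) (f x) + (- real m) * expbump (m + 1) (f x)) * D i x"
  have "((\<lambda>x. expbump m (f x)) has_derivative (\<lambda>h. \<Sum>i\<in>UNIV. ?E i x * h $ i)) (at x)" for x
    using DERIV_compose_FDERIV[OF DERIV_expbump D(1)[of x]]
    by (simp add: sum_distrib_left mult_ac algebra_simps sum_subtractf)
  moreover have "smooth_expr (?E i)" for i
    using D(2) expbump.hyps by (intro smooth_expr.intros)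
  ultimately show ?case by (intro exI[of _ ?E]) blast
next
  case (sin f)
  then obtain D where D: "\<And>x. (f has_derivative (\<lambda>h. \<Sum>i\<in>UNIV. D i x * h $ i)) (at x)" "\<And>i. smooth_expr (D i)"
    by blast
  have "((\<lambda>x. sin (f x)) has_derivative (\<lambda>h. \<Sum>i\<in>UNIV. (cos (f x) * D i x) * h $ i)) (at x)" for x
    using DERIV_compose_FDERIV[OF DERIV_sin D(1)[of x]] by (simp add: sum_distrib_left mult_ac)
  then show ?case
    using D(2) sin.hyps by (intro exI[of _ "\<lambda>i x. cos (f x) * D i x"]) (auto intro!: smooth_expr.intros)
next
  case (cos f)
  then obtain D where D: "\<And>x. (f has_derivative (\<lambda>h. \<Sum>i\<in>UNIV. D i x * h $ i)) (at x)" "\<And>i. smooth_expr (D i)"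
    by blast
  let ?E = "\<lambda>i x. (- 1) * (sin (f x) * D i x)"
  have "((\<lambda>x. cos (f x)) has_derivative (\<lambda>h. \<Sum>i\<in>UNIV. ?E i x * h $ i)) (at x)" for x
    using DERIV_compose_FDERIV[OF DERIV_cos D(1)[of x]]
    by (simp add: sum_distrib_left mult_ac sum_negf)
  moreover have "smooth_expr (?E i)" for i
    by (intro smooth_expr.const smooth_expr.mult smooth_expr.sin D(2) cos.hyps)
  ultimately show ?case by (intro exI[of _ ?E]) blast
qed

lemma partial_deriv_eq:
  assumes "(f has_derivative (\<lambda>h. \<Sum>i\<in>UNIV. D i * h $ i)) (at x)"
  shows "partial_deriv i f x = D i"
proof -
  have "frechet_derivative f (at x) = (\<lambda>h. \<Sum>i\<in>UNIV. D i * h $ i)"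
    by (rule frechet_derivative_at[OF assms, symmetric])
  moreover have "(\<Sum>j\<in>UNIV. D j * axis i 1 $ j) = (\<Sum>j\<in>UNIV. if j = i then D j else 0)"
    by (intro sum.cong) (auto simp: axis_def)
  ultimately show ?thesis by (simp add: partial_deriv_def)
qed

lemma smooth_expr_imp_C_k: "smooth_expr f \<Longrightarrow> C_k k f"
proof (induction k arbitrary: f)
  case 0
  then obtain D where "\<And>x. (f has_derivative (\<lambda>h. \<Sum>i\<in>UNIV. D i x * h $ i)) (at x)"
    using smooth_expr_has_derivative by blast
  then show ?case
    by (auto intro!: continuous_at_imp_continuous_on has_derivative_continuous)
next
  case (Suc k)
  obtain D where D: "\<And>x. (f has_derivative (\<lambda>h. \<Sum>i\<in>UNIV. D i x * h $ i)) (at x)" "\<And>i. smooth_expr (D i)"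
    using smooth_expr_has_derivative[OF Suc.prems] by blast
  have "partial_deriv i f = D i" for i
    using partial_deriv_eq[OF D(1)] by blast
  moreover have "f differentiable_on UNIV"
    using D(1) by (auto simp: differentiable_on_def differentiable_def)
  ultimately show ?case using Suc.IH D(2) by simp
qed

text \<open>The squared norm makes the argument a polynomial in the coordinates, which keeps the
  bump inside \<open>smooth_expr\<close>.\<close>

definition bump :: "real^'n::finite \<Rightarrow> real \<Rightarrow> real^'n \<Rightarrow> real" where
  "bump z r x = expbump 0 (1 - (norm (x - z) / r)\<^sup>2)"

lemma smooth_expr_bump: "smooth_expr (bump z r)"
proof -
  have "bump z r = (\<lambda>x. expbump 0 (1 + (- 1 / r\<^sup>2) * (\<Sum>i\<in>UNIV. (x $ i + - z $ i) * (x $ i + - z $ i))))"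
    by (simp add: bump_def fun_eq_iff power_divide norm_eq_sqrt_inner inner_vec_def real_sqrt_pow2 sum_nonneg)
  moreover have "smooth_expr (\<lambda>x. expbump 0 (1 + (- 1 / r\<^sup>2) * (\<Sum>i\<in>UNIV. (x $ i + - z $ i) * (x $ i + - z $ i))))"
    by (intro smooth_expr.intros smooth_expr_sum) auto
  ultimately show ?thesis by simp
qed

lemma bump_bounds: "0 \<le> bump z r x" "bump z r x \<le> 1"
  by (simp_all add: bump_def expbump_0_bounds)

lemma bump_eq_0: "0 < r \<Longrightarrow> r \<le> norm (x - z) \<Longrightarrow> bump z r x = 0"
  by (simp add: bump_def expbump_def one_le_power)

text \<open>On the half ball the argument of \<open>expbump 0\<close> is at least 3 / 4, and the
  exponent is minus its inverse.\<close>

lemma bump_ge: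
  assumes "0 < r" "norm (x - z) \<le> r / 2"
  shows "exp (- 4 / 3) \<le> bump z r x"
proof -
  have "norm (x - z) / r \<le> 1 / 2" using assms by (simp add: field_simps)
  then have "(norm (x - z) / r)\<^sup>2 \<le> (1 / 2)\<^sup>2" by (rule power_mono) (use assms in simp)
  then have t: "1 - (norm (x - z) / r)\<^sup>2 \<ge> 3 / 4" by (simp add: power2_eq_square)
  then have "inverse (1 - (norm (x - z) / r)\<^sup>2) \<le> inverse (3 / 4)"
    by (intro le_imp_inverse_le) auto
  with t show ?thesis by (simp add: bump_def expbump_def)
qed

lemma test_functionI:
  assumes f: "smooth_expr f" and sub: "cball z r \<subseteq> \<Omega>" and 0: "\<And>x. r \<le> norm (x - z) \<Longrightarrow> f x = 0"
  shows "test_function \<Omega> f"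
proof -
  have "{x. f x \<noteq> 0} \<subseteq> cball z r"
    using 0 by (force simp: dist_norm norm_minus_commute)
  then have *: "closure {x. f x \<noteq> 0} \<subseteq> cball z r"
    by (rule closure_minimal) simp
  then have "compact (closure {x. f x \<noteq> 0})"
    by (meson bounded_cball bounded_subset closed_closure compact_eq_bounded_closed)
  with * sub show ?thesis
    using smooth_expr_imp_C_k[OF f] by (auto simp: test_function_def)
qed

section \<open>Integration by parts, and lower bounds for weak gradients by testing\<close>

lemma nn_integral_lebesgue_on_eq:
  assumes "\<Omega> \<in> sets lebesgue"
  shows "(\<integral>\<^sup>+x. f x \<partial>lebesgue_on \<Omega>) = (\<integral>\<^sup>+x. f x * indicator \<Omega> x \<partial>lborel)"
  using assms by (simp add: nn_integral_restrict_space nn_integral_completion)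

lemma continuous_locally_integrable_on:
  fixes f :: "real^'n::finite \<Rightarrow> 'b::{banach, second_countable_topology}"
  assumes "continuous_on UNIV f"
  shows "locally_integrable_on f \<Omega>"
  unfolding locally_integrable_on_def
proof (intro allI impI)
  fix K assume K: "compact K \<and> K \<subseteq> \<Omega>"
  then have "integrable lborel (\<lambda>x. indicator K x *\<^sub>R f x)"
    using assms by (intro borel_integrable_compact) (auto intro: continuous_on_subset)
  moreover from this have "(\<lambda>x. indicator K x *\<^sub>R f x) \<in> borel_measurable lborel" by simp
  ultimately have "integrable lebesgue (\<lambda>x. indicator K x *\<^sub>R f x)"
    by (simp add: integrable_completion)
  then show "integrable (lebesgue_on K) f"
    using K by (subst integrable_restrict_space) (auto intro: fmeasurableD lmeasurable_compact)
qed

lemma lebesgue_on_integral_of_support: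
  fixes f :: "real^'n::finite \<Rightarrow> real"
  assumes [measurable]: "f \<in> borel_measurable borel" and "\<Omega> \<in> sets lebesgue" and 0: "\<And>x. x \<notin> \<Omega> \<Longrightarrow> f x = 0"
  shows "(LINT x|lebesgue_on \<Omega>. f x) = (LINT x|lborel. f x)"
proof -
  have "(\<lambda>x. indicator \<Omega> x *\<^sub>R f x) = f"
    using 0 by (auto simp: indicator_def fun_eq_iff)
  moreover have "integral\<^sup>L lebesgue f = integral\<^sup>L lborel f"
    by (rule integral_completion) simp
  moreover have "\<Omega> \<inter> space lebesgue \<in> sets lebesgue" using assms(2) by simp
  ultimately show ?thesis by (simp only: integral_restrict_space)
qed

lemma integral_lborel_translation:
  fixes f :: "'a::euclidean_space \<Rightarrow> real"
  assumes "f \<in> borel_measurable borel"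
  shows "(LINT x|lborel. f (x + c)) = (LINT x|lborel. f x)"
proof -
  have "(LINT x|lborel. f x) = (LINT x|distr lborel borel ((+) c). f x)"
    by (simp add: lborel_distr_plus)
  also have "\<dots> = (LINT x|lborel. f (c + x))"
    using assms by (intro integral_distr) auto
  finally show ?thesis by (simp add: add.commute)
qed

lemma integrable_lborel_translation:
  fixes f :: "'a::euclidean_space \<Rightarrow> real"
  assumes "integrable lborel f"
  shows "integrable lborel (\<lambda>x. f (x + c))"
proof -
  have "integrable (distr lborel borel ((+) c)) f"
    using assms by (simp add: lborel_distr_plus)
  then have "integrable lborel (\<lambda>x. f (c + x))"
    using assms by (subst (asm) integrable_distr_eq) auto
  then show ?thesis by (simp add: add.commute)
qed

text \<open>By translation invariance every difference quotient of F in direction e has integral 0,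
  and the quotients converge to D. This replaces Fubini and the one-dimensional fundamental
  theorem.\<close>

lemma integral_directional_derivative_eq_0:
  fixes F D :: "'a::euclidean_space \<Rightarrow> real"
  assumes F: "continuous_on UNIV F" and D: "continuous_on UNIV D"
    and der: "\<And>x t. ((\<lambda>t. F (x + t *\<^sub>R e)) has_real_derivative D (x + t *\<^sub>R e)) (at t)"
    and 0: "\<And>x. R < norm x \<Longrightarrow> F x = 0" "\<And>x. R < norm x \<Longrightarrow> D x = 0"
  shows "(LINT x|lborel. D x) = 0"
proof -
  have int: "integrable lborel f" if "continuous_on UNIV f" "\<And>x. R < norm x \<Longrightarrow> f x = 0" for f :: "'a \<Rightarrow> real"
  proof -
    have "integrable lborel (\<lambda>x. indicator (cball 0 R) x *\<^sub>R f x)"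
      using that(1) by (intro borel_integrable_compact) (auto intro: continuous_on_subset)
    moreover have "(\<lambda>x. indicator (cball 0 R) x *\<^sub>R f x) = f"
      using that(2) by (auto simp: indicator_def fun_eq_iff)
    ultimately show ?thesis by (simp only:)
  qed
  have [measurable]: "F \<in> borel_measurable borel" "D \<in> borel_measurable borel"
    using F D by (auto intro: borel_measurable_continuous_onI)
  obtain M where M: "\<And>x. \<bar>D x\<bar> \<le> M"
  proof -
    have "compact (D ` cball 0 R)"
      using D by (intro compact_continuous_image) (auto intro: continuous_on_subset)
    then have "bounded (D ` cball 0 R)" by (rule compact_imp_bounded)
    then obtain B where B: "\<And>x. x \<in> cball 0 R \<Longrightarrow> norm (D x) \<le> B"
      unfolding bounded_iff by blast
    show thesis
    proof (rule that[of "max B 0"])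
      show "\<bar>D x\<bar> \<le> max B 0" for x
        using B[of x] 0(2)[of x] by (cases "norm x \<le> R") auto
    qed
  qed
  define h where "h n = inverse (real (Suc n))" for n
  have h: "0 < h n" "h n \<le> 1" for n by (auto simp: h_def inverse_le_1_iff)
  have h0: "filterlim h (at 0) sequentially"
  proof -
    have "h = (\<lambda>n. inverse (real (Suc n)))" by (simp add: fun_eq_iff h_def)
    then have "h \<longlonglongrightarrow> 0" using LIMSEQ_inverse_real_of_nat by (simp only:)
    then show ?thesis unfolding filterlim_at using h(1) by (auto simp: less_imp_neq[THEN not_sym])
  qed
  let ?s = "\<lambda>n x. (F (x + h n *\<^sub>R e) - F x) / h n"
  \<comment> \<open>The steps \<open>h n\<close> are at most 1, so all quotients vanish outside the
    ball of radius R + norm e; inside it the mean value theorem bounds them by the supremum M of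
    D.\<close>
  have "(\<lambda>n. LINT x|lborel. ?s n x) \<longlonglongrightarrow> (LINT x|lborel. D x)"
  proof (rule integral_dominated_convergence[where w = "\<lambda>x. indicator (cball 0 (R + norm e)) x *\<^sub>R M"])
    show "integrable lborel (\<lambda>x::'a. indicator (cball 0 (R + norm e)) x *\<^sub>R M)"
      by (intro borel_integrable_compact) auto
    show "AE x in lborel. (\<lambda>n. ?s n x) \<longlonglongrightarrow> D x"
    proof (rule AE_I2)
      fix x
      have "((\<lambda>t. (F (x + t *\<^sub>R e) - F x) / t) \<longlongrightarrow> D x) (at 0)"
        using der[of x 0] by (simp add: DERIV_def)
      from filterlim_compose[OF this h0] show "(\<lambda>n. ?s n x) \<longlonglongrightarrow> D x" .
    qed
    show "AE x in lborel. norm (?s n x) \<le> indicator (cball 0 (R + norm e)) x *\<^sub>R M" for n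
    proof (rule AE_I2)
      fix x
      show "norm (?s n x) \<le> indicator (cball 0 (R + norm e)) x *\<^sub>R M"
      proof (cases "norm x \<le> R + norm e")
        case True
        obtain t where "F (x + h n *\<^sub>R e) - F (x + 0 *\<^sub>R e) = (h n - 0) * D (x + t *\<^sub>R e)"
          using MVT2[of 0 "h n" "\<lambda>t. F (x + t *\<^sub>R e)" "\<lambda>t. D (x + t *\<^sub>R e)"] der h(1) by blast
        then show ?thesis using True M[of "x + t *\<^sub>R e"] h(1)[of n] by simp
      next
        case False
        have "norm (h n *\<^sub>R e) \<le> norm e"
          using mult_right_mono[OF h(2)[of n], of "norm e"] h(1)[of n] by simp
        then have "R < norm (x + h n *\<^sub>R e)" "R < norm x"
          using False norm_triangle_ineq4[of "x + h n *\<^sub>R e" "h n *\<^sub>R e"] norm_ge_zero[of e] by (auto simp del: norm_scaleR norm_ge_zero)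
        then show ?thesis using 0(1) False by simp
      qed
    qed
  qed measurable
  moreover have s0: "(LINT x|lborel. ?s n x) = 0" for n
    using int[OF F 0(1)] integrable_lborel_translation[OF int[OF F 0(1)], of "h n *\<^sub>R e"]
    by (simp add: integral_lborel_translation)
  ultimately have "(\<lambda>n::nat. 0) \<longlonglongrightarrow> (LINT x|lborel. D x)"
    by (simp only: s0)
  then show ?thesis using LIMSEQ_unique tendsto_const by blast
qed

lemma test_function_has_derivative:
  assumes "test_function \<Omega> \<phi>"
  shows "continuous_on UNIV \<phi>" "continuous_on UNIV (partial_deriv i \<phi>)"
    "((\<lambda>t. \<phi> (x + t *\<^sub>R axis i 1)) has_real_derivative partial_deriv i \<phi> (x + t *\<^sub>R axis i 1)) (at t)"
    "x \<notin> closure {x. \<phi> x \<noteq> 0} \<Longrightarrow> partial_deriv i \<phi> x = 0"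
proof -
  have C: "C_k k \<phi>" for k using assms by (simp add: test_function_def)
  show "continuous_on UNIV \<phi>" using C[of 0] by simp
  show "continuous_on UNIV (partial_deriv i \<phi>)" using C[of "Suc 0"] by simp
  have d: "(\<phi> has_derivative frechet_derivative \<phi> (at y)) (at y)" for y
    using C[of "Suc 0"] by (auto simp: differentiable_on_def frechet_derivative_works)
  have "((\<lambda>t. \<phi> (x + t *\<^sub>R axis i 1)) has_derivative
      (\<lambda>s. frechet_derivative \<phi> (at (x + t *\<^sub>R axis i 1)) (s *\<^sub>R axis i 1))) (at t)"
    by (rule has_derivative_compose[OF _ d]) (auto intro!: derivative_eq_intros)
  moreover have "(\<lambda>s. frechet_derivative \<phi> (at (x + t *\<^sub>R axis i 1)) (s *\<^sub>R axis i 1))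
      = (*) (partial_deriv i \<phi> (x + t *\<^sub>R axis i 1))"
    using linear_scale[OF has_derivative_linear[OF d]] by (simp add: partial_deriv_def fun_eq_iff)
  ultimately show "((\<lambda>t. \<phi> (x + t *\<^sub>R axis i 1)) has_real_derivative partial_deriv i \<phi> (x + t *\<^sub>R axis i 1)) (at t)"
    by (simp add: has_field_derivative_def)
  assume x: "x \<notin> closure {x. \<phi> x \<noteq> 0}"
  have "(\<phi> has_derivative (\<lambda>h. 0)) (at x)"
    by (rule has_derivative_transform_within_open[of "\<lambda>_. 0" _ _ _ "- closure {x. \<phi> x \<noteq> 0}"])
       (use x closure_subset[of "{x. \<phi> x \<noteq> 0}"] in auto)
  then have "frechet_derivative \<phi> (at x) = (\<lambda>h. 0)"
    by (rule frechet_derivative_at[symmetric])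
  then show "partial_deriv i \<phi> x = 0" by (simp add: partial_deriv_def)
qed

text \<open>The product of u and \<phi> has compact support, so its i-th partial derivative has
  integral 0 over the whole space, and the product rule splits that integral. Passing between
  \<Omega> and the whole space costs nothing because both integrands vanish off the support of
  \<phi>.\<close>

lemma integration_by_parts_test_function:
  fixes u :: "real^'n::finite \<Rightarrow> real"
  assumes \<Omega>: "\<Omega> \<in> sets lebesgue" and \<phi>: "test_function \<Omega> \<phi>"
    and u: "\<And>x. (u has_derivative (\<lambda>h. G x \<bullet> h)) (at x)" and G: "continuous_on UNIV G"
  shows "(LINT x|lebesgue_on \<Omega>. u x * partial_deriv i \<phi> x) = - (LINT x|lebesgue_on \<Omega>. G x $ i * \<phi> x)"
proof -
  note t = test_function_has_derivative[OF \<phi>]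
  define K where "K = closure {x. \<phi> x \<noteq> 0}"
  have K: "compact K" "K \<subseteq> \<Omega>" using \<phi> by (auto simp: test_function_def K_def)
  have \<phi>0: "\<phi> x = 0" if "x \<notin> K" for x using that closure_subset[of "{x. \<phi> x \<noteq> 0}"] unfolding K_def by blast
  have \<phi>1: "partial_deriv i \<phi> x = 0" if "x \<notin> K" for x using that t(4) unfolding K_def by blast
  have cu: "continuous_on UNIV u"
    using u by (auto intro!: continuous_at_imp_continuous_on has_derivative_continuous)
  have cGi: "continuous_on UNIV (\<lambda>x. G x $ i)" using G by (rule continuous_on_component)
  obtain R where R: "\<And>x. x \<in> K \<Longrightarrow> norm x \<le> R"
    using compact_imp_bounded[OF K(1)] by (auto simp: bounded_iff)
  have du: "((\<lambda>t. u (x + t *\<^sub>R axis i 1)) has_real_derivative G (x + t *\<^sub>R axis i 1) $ i) (at t)" for x t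
  proof -
    have "((\<lambda>t. u (x + t *\<^sub>R axis i 1)) has_derivative
      (\<lambda>s. G (x + t *\<^sub>R axis i 1) \<bullet> (s *\<^sub>R axis i 1))) (at t)"
      by (rule has_derivative_compose[OF _ u]) (auto intro!: derivative_eq_intros)
    then show ?thesis
      by (simp add: has_field_derivative_def inner_axis mult.commute[of _ "_ $ i"])
  qed
  have int: "integrable lborel f" if "continuous_on UNIV f" "\<And>x. x \<notin> K \<Longrightarrow> f x = 0" for f :: "real^'n \<Rightarrow> real"
  proof -
    have "integrable lborel (\<lambda>x. indicator K x *\<^sub>R f x)"
      using that(1) K(1) by (intro borel_integrable_compact) (auto intro: continuous_on_subset)
    moreover have "(\<lambda>x. indicator K x *\<^sub>R f x) = f"
      using that(2) by (auto simp: indicator_def fun_eq_iff)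
    ultimately show ?thesis by (simp only:)
  qed
  have c1: "continuous_on UNIV (\<lambda>x. u x * partial_deriv i \<phi> x)" and c2: "continuous_on UNIV (\<lambda>x. G x $ i * \<phi> x)"
    using cu cGi t by (auto intro!: continuous_intros)
  have "(LINT x|lborel. u x * partial_deriv i \<phi> x + G x $ i * \<phi> x) = 0"
  proof (rule integral_directional_derivative_eq_0[where F = "\<lambda>x. u x * \<phi> x" and e = "axis i 1" and R = R])
    show "continuous_on UNIV (\<lambda>x. u x * \<phi> x)" using cu t by (auto intro!: continuous_intros)
    show "continuous_on UNIV (\<lambda>x. u x * partial_deriv i \<phi> x + G x $ i * \<phi> x)"
      using c1 c2 by (rule continuous_on_add)
    show "((\<lambda>t. u (x + t *\<^sub>R axis i 1) * \<phi> (x + t *\<^sub>R axis i 1)) has_real_derivative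
       u (x + t *\<^sub>R axis i 1) * partial_deriv i \<phi> (x + t *\<^sub>R axis i 1)
        + G (x + t *\<^sub>R axis i 1) $ i * \<phi> (x + t *\<^sub>R axis i 1)) (at t)" for x t
      using DERIV_mult[OF du t(3)] by (simp add: add.commute mult.commute)
    fix x :: "real^'n" assume "R < norm x"
    then have "x \<notin> K" using R[of x] by linarith
    with \<phi>0 \<phi>1 show "u x * \<phi> x = 0" "u x * partial_deriv i \<phi> x + G x $ i * \<phi> x = 0" by simp_all
  qed
  then have "(LINT x|lborel. u x * partial_deriv i \<phi> x) = - (LINT x|lborel. G x $ i * \<phi> x)"
  proof -
    have "integrable lborel (\<lambda>x. u x * partial_deriv i \<phi> x)" by (rule int[OF c1]) (simp add: \<phi>1)
    moreover have "integrable lborel (\<lambda>x. G x $ i * \<phi> x)" by (rule int[OF c2]) (simp add: \<phi>0)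
    moreover note \<open>(LINT x|lborel. u x * partial_deriv i \<phi> x + G x $ i * \<phi> x) = 0\<close>
    ultimately show ?thesis by simp
  qed
  moreover have "(LINT x|lebesgue_on \<Omega>. u x * partial_deriv i \<phi> x) = (LINT x|lborel. u x * partial_deriv i \<phi> x)"
  proof (rule lebesgue_on_integral_of_support[OF _ \<Omega>])
    show "(\<lambda>x. u x * partial_deriv i \<phi> x) \<in> borel_measurable borel"
      using c1 by (rule borel_measurable_continuous_onI)
    show "u x * partial_deriv i \<phi> x = 0" if "x \<notin> \<Omega>" for x
      using that K(2) \<phi>1[of x] by auto
  qed
  moreover have "(LINT x|lebesgue_on \<Omega>. G x $ i * \<phi> x) = (LINT x|lborel. G x $ i * \<phi> x)"
  proof (rule lebesgue_on_integral_of_support[OF _ \<Omega>])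
    show "(\<lambda>x. G x $ i * \<phi> x) \<in> borel_measurable borel"
      using c2 by (rule borel_measurable_continuous_onI)
    show "G x $ i * \<phi> x = 0" if "x \<notin> \<Omega>" for x
      using that K(2) \<phi>0[of x] by auto
  qed
  ultimately show ?thesis by simp
qed

lemma weak_gradient_of_C1:
  fixes u :: "real^'n::finite \<Rightarrow> real"
  assumes "\<Omega> \<in> sets lebesgue" and u: "\<And>x. (u has_derivative (\<lambda>h. G x \<bullet> h)) (at x)" and G: "continuous_on UNIV G"
  shows "weak_gradient \<Omega> u G"
proof -
  have cu: "continuous_on UNIV u"
    using u by (auto intro!: continuous_at_imp_continuous_on has_derivative_continuous)
  show ?thesis
    unfolding weak_gradient_def
    using integration_by_parts_test_function[OF assms(1) _ u G]
      continuous_locally_integrable_on[OF cu] continuous_locally_integrable_on[OF G] by blast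
qed

text \<open>Testing transfers the lower bound: the integrals of \<phi> against the classical
  gradient of u and against any weak gradient g of the representative v coincide. In place of
  Hoelder's inequality, norm g is split at a level t; the free parameter is fixed later in
  \<open>test_functional_lower_bound\<close>.\<close>

lemma weak_gradient_test_bound:
  fixes u :: "real^'n::finite \<Rightarrow> real"
  assumes \<Omega>: "\<Omega> \<in> sets lebesgue" and u: "\<And>x. (u has_derivative (\<lambda>h. G x \<bullet> h)) (at x)" and G: "continuous_on UNIV G"
    and v: "v \<in> borel_measurable (lebesgue_on \<Omega>)" "AE x in lebesgue_on \<Omega>. v x = u x" "weak_gradient \<Omega> v g"
    and B: "(\<integral>\<^sup>+ x. ennreal (norm (g x) powr q) \<partial>lebesgue_on \<Omega>) \<le> ennreal B" "0 \<le> B"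
    and \<phi>: "test_function \<Omega> \<phi>" "\<And>x. \<bar>\<phi> x\<bar> \<le> 1" "\<And>x. x \<notin> cball z r \<Longrightarrow> \<phi> x = 0" "cball z r \<subseteq> \<Omega>" "0 < r"
    and q: "1 \<le> q" "0 < t"
  shows "\<bar>LINT x|lebesgue_on \<Omega>. G x $ i * \<phi> x\<bar> \<le> t * (unit_ball_vol (real CARD('n)) * r ^ CARD('n)) + t powr (1 - q) * B"
proof -
  note t = test_function_has_derivative[OF \<phi>(1)]
  have cu: "continuous_on UNIV u"
    using u by (auto intro!: continuous_at_imp_continuous_on has_derivative_continuous)
  have meas: "f \<in> borel_measurable (lebesgue_on \<Omega>)" if "continuous_on UNIV f" for f :: "real^'n \<Rightarrow> real"
  proof -
    have "f \<in> borel_measurable borel" using that by (rule borel_measurable_continuous_onI)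
    then show ?thesis by (simp add: measurable_completion measurable_restrict_space1)
  qed
  have "- (LINT x|lebesgue_on \<Omega>. G x $ i * \<phi> x) = (LINT x|lebesgue_on \<Omega>. u x * partial_deriv i \<phi> x)"
    using integration_by_parts_test_function[OF \<Omega> \<phi>(1) u G] by simp
  also have "\<dots> = (LINT x|lebesgue_on \<Omega>. v x * partial_deriv i \<phi> x)"
    by (intro integral_cong_AE borel_measurable_times meas cu t v(1)) (use v(2) in auto)
  also have "\<dots> = - (LINT x|lebesgue_on \<Omega>. g x $ i * \<phi> x)"
    using v(3) \<phi>(1) by (auto simp: weak_gradient_def)
  finally have eq: "(LINT x|lebesgue_on \<Omega>. G x $ i * \<phi> x) = (LINT x|lebesgue_on \<Omega>. g x $ i * \<phi> x)" by simp
  \<comment> \<open>Local integrability makes g measurable on the compact ball, which carries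
    \<phi>; the estimate is therefore done there.\<close>
  have "\<forall>K. compact K \<and> K \<subseteq> \<Omega> \<longrightarrow> integrable (lebesgue_on K) g"
    using v(3) by (simp add: weak_gradient_def locally_integrable_on_def)
  then have "integrable (lebesgue_on (cball z r)) g"
    using \<phi>(4) compact_cball by blast
  then have gm: "g \<in> borel_measurable (lebesgue_on (cball z r))"
    by (rule borel_measurable_integrable)
  \<comment> \<open>Above the level t the quotient norm (g x) / t exceeds 1 and is therefore at most
    its q-th power.\<close>
  have young: "norm (g x) \<le> t + t powr (1 - q) * norm (g x) powr q" for x
  proof (cases "norm (g x) \<le> t")
    case False
    then have "(norm (g x) / t) powr 1 \<le> (norm (g x) / t) powr q"
      using q by (intro powr_mono) auto
    then have "norm (g x) \<le> t * (norm (g x) powr q / t powr q)"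
      using q False by (simp add: powr_divide field_simps)
    also have "\<dots> = t powr (1 - q) * norm (g x) powr q" using q by (simp add: powr_diff)
    finally show ?thesis using q by simp
  qed (simp add: add_increasing2)
  \<comment> \<open>If the product is not integrable, its Bochner integral has the default value 0
    and the bound is trivial.\<close>
  have "ennreal \<bar>LINT x|lebesgue_on \<Omega>. g x $ i * \<phi> x\<bar> \<le> (\<integral>\<^sup>+x. ennreal \<bar>g x $ i * \<phi> x\<bar> \<partial>lebesgue_on \<Omega>)"
  proof (cases "integrable (lebesgue_on \<Omega>) (\<lambda>x. g x $ i * \<phi> x)")
    case True
    from integral_norm_bound_ennreal[OF this] show ?thesis by simp
  qed (simp add: not_integrable_integral_eq)
  also have "\<dots> = (\<integral>\<^sup>+x. ennreal \<bar>g x $ i * \<phi> x\<bar> * indicator \<Omega> x \<partial>lborel)"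
    by (rule nn_integral_lebesgue_on_eq[OF \<Omega>])
  also have "\<dots> \<le> (\<integral>\<^sup>+x. ennreal (t + t powr (1 - q) * norm (g x) powr q) * indicator (cball z r) x \<partial>lborel)"
  proof (intro nn_integral_mono)
    fix x
    have "\<bar>g x $ i * \<phi> x\<bar> \<le> norm (g x) * 1"
      unfolding abs_mult by (intro mult_mono \<phi> component_le_norm_cart) auto
    also have "\<dots> \<le> t + t powr (1 - q) * norm (g x) powr q" using young by simp
    finally show "ennreal \<bar>g x $ i * \<phi> x\<bar> * indicator \<Omega> x \<le>
        ennreal (t + t powr (1 - q) * norm (g x) powr q) * indicator (cball z r) x"
      using \<phi>(3)[of x] \<phi>(4) by (cases "x \<in> cball z r") (auto simp: indicator_def intro: ennreal_leI)
  qed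
  also have "\<dots> = (\<integral>\<^sup>+x. ennreal (t + t powr (1 - q) * norm (g x) powr q) \<partial>lebesgue_on (cball z r))"
    by (rule nn_integral_lebesgue_on_eq[symmetric]) auto
  also have "\<dots> = (\<integral>\<^sup>+x. ennreal t + ennreal (t powr (1 - q)) * ennreal (norm (g x) powr q) \<partial>lebesgue_on (cball z r))"
    using q by (intro nn_integral_cong) (simp add: ennreal_mult ennreal_plus)
  also have "\<dots> = ennreal t * emeasure (lebesgue_on (cball z r)) (cball z r)
      + ennreal (t powr (1 - q)) * (\<integral>\<^sup>+x. ennreal (norm (g x) powr q) \<partial>lebesgue_on (cball z r))"
    using gm by (subst nn_integral_add) (auto simp: nn_integral_cmult)
  also have "emeasure (lebesgue_on (cball z r)) (cball z r) = ennreal (unit_ball_vol (real CARD('n)) * r ^ CARD('n))"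
    using \<phi>(5) by (simp add: emeasure_restrict_space emeasure_cball)
  also have "ennreal t * ennreal (unit_ball_vol (real CARD('n)) * r ^ CARD('n))
        + ennreal (t powr (1 - q)) * (\<integral>\<^sup>+x. ennreal (norm (g x) powr q) \<partial>lebesgue_on (cball z r))
      \<le> ennreal t * ennreal (unit_ball_vol (real CARD('n)) * r ^ CARD('n)) + ennreal (t powr (1 - q)) * ennreal B"
  proof (intro add_left_mono mult_left_mono)
    have "(\<integral>\<^sup>+x. ennreal (norm (g x) powr q) \<partial>lebesgue_on (cball z r))
        = (\<integral>\<^sup>+x. ennreal (norm (g x) powr q) * indicator (cball z r) x \<partial>lborel)"
      by (rule nn_integral_lebesgue_on_eq) auto
    also have "\<dots> \<le> (\<integral>\<^sup>+x. ennreal (norm (g x) powr q) * indicator \<Omega> x \<partial>lborel)"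
      using \<phi>(4) by (intro nn_integral_mono) (auto simp: indicator_def)
    also have "\<dots> = (\<integral>\<^sup>+x. ennreal (norm (g x) powr q) \<partial>lebesgue_on \<Omega>)"
      by (rule nn_integral_lebesgue_on_eq[OF \<Omega>, symmetric])
    also note B(1)
    finally show "(\<integral>\<^sup>+x. ennreal (norm (g x) powr q) \<partial>lebesgue_on (cball z r)) \<le> ennreal B" .
  qed auto
  also have "\<dots> = ennreal (t * (unit_ball_vol (real CARD('n)) * r ^ CARD('n)) + t powr (1 - q) * B)"
    using q B(2) \<phi>(5) by (simp add: ennreal_mult ennreal_plus)
  finally show ?thesis
    unfolding eq using q B(2) \<phi>(5) by (subst (asm) ennreal_le_iff) auto
qed

section \<open>Gagliardo energies\<close>

lemma measurable_lebesgue_on_of_borel: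
  "f \<in> borel_measurable borel \<Longrightarrow> f \<in> borel_measurable (lebesgue_on \<Omega>)"
  by (simp add: measurable_completion measurable_restrict_space1)

text \<open>The product of two completed measures is not a completed measure on the product space;
  Borel functions of the pair are measurable because both identities into the Borel spaces
  are.\<close>

lemma measurable_pair_lebesgue_on_of_borel:
  fixes f :: "'a::euclidean_space \<times> 'b::euclidean_space \<Rightarrow> 'c::topological_space"
  assumes "f \<in> borel_measurable borel"
  shows "f \<in> borel_measurable (lebesgue_on \<Omega> \<Otimes>\<^sub>M lebesgue_on \<Omega>')"
proof -
  have 1: "(\<lambda>x. x) \<in> lebesgue_on \<Omega> \<rightarrow>\<^sub>M (borel :: 'a measure)" and 2: "(\<lambda>x. x) \<in> lebesgue_on \<Omega>' \<rightarrow>\<^sub>M (borel :: 'b measure)"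
    by (auto intro!: measurable_restrict_space1 measurable_completion)
  have "(\<lambda>z. (fst z, snd z)) \<in> lebesgue_on \<Omega> \<Otimes>\<^sub>M lebesgue_on \<Omega>' \<rightarrow>\<^sub>M borel \<Otimes>\<^sub>M borel"
    by (intro measurable_Pair measurable_compose[OF measurable_fst 1] measurable_compose[OF measurable_snd 2])
  then show ?thesis
    using measurable_compose[OF _ assms[folded borel_prod]] by simp
qed

lemma sigma_finite_lebesgue_on:
  assumes "open \<Omega>" "bounded \<Omega>"
  shows "sigma_finite_measure (lebesgue_on (\<Omega> :: 'a::euclidean_space set))"
proof -
  have "\<Omega> \<in> lmeasurable" using assms by (simp add: lmeasurable_open)
  then interpret finite_measure "lebesgue_on \<Omega>" by (rule finite_measure_lebesgue_on)
  show ?thesis by unfold_locales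
qed

lemma nn_integral_lborel_translation:
  fixes f :: "'a::euclidean_space \<Rightarrow> ennreal"
  assumes "f \<in> borel_measurable borel"
  shows "(\<integral>\<^sup>+x. f (x - c) \<partial>lborel) = (\<integral>\<^sup>+x. f x \<partial>lborel)"
proof -
  have "(\<integral>\<^sup>+x. f x \<partial>lborel) = (\<integral>\<^sup>+x. f x \<partial>distr lborel borel ((+) (- c)))"
    by (simp add: lborel_distr_plus)
  also have "\<dots> = (\<integral>\<^sup>+x. f (- c + x) \<partial>lborel)"
    using assms by (intro nn_integral_distr) auto
  finally show ?thesis by simp
qed

text \<open>The majorant may sit at either endpoint of a pair, since the bound for the logarithmic
  profile holds at the endpoint nearer to the centre and one does not know which it is. Exchanging x
  and y makes both contributions equal, whence the factor 2; substituting h = y - x leaves a radial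
  inner integral.\<close>

lemma gagliardo_le:
  fixes \<Omega> :: "(real^'n::finite) set" and H :: "real^'n \<Rightarrow> real \<Rightarrow> ennreal"
  assumes \<Omega>: "open \<Omega>" "bounded \<Omega>" and D: "\<And>x y. x \<in> \<Omega> \<Longrightarrow> y \<in> \<Omega> \<Longrightarrow> norm (x - y) \<le> D"
    and H: "(\<lambda>(x, r). H x r) \<in> borel_measurable borel"
    and le: "\<And>x y. x \<in> \<Omega> \<Longrightarrow> y \<in> \<Omega> \<Longrightarrow> x \<noteq> y \<Longrightarrow>
      ennreal (\<bar>u x - u y\<bar> powr p / norm (x - y) powr (real CARD('n) + s * p)) \<le> H x (norm (x - y)) + H y (norm (x - y))"
  shows "gagliardo s p \<Omega> u \<le> 2 * (\<integral>\<^sup>+x. (\<integral>\<^sup>+h. H x (norm (h::real^'n)) * indicator {..D} (norm h) \<partial>lborel) * indicator \<Omega> x \<partial>lborel)"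
proof -
  let ?L = "lebesgue_on \<Omega>"
  let ?K = "\<lambda>x (h::real^'n). H x (norm h) * indicator {..D} (norm h)"
  interpret S: sigma_finite_measure ?L using \<Omega> by (rule sigma_finite_lebesgue_on)
  interpret P: pair_sigma_finite ?L ?L ..
  have \<Omega>L: "\<Omega> \<in> sets lebesgue" using \<Omega>(1) by simp
  have H' [measurable]: "(\<lambda>z. H (fst z) (snd z)) \<in> borel_measurable (borel \<Otimes>\<^sub>M borel)"
    using H by (simp add: case_prod_beta' borel_prod)
  have HM [measurable]: "(\<lambda>z. H (f z) (g z)) \<in> borel_measurable M"
    if "f \<in> borel_measurable M" "g \<in> borel_measurable M" for f :: "'c \<Rightarrow> real^'n" and g and M :: "'c measure"
    using measurable_compose[OF measurable_Pair[OF that] H'] by simp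
  have m1: "(\<lambda>(x, y). ?K x (y - x)) \<in> borel_measurable (?L \<Otimes>\<^sub>M ?L)"
    by (rule measurable_pair_lebesgue_on_of_borel) (unfold borel_prod[symmetric], measurable)
  have m2: "(\<lambda>(x, y). ?K y (x - y)) \<in> borel_measurable (?L \<Otimes>\<^sub>M ?L)"
    by (rule measurable_pair_lebesgue_on_of_borel) (unfold borel_prod[symmetric], measurable)
  have I: "(\<integral>\<^sup>+y. ?K x (y - x) \<partial>?L) \<le> (\<integral>\<^sup>+h. ?K x h \<partial>lborel)" for x
  proof -
    have "(\<integral>\<^sup>+y. ?K x (y - x) \<partial>?L) \<le> (\<integral>\<^sup>+y. ?K x (y - x) \<partial>lborel)"
      unfolding nn_integral_lebesgue_on_eq[OF \<Omega>L] by (intro nn_integral_mono) (auto simp: indicator_def)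
    also have "\<dots> = (\<integral>\<^sup>+h. ?K x h \<partial>lborel)"
      by (rule nn_integral_lborel_translation) measurable
    finally show ?thesis .
  qed
  have J: "(\<integral>\<^sup>+x. \<integral>\<^sup>+y. ?K x (y - x) \<partial>?L \<partial>?L) \<le> (\<integral>\<^sup>+x. (\<integral>\<^sup>+h. ?K x h \<partial>lborel) * indicator \<Omega> x \<partial>lborel)"
    unfolding nn_integral_lebesgue_on_eq[OF \<Omega>L, symmetric] by (intro nn_integral_mono I)
  have "gagliardo s p \<Omega> u \<le> (\<integral>\<^sup>+z. (case z of (x, y) \<Rightarrow> ?K x (y - x)) + (case z of (x, y) \<Rightarrow> ?K y (x - y)) \<partial>(?L \<Otimes>\<^sub>M ?L))"
    unfolding gagliardo_def
  proof (intro nn_integral_mono, clarsimp simp: space_pair_measure)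
    fix x y assume xy: "x \<in> \<Omega>" "y \<in> \<Omega>"
    show "ennreal (\<bar>u x - u y\<bar> powr p / norm (x - y) powr (real CARD('n) + s * p))
       \<le> ?K x (y - x) + ?K y (x - y)"
      using le[OF xy] D[OF xy] by (cases "x = y") (auto simp: norm_minus_commute)
  qed
  also have "\<dots> = (\<integral>\<^sup>+(x, y). ?K x (y - x) \<partial>(?L \<Otimes>\<^sub>M ?L)) + (\<integral>\<^sup>+(x, y). ?K y (x - y) \<partial>(?L \<Otimes>\<^sub>M ?L))"
    using m1 m2 by (rule nn_integral_add)
  also have "(\<integral>\<^sup>+(x, y). ?K x (y - x) \<partial>(?L \<Otimes>\<^sub>M ?L)) = (\<integral>\<^sup>+x. \<integral>\<^sup>+y. ?K x (y - x) \<partial>?L \<partial>?L)"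
    using S.nn_integral_fst[OF m1] by simp
  also have "(\<integral>\<^sup>+(x, y). ?K y (x - y) \<partial>(?L \<Otimes>\<^sub>M ?L)) = (\<integral>\<^sup>+y. \<integral>\<^sup>+x. ?K y (x - y) \<partial>?L \<partial>?L)"
    using P.nn_integral_snd[OF m2] by simp
  also have "(\<integral>\<^sup>+x. \<integral>\<^sup>+y. ?K x (y - x) \<partial>?L \<partial>?L) + (\<integral>\<^sup>+y. \<integral>\<^sup>+x. ?K y (x - y) \<partial>?L \<partial>?L)
    = 2 * (\<integral>\<^sup>+x. \<integral>\<^sup>+y. ?K x (y - x) \<partial>?L \<partial>?L)"
    by (simp add: mult_2)
  also have "\<dots> \<le> 2 * (\<integral>\<^sup>+x. (\<integral>\<^sup>+h. ?K x h \<partial>lborel) * indicator \<Omega> x \<partial>lborel)"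
    using J by (rule mult_left_mono) simp
  finally show ?thesis .
qed

lemma gagliardo_eq_iterated:
  fixes v :: "real^'n::finite \<Rightarrow> real"
  assumes \<Omega>: "open \<Omega>" "bounded \<Omega>" and [measurable]: "v \<in> borel_measurable (lebesgue_on \<Omega>)"
  shows "gagliardo s p \<Omega> v = (\<integral>\<^sup>+x. \<integral>\<^sup>+y. ennreal (\<bar>v x - v y\<bar> powr p / norm (x - y) powr (real CARD('n) + s * p))
    \<partial>lebesgue_on \<Omega> \<partial>lebesgue_on \<Omega>)"
proof -
  interpret S: sigma_finite_measure "lebesgue_on \<Omega>" using \<Omega> by (rule sigma_finite_lebesgue_on)
  have [measurable]: "(\<lambda>z. norm (fst z - snd z)) \<in> borel_measurable (lebesgue_on \<Omega> \<Otimes>\<^sub>M lebesgue_on \<Omega>)"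
    by (rule measurable_pair_lebesgue_on_of_borel) (intro borel_measurable_continuous_onI continuous_intros)
  have "(\<lambda>z. ennreal (\<bar>v (fst z) - v (snd z)\<bar> powr p / norm (fst z - snd z) powr (real CARD('n) + s * p)))
      \<in> borel_measurable (lebesgue_on \<Omega> \<Otimes>\<^sub>M lebesgue_on \<Omega>)"
    by measurable
  from S.nn_integral_fst[OF this] show ?thesis
    by (simp add: gagliardo_def case_prod_beta')
qed

text \<open>One variable is replaced at a time in the iterated integral, first y for fixed x and
  fixed value c, then x; null sets in the product never appear.\<close>

lemma gagliardo_cong_AE:
  fixes v :: "real^'n::finite \<Rightarrow> real"
  assumes "open \<Omega>" "bounded \<Omega>" "v \<in> borel_measurable (lebesgue_on \<Omega>)" "u \<in> borel_measurable (lebesgue_on \<Omega>)"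
    and ae: "AE x in lebesgue_on \<Omega>. v x = u x"
  shows "gagliardo s p \<Omega> v = gagliardo s p \<Omega> u"
proof -
  have "(\<integral>\<^sup>+y. ennreal (\<bar>c - v y\<bar> powr p / norm (x - y) powr (real CARD('n) + s * p)) \<partial>lebesgue_on \<Omega>)
     = (\<integral>\<^sup>+y. ennreal (\<bar>c - u y\<bar> powr p / norm (x - y) powr (real CARD('n) + s * p)) \<partial>lebesgue_on \<Omega>)" for x c
    by (rule nn_integral_cong_AE) (use ae in auto)
  moreover have "(\<integral>\<^sup>+x. \<integral>\<^sup>+y. ennreal (\<bar>v x - u y\<bar> powr p / norm (x - y) powr (real CARD('n) + s * p)) \<partial>lebesgue_on \<Omega> \<partial>lebesgue_on \<Omega>)
     = (\<integral>\<^sup>+x. \<integral>\<^sup>+y. ennreal (\<bar>u x - u y\<bar> powr p / norm (x - y) powr (real CARD('n) + s * p)) \<partial>lebesgue_on \<Omega> \<partial>lebesgue_on \<Omega>)"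
    by (rule nn_integral_cong_AE) (use ae in auto)
  ultimately show ?thesis
    by (simp add: gagliardo_eq_iterated[OF assms(1,2,3)] gagliardo_eq_iterated[OF assms(1,2,4)])
qed

lemma gagliardo_ge_on_cballs:
  fixes u :: "real^'n::finite \<Rightarrow> real"
  assumes \<Omega>: "open \<Omega>" "bounded \<Omega>" and sub: "cball a r \<subseteq> \<Omega>" "cball b r \<subseteq> \<Omega>" and "0 \<le> r" "0 \<le> m"
    and ge: "\<And>x y. x \<in> cball a r \<Longrightarrow> y \<in> cball b r \<Longrightarrow> m \<le> \<bar>u x - u y\<bar> powr p / norm (x - y) powr (real CARD('n) + s * p)"
  shows "ennreal (m * (unit_ball_vol (real CARD('n)) * r ^ CARD('n))\<^sup>2) \<le> gagliardo s p \<Omega> u"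
proof -
  let ?L = "lebesgue_on \<Omega>"
  interpret S: sigma_finite_measure ?L using \<Omega> by (rule sigma_finite_lebesgue_on)
  have c: "cball c r \<in> sets ?L" "emeasure ?L (cball c r) = ennreal (unit_ball_vol (real CARD('n)) * r ^ CARD('n))"
    if "cball c r \<subseteq> \<Omega>" for c :: "real^'n"
  proof -
    have "cball c r \<in> sets lebesgue" by simp
    then show "cball c r \<in> sets ?L" using that \<Omega>(1) by (simp add: sets_restrict_space_iff)
    then show "emeasure ?L (cball c r) = ennreal (unit_ball_vol (real CARD('n)) * r ^ CARD('n))"
      using that \<Omega>(1) \<open>0 \<le> r\<close> by (simp add: emeasure_restrict_space emeasure_cball)
  qed
  have "ennreal (m * (unit_ball_vol (real CARD('n)) * r ^ CARD('n))\<^sup>2) =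
      ennreal m * emeasure (?L \<Otimes>\<^sub>M ?L) (cball a r \<times> cball b r)"
    using c[OF sub(1)] c[OF sub(2)] assms
    by (subst S.emeasure_pair_measure_Times) (auto simp: power2_eq_square ennreal_mult)
  also have "\<dots> = (\<integral>\<^sup>+z. ennreal m * indicator (cball a r \<times> cball b r) z \<partial>(?L \<Otimes>\<^sub>M ?L))"
    using c[OF sub(1)] c[OF sub(2)] by (subst nn_integral_cmult_indicator) auto
  also have "\<dots> \<le> gagliardo s p \<Omega> u"
    unfolding gagliardo_def using ge
    by (intro nn_integral_mono) (auto split: split_indicator intro!: ennreal_leI)
  finally show ?thesis .
qed

section \<open>Logarithmic profiles\<close>

text \<open>The radius \<open>norm (\<epsilon>, x - x0)\<close>, a norm in the product space, is the square root of
  \<open>\<epsilon>\<^sup>2 + norm (x - x0)\<^sup>2\<close>; in this form it inherits the triangle inequality.\<close>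

definition log_profile :: "'a::euclidean_space \<Rightarrow> real \<Rightarrow> 'a \<Rightarrow> real" where
  "log_profile x0 \<epsilon> x = - ln (norm (\<epsilon>, x - x0))"

lemma norm_Pair_bounds:
  assumes "0 < \<epsilon>"
  shows "0 < norm (\<epsilon>::real, z::'a::euclidean_space)" "\<epsilon> \<le> norm (\<epsilon>, z)" "norm z \<le> norm (\<epsilon>, z)" "norm (\<epsilon>, z) \<le> \<epsilon> + norm z"
  using assms norm_fst_le[of \<epsilon> z] norm_snd_le[of z \<epsilon>] norm_Pair_le[of \<epsilon> z] by auto

text \<open>The difference is the logarithm of the quotient of the larger radius by the smaller one,
  and the radii differ by at most norm (x - y). The two alternatives tell which endpoint has the
  smaller radius.\<close>

lemma log_profile_diff_le:
  assumes "0 < \<epsilon>"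
  shows "\<bar>log_profile x0 \<epsilon> x - log_profile x0 \<epsilon> y\<bar> \<le> ln (1 + norm (x - y) / norm (\<epsilon>, x - x0)) \<or>
    \<bar>log_profile x0 \<epsilon> x - log_profile x0 \<epsilon> y\<bar> \<le> ln (1 + norm (x - y) / norm (\<epsilon>, y - x0))"
proof -
  have *: "\<bar>log_profile x0 \<epsilon> x - log_profile x0 \<epsilon> y\<bar> \<le> ln (1 + norm (x - y) / norm (\<epsilon>, x - x0))"
    if le: "norm (\<epsilon>, x - x0) \<le> norm (\<epsilon>, y - x0)" for x y
  proof -
    note pos = norm_Pair_bounds(1)[OF assms, of "x - x0"] norm_Pair_bounds(1)[OF assms, of "y - x0"]
    have "(\<epsilon>, y - x0) = (\<epsilon>, x - x0) + (0, y - x)" by simp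
    then have "norm (\<epsilon>, y - x0) \<le> norm (\<epsilon>, x - x0) + norm (x - y)"
      using norm_triangle_ineq[of "(\<epsilon>, x - x0)" "(0, y - x)"] by (simp add: norm_Pair norm_minus_commute)
    then have "norm (\<epsilon>, y - x0) / norm (\<epsilon>, x - x0) \<le> 1 + norm (x - y) / norm (\<epsilon>, x - x0)"
      using pos by (simp add: field_simps)
    then have "ln (norm (\<epsilon>, y - x0) / norm (\<epsilon>, x - x0)) \<le> ln (1 + norm (x - y) / norm (\<epsilon>, x - x0))"
      using pos by (intro ln_mono) auto
    moreover have "ln (norm (\<epsilon>, x - x0)) \<le> ln (norm (\<epsilon>, y - x0))"
      using pos le by (intro ln_mono) auto
    ultimately show ?thesis
      using pos by (simp add: log_profile_def ln_div)
  qed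
  show ?thesis
    using *[of x y] *[of y x] by (cases "norm (\<epsilon>, x - x0) \<le> norm (\<epsilon>, y - x0)") (auto simp: norm_minus_commute abs_minus_commute)
qed

text \<open>An arbitrarily small power a of t dominates the logarithm. Used for distant pairs with a
  = s / 2: the exponent a p is then N / 2, half the critical one, and the tail becomes
  integrable.\<close>

lemma ln_1_plus_powr_le:
  fixes a p t :: real
  assumes "0 < a" "0 < p" "1 \<le> t"
  shows "ln (1 + t) powr p \<le> (2 powr a / a) powr p * t powr (a * p)"
proof -
  have "ln (1 + t) \<le> ln (2 * t)" using assms by (intro ln_mono) auto
  also have "\<dots> \<le> (2 * t) powr a / a" using assms by (intro ln_powr_bound) auto
  also have "\<dots> = 2 powr a / a * t powr a" using assms by (simp add: powr_mult)
  finally have "ln (1 + t) powr p \<le> (2 powr a / a * t powr a) powr p"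
    using assms by (intro powr_mono2) auto
  also have "\<dots> = (2 powr a / a) powr p * t powr (a * p)"
    using assms by (subst powr_mult) (auto simp: powr_powr)
  finally show ?thesis .
qed

lemma nn_integral_norm_Pair_powr_le:
  fixes \<Omega> :: "(real^'n::finite) set"
  assumes "0 < \<epsilon>" "\<epsilon> \<le> R" "\<Omega> \<subseteq> cball x0 R"
  shows "(\<integral>\<^sup>+x. ennreal (norm (\<epsilon>, x - x0) powr (- real CARD('n))) * indicator \<Omega> x \<partial>lborel)
    \<le> ennreal (unit_ball_vol (real CARD('n)) * (1 + real CARD('n) * ln (R / \<epsilon>)))"
proof -
  let ?f = "\<lambda>h::real^'n. ennreal (max \<epsilon> (norm h) powr (- real CARD('n))) * indicator {..R} (norm h)"
  have "(\<integral>\<^sup>+x. ennreal (norm (\<epsilon>, x - x0) powr (- real CARD('n))) * indicator \<Omega> x \<partial>lborel)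
    \<le> (\<integral>\<^sup>+x. ?f (x - x0) \<partial>lborel)"
  proof (intro nn_integral_mono)
    fix x
    have "norm (\<epsilon>, x - x0) powr (- real CARD('n)) \<le> max \<epsilon> (norm (x - x0)) powr (- real CARD('n))"
      using norm_Pair_bounds[OF assms(1), of "x - x0"] assms(1) by (intro powr_mono2') auto
    then show "ennreal (norm (\<epsilon>, x - x0) powr (- real CARD('n))) * indicator \<Omega> x \<le> ?f (x - x0)"
      using assms(3) by (auto split: split_indicator simp: dist_norm norm_minus_commute subset_iff intro!: ennreal_leI)
  qed
  also have "\<dots> = (\<integral>\<^sup>+h. ?f h \<partial>lborel)"
    by (rule nn_integral_lborel_translation) simp
  also have "\<dots> \<le> ennreal (unit_ball_vol (real CARD('n)) * (1 + real CARD('n) * ln (R / \<epsilon>)))"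
    using nn_integral_truncated_norm_powr_le[OF assms(1,2), where ?'a = "real^'n"] by simp
  finally show ?thesis .
qed

text \<open>Here \<rho> is the distance scale at a base point. Within \<rho> the increment is at
  most norm h / \<rho>, integrable at 0 because p > N; beyond it the power N / 2 leaves an
  integrable tail. Both parts scale as \<rho> powr (- N).\<close>

lemma nn_integral_kernel_le:
  fixes p C \<rho> :: real
  assumes "real CARD('n::finite) < p" "0 < \<rho>" "0 \<le> C"
  shows "(\<integral>\<^sup>+h. (if norm h \<le> \<rho> then ennreal (\<rho> powr (- p) * norm h powr (p - 2 * real CARD('n)))
      else ennreal (C * \<rho> powr (- real CARD('n) / 2) * norm h powr (- real CARD('n) / 2 - real CARD('n)))) \<partial>(lborel :: (real^'n) measure))
    \<le> ennreal (CARD('n) * unit_ball_vol (real CARD('n)) * (1 / (p - real CARD('n)) + 2 * C / real CARD('n)) * \<rho> powr (- real CARD('n)))"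
proof -
  let ?N = "real CARD('n)" and ?V = "CARD('n) * unit_ball_vol (real CARD('n))"
  have N: "0 < ?N" by simp
  have "(\<integral>\<^sup>+h. (if norm h \<le> \<rho> then ennreal (\<rho> powr (- p) * norm h powr (p - 2 * ?N))
      else ennreal (C * \<rho> powr (- ?N / 2) * norm h powr (- ?N / 2 - ?N))) \<partial>(lborel :: (real^'n) measure))
   \<le> (\<integral>\<^sup>+h. ennreal (\<rho> powr (- p)) * (ennreal (norm h powr ((p - ?N) - ?N)) * indicator {..\<rho>} (norm h))
      + ennreal (C * \<rho> powr (- ?N / 2)) * (ennreal (norm h powr (- (?N / 2) - ?N)) * indicator {\<rho>..} (norm h)) \<partial>(lborel :: (real^'n) measure))"
    using assms by (intro nn_integral_mono) (auto simp: ennreal_mult split: split_indicator)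
  also have "\<dots> = ennreal (\<rho> powr (- p)) * ennreal (?V * \<rho> powr (p - ?N) / (p - ?N))
      + ennreal (C * \<rho> powr (- ?N / 2)) * ennreal (?V * \<rho> powr (- (?N / 2)) / (?N / 2))"
    using nn_integral_norm_powr_near_0[where ?'a = "real^'n" and a = "p - ?N" and r = \<rho>]
      nn_integral_norm_powr_near_infinity[where ?'a = "real^'n" and a = "?N / 2" and r = \<rho>] assms
    by (subst nn_integral_add) (simp_all add: nn_integral_cmult)
  also have "\<dots> = ennreal (\<rho> powr (- p) * (?V * \<rho> powr (p - ?N) / (p - ?N)) + C * \<rho> powr (- ?N / 2) * (?V * \<rho> powr (- (?N / 2)) / (?N / 2)))"
    using assms by (simp add: ennreal_mult[symmetric] ennreal_plus[symmetric] del: ennreal_plus)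
  also have "\<rho> powr (- p) * (?V * \<rho> powr (p - ?N) / (p - ?N)) = ?V / (p - ?N) * (\<rho> powr (- p) * \<rho> powr (p - ?N))"
    by simp
  also have "\<rho> powr (- p) * \<rho> powr (p - ?N) = \<rho> powr (- ?N)" by (simp flip: powr_add)
  also have "C * \<rho> powr (- ?N / 2) * (?V * \<rho> powr (- (?N / 2)) / (?N / 2)) = C * ?V / (?N / 2) * (\<rho> powr (- ?N / 2) * \<rho> powr (- (?N / 2)))"
    by simp
  also have "\<rho> powr (- ?N / 2) * \<rho> powr (- (?N / 2)) = \<rho> powr (- ?N)" by (simp flip: powr_add)
  also have "?V / (p - ?N) * \<rho> powr (- ?N) + C * ?V / (?N / 2) * \<rho> powr (- ?N)
      = ?V * (1 / (p - ?N) + 2 * C / ?N) * \<rho> powr (- ?N)"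
    by (simp add: field_simps)
  finally show ?thesis .
qed

text \<open>After integration over the increments h, each base point contributes \<rho> powr (- N);
  the remaining integral over \<Omega> is the critical one that grows like ln (1 /
  \<epsilon>).\<close>

lemma gagliardo_log_profile_le:
  fixes \<Omega> :: "(real^'n::finite) set"
  assumes \<Omega>: "open \<Omega>" "bounded \<Omega>" and s: "0 < s" "s < 1" "s * p = real CARD('n)"
  obtains K where "0 \<le> K" "\<And>\<epsilon>. 0 < \<epsilon> \<Longrightarrow> gagliardo s p \<Omega> (log_profile x0 \<epsilon>) \<le>
    ennreal K * (\<integral>\<^sup>+x. ennreal (norm (\<epsilon>, x - x0) powr (- real CARD('n))) * indicator \<Omega> x \<partial>lborel)"
proof -
  let ?N = "real CARD('n)"
  have N: "0 < ?N" by simp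
  have p: "0 < p" using s N zero_less_mult_pos by metis
  have pN: "?N < p" using s p mult_strict_right_mono[of s 1 p] by simp
  \<comment> \<open>The constant of \<open>ln_1_plus_powr_le\<close> for a = s / 2.\<close>
  define C where "C = (2 powr (s / 2) / (s / 2)) powr p"
  have C: "0 \<le> C" by (simp add: C_def)
  define K1 where "K1 = CARD('n) * unit_ball_vol (real CARD('n)) * (1 / (p - ?N) + 2 * C / ?N)"
  have K1: "0 \<le> K1" using pN C by (simp add: K1_def)
  obtain D where D: "\<And>x y. x \<in> \<Omega> \<Longrightarrow> y \<in> \<Omega> \<Longrightarrow> norm (x - y) \<le> D"
    using \<Omega>(2) unfolding bounded_two_points dist_norm by blast
  show thesis
  proof (rule that[of "2 * K1"])
    show "0 \<le> 2 * K1" using K1 by simp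
    fix \<epsilon> :: real assume \<epsilon>: "0 < \<epsilon>"
    let ?\<rho> = "\<lambda>x. norm (\<epsilon>, x - x0)"
    define H where "H x r = (if r \<le> ?\<rho> x then ennreal (?\<rho> x powr (- p) * r powr (p - 2 * ?N))
      else ennreal (C * ?\<rho> x powr (- ?N / 2) * r powr (- ?N / 2 - ?N)))" for x r
    have \<rho>m: "?\<rho> \<in> borel_measurable borel"
      by (intro borel_measurable_continuous_onI continuous_intros)
    have H: "(\<lambda>(x, r). H x r) \<in> borel_measurable borel"
      unfolding H_def case_prod_beta' borel_prod[symmetric]
      using measurable_compose[OF measurable_fst \<rho>m] by measurable
    \<comment> \<open>For r \<le> \<rho> one uses ln (1 + y) \<le> y, otherwise the power bound;
      since s p = N the kernel exponent is 2 N.\<close>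
    have key: "ennreal (t powr p / r powr (?N + s * p)) \<le> H x r"
      if t: "0 \<le> t" "t \<le> ln (1 + r / ?\<rho> x)" "0 < r" for t r x
    proof -
      have \<rho>: "0 < ?\<rho> x" by (rule norm_Pair_bounds(1)[OF \<epsilon>])
      show ?thesis
      proof (cases "r \<le> ?\<rho> x")
        case True
        have "t \<le> r / ?\<rho> x" using t(2) ln_add_one_self_le_self[of "r / ?\<rho> x"] t(3) \<rho> by simp
        then have "t powr p \<le> (r / ?\<rho> x) powr p" using t p by (intro powr_mono2) auto
        then have "t powr p / r powr (?N + s * p) \<le> (r / ?\<rho> x) powr p / r powr (2 * ?N)"
          using s by (simp add: divide_right_mono)
        also have "\<dots> = ?\<rho> x powr (- p) * r powr (p - 2 * ?N)"
          using \<rho> t(3) by (simp add: powr_divide powr_diff powr_minus divide_simps)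
        finally show ?thesis using True by (simp add: H_def ennreal_leI)
      next
        case False
        have "t powr p \<le> ln (1 + r / ?\<rho> x) powr p" using t p by (intro powr_mono2) auto
        also have "\<dots> \<le> C * (r / ?\<rho> x) powr (s / 2 * p)"
          unfolding C_def using s p False \<rho> by (intro ln_1_plus_powr_le) auto
        also have "s / 2 * p = ?N / 2" using s by simp
        finally have "t powr p / r powr (?N + s * p) \<le> C * (r / ?\<rho> x) powr (?N / 2) / r powr (2 * ?N)"
          using s by (simp add: divide_right_mono)
        also have "\<dots> = C * (?\<rho> x powr (- ?N / 2) * (r powr (?N / 2) / r powr (2 * ?N)))"
          using \<rho> t(3) by (simp add: powr_divide powr_minus divide_simps)
        also have "r powr (?N / 2) / r powr (2 * ?N) = r powr (- ?N / 2 - ?N)"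
          by (simp flip: powr_diff)
        finally show ?thesis using False by (simp add: H_def ennreal_leI mult.assoc)
      qed
    qed
    have "gagliardo s p \<Omega> (log_profile x0 \<epsilon>) \<le>
        2 * (\<integral>\<^sup>+x. (\<integral>\<^sup>+h. H x (norm (h::real^'n)) * indicator {..D} (norm h) \<partial>lborel) * indicator \<Omega> x \<partial>lborel)"
    proof (rule gagliardo_le[OF \<Omega> D H])
      fix x y assume xy: "x \<in> \<Omega>" "y \<in> \<Omega>" "x \<noteq> y"
      from log_profile_diff_le[OF \<epsilon>, of x0 x y]
      show "ennreal (\<bar>log_profile x0 \<epsilon> x - log_profile x0 \<epsilon> y\<bar> powr p / norm (x - y) powr (?N + s * p))
          \<le> H x (norm (x - y)) + H y (norm (x - y))"
        using key[of "\<bar>log_profile x0 \<epsilon> x - log_profile x0 \<epsilon> y\<bar>" "norm (x - y)" x]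
          key[of "\<bar>log_profile x0 \<epsilon> x - log_profile x0 \<epsilon> y\<bar>" "norm (x - y)" y] xy(3)
        by (auto intro: add_increasing add_increasing2)
    qed
    also have "\<dots> \<le> 2 * (\<integral>\<^sup>+x. ennreal K1 * (ennreal (?\<rho> x powr (- ?N)) * indicator \<Omega> x) \<partial>lborel)"
    proof (intro mult_left_mono nn_integral_mono)
      fix x
      have "(\<integral>\<^sup>+h. H x (norm (h::real^'n)) * indicator {..D} (norm h) \<partial>lborel) \<le> (\<integral>\<^sup>+h. H x (norm (h::real^'n)) \<partial>lborel)"
        by (intro nn_integral_mono) (auto split: split_indicator)
      also have "\<dots> \<le> ennreal (K1 * ?\<rho> x powr (- ?N))"
        unfolding H_def K1_def by (rule nn_integral_kernel_le[OF pN norm_Pair_bounds(1)[OF \<epsilon>] C])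
      finally show "(\<integral>\<^sup>+h. H x (norm (h::real^'n)) * indicator {..D} (norm h) \<partial>lborel) * indicator \<Omega> x
          \<le> ennreal K1 * (ennreal (?\<rho> x powr (- ?N)) * indicator \<Omega> x)"
        using K1 by (auto split: split_indicator simp: ennreal_mult)
    qed simp
    also have "\<dots> = ennreal (2 * K1) * (\<integral>\<^sup>+x. ennreal (?\<rho> x powr (- ?N)) * indicator \<Omega> x \<partial>lborel)"
      using \<Omega>(1) \<rho>m K1 by (subst nn_integral_cmult) (auto simp: ennreal_mult mult.assoc)
    finally show "gagliardo s p \<Omega> (log_profile x0 \<epsilon>) \<le>
      ennreal (2 * K1) * (\<integral>\<^sup>+x. ennreal (?\<rho> x powr (- ?N)) * indicator \<Omega> x \<partial>lborel)" .
  qed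
qed

lemma log_profile_has_derivative:
  fixes x :: "'a::euclidean_space"
  assumes "0 < \<epsilon>"
  shows "(log_profile x0 \<epsilon> has_derivative (\<lambda>h. ((- 1 / (norm (\<epsilon>, x - x0))\<^sup>2) *\<^sub>R (x - x0)) \<bullet> h)) (at x)"
proof -
  have pos: "0 < \<epsilon>\<^sup>2 + (x - x0) \<bullet> (x - x0)" for x using assms by (simp add: add_pos_nonneg)
  have eq: "log_profile x0 \<epsilon> = (\<lambda>x. - ln (\<epsilon>\<^sup>2 + (x - x0) \<bullet> (x - x0)) / 2)"
    using pos by (simp add: log_profile_def fun_eq_iff norm_Pair ln_sqrt power2_norm_eq_inner)
  have n: "(norm (\<epsilon>, x - x0))\<^sup>2 = \<epsilon>\<^sup>2 + (x - x0) \<bullet> (x - x0)"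
    by (simp add: norm_Pair power2_norm_eq_inner)
  have half: "(y + y) * (- 1 / (2 * r)) = (- 1 / r) * y" for y r :: real
    by (cases "r = 0") (simp_all add: field_simps)
  let ?q = "\<epsilon>\<^sup>2 + (x - x0) \<bullet> (x - x0)"
  have d: "((\<lambda>x. \<epsilon>\<^sup>2 + (x - x0) \<bullet> (x - x0)) has_derivative (\<lambda>h. (x - x0) \<bullet> h + h \<bullet> (x - x0))) (at x)"
    by (auto intro!: derivative_eq_intros)
  have "((\<lambda>y. - ln y / 2) has_real_derivative (- 1 / (2 * r))) (at r)" if "0 < r" for r :: real
    using that by (auto intro!: derivative_eq_intros)
  from DERIV_compose_FDERIV[OF this[OF pos[of x]] d]
  have "((\<lambda>x. - ln (\<epsilon>\<^sup>2 + (x - x0) \<bullet> (x - x0)) / 2) has_derivative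
      (\<lambda>h. ((x - x0) \<bullet> h + h \<bullet> (x - x0)) * (- 1 / (2 * ?q)))) (at x)" .
  moreover have "((x - x0) \<bullet> h + h \<bullet> (x - x0)) * (- 1 / (2 * ?q)) = ((- 1 / ?q) *\<^sub>R (x - x0)) \<bullet> h" for h
    unfolding inner_scaleR_left inner_commute[of h] by (rule half)
  ultimately show ?thesis
    unfolding eq n by (simp only:)
qed

lemma continuous_on_log_profile_gradient:
  "0 < \<epsilon> \<Longrightarrow> continuous_on UNIV (\<lambda>x. (- 1 / (norm (\<epsilon>::real, x - x0))\<^sup>2) *\<^sub>R (x - x0 :: 'a::euclidean_space))"
  using norm_Pair_bounds(1)[of \<epsilon>] by (intro continuous_intros) (auto simp: less_imp_neq[THEN not_sym])

text \<open>For small \<rho> the logarithm is at most \<rho> powr (- s) / s, and s p = N turns the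
  p-th power into \<rho> powr (- N). So the L^p norm is controlled by the same critical integral as
  the energy.\<close>

lemma abs_ln_powr_le:
  fixes s p N \<rho> R :: real
  assumes "0 < s" "1 \<le> p" "s * p = N" "0 < \<rho>" "\<rho> \<le> R" "1 \<le> R" "0 < N"
  shows "\<bar>ln \<rho>\<bar> powr p \<le> (s powr (- p) + R powr (p + N)) * \<rho> powr (- N)"
proof (cases "\<rho> \<le> 1")
  case True
  have "ln (1 / \<rho>) \<le> (1 / \<rho>) powr s / s"
    using assms True by (intro ln_powr_bound) auto
  then have "ln (1 / \<rho>) powr p \<le> ((1 / \<rho>) powr s / s) powr p"
    using assms True by (intro powr_mono2) auto
  also have "\<dots> = s powr (- p) * \<rho> powr (- N)"
  proof -
    have "((1 / \<rho>) powr s / s) powr p = ((1 / \<rho>) powr s) powr p / s powr p"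
      using assms by (simp only: powr_divide)
    also have "((1 / \<rho>) powr s) powr p = \<rho> powr (- N)"
      using assms by (simp add: powr_powr powr_divide powr_minus_divide)
    finally show ?thesis by (simp add: powr_minus_divide)
  qed
  also have "ln (1 / \<rho>) = \<bar>ln \<rho>\<bar>" using True assms by (simp add: ln_div)
  finally show ?thesis by (simp add: distrib_right add_increasing2)
next
  case False
  have "\<bar>ln \<rho>\<bar> \<le> R" using False ln_le_minus_one[of \<rho>] assms by simp
  then have "\<bar>ln \<rho>\<bar> powr p \<le> R powr p" using assms by (intro powr_mono2) auto
  also have "\<dots> = R powr (p + N) * R powr (- N)" by (simp flip: powr_add)
  also have "\<dots> \<le> R powr (p + N) * \<rho> powr (- N)"
    using assms by (intro mult_left_mono powr_mono2') auto
  finally show ?thesis by (simp add: distrib_right add_increasing)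
qed

text \<open>Fractional energy, gradient and L^p norm are all bounded by multiples of the one
  integral \<open>?I\<close>, which is of order 1 + ln (1 / \<epsilon>).\<close>

lemma log_profile_source_bound:
  fixes \<Omega> :: "(real^'n::finite) set"
  assumes \<Omega>: "open \<Omega>" "bounded \<Omega>" and s: "0 < s" "s \<le> 1" "1 \<le> p" "s * p = real CARD('n)"
  obtains K where "0 < K" "\<And>\<epsilon>. 0 < \<epsilon> \<Longrightarrow> \<epsilon> \<le> 1 \<Longrightarrow> log_profile x0 \<epsilon> \<in> sobolev_space s (ereal p) \<Omega> \<and>
    sobolev_norm s (ereal p) \<Omega> (log_profile x0 \<epsilon>) \<le> ennreal ((K * (1 + ln (1 / \<epsilon>))) powr (1 / p))"
proof -
  let ?N = "real CARD('n)" and ?V = "unit_ball_vol (real CARD('n))"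
  let ?I = "\<lambda>\<epsilon>. \<integral>\<^sup>+x. ennreal (norm (\<epsilon>, x - x0) powr (- ?N)) * indicator \<Omega> x \<partial>lborel"
  obtain R0 where R0: "\<Omega> \<subseteq> cball x0 R0"
    using \<Omega>(2) bounded_any_center[of \<Omega> x0] by (auto simp: subset_iff)
  define R where "R = max R0 1"
  have R: "\<Omega> \<subseteq> cball x0 R" "1 \<le> R"
    using R0 by (auto simp: R_def)
  have \<Omega>L: "\<Omega> \<in> sets lebesgue" using \<Omega>(1) by simp
  \<comment> \<open>Absorbs ln R and the dimension, so that a single multiple of 1 + ln (1 /
    \<epsilon>) remains.\<close>
  define K0 where "K0 = ?V * (1 + ?N * ln R + ?N)"
  have K0: "0 < K0" using R(2) by (simp add: K0_def add_pos_pos add_pos_nonneg)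
  have I: "?I \<epsilon> \<le> ennreal (K0 * (1 + ln (1 / \<epsilon>)))" if \<epsilon>: "0 < \<epsilon>" "\<epsilon> \<le> 1" for \<epsilon>
  proof -
    have L: "0 \<le> ln (1 / \<epsilon>)" "0 \<le> ln R" using \<epsilon> R(2) by simp_all
    have "1 + ?N * ln (R / \<epsilon>) = 1 + ?N * (ln R + ln (1 / \<epsilon>))"
      using \<epsilon> R(2) by (simp add: ln_div)
    also have "\<dots> \<le> (1 + ?N * ln R + ?N) * (1 + ln (1 / \<epsilon>))"
      unfolding distrib_left distrib_right using L by simp
    finally have "?V * (1 + ?N * ln (R / \<epsilon>)) \<le> K0 * (1 + ln (1 / \<epsilon>))"
      unfolding K0_def mult.assoc by (intro mult_left_mono) auto
    with nn_integral_norm_Pair_powr_le[OF \<epsilon>(1) _ R(1)] \<epsilon> R(2) show ?thesis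
      by (meson ennreal_leI order_trans)
  qed
  define K2 where "K2 = s powr (- p) + (1 + R) powr (p + ?N)"
  have K2: "0 < K2" using s by (simp add: K2_def add_pos_nonneg)
  have u: "log_profile x0 \<epsilon> \<in> borel_measurable (lebesgue_on \<Omega>)" if "0 < \<epsilon>" for \<epsilon>
    using log_profile_has_derivative[OF that]
    by (intro measurable_lebesgue_on_of_borel borel_measurable_continuous_onI continuous_at_imp_continuous_on)
       (auto intro: has_derivative_continuous)
  have \<rho>m: "(\<lambda>x. ennreal (norm (\<epsilon>, x - x0) powr (- ?N)) * indicator \<Omega> x) \<in> borel_measurable lborel" for \<epsilon> :: real
  proof -
    have [measurable]: "\<Omega> \<in> sets borel" using \<Omega>(1) by simp
    have [measurable]: "(\<lambda>x. norm (\<epsilon>, x - x0)) \<in> borel_measurable borel"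
      by (intro borel_measurable_continuous_onI continuous_intros)
    show ?thesis by measurable
  qed
  have Lp: "(\<integral>\<^sup>+ x. ennreal (\<bar>log_profile x0 \<epsilon> x\<bar> powr p) \<partial>lebesgue_on \<Omega>) \<le> ennreal (K2 * K0 * (1 + ln (1 / \<epsilon>)))"
    if \<epsilon>: "0 < \<epsilon>" "\<epsilon> \<le> 1" for \<epsilon>
  proof -
    have "(\<integral>\<^sup>+ x. ennreal (\<bar>log_profile x0 \<epsilon> x\<bar> powr p) \<partial>lebesgue_on \<Omega>)
      \<le> (\<integral>\<^sup>+ x. ennreal K2 * (ennreal (norm (\<epsilon>, x - x0) powr (- ?N)) * indicator \<Omega> x) \<partial>lborel)"
      unfolding nn_integral_lebesgue_on_eq[OF \<Omega>L]
    proof (intro nn_integral_mono)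
      fix x
      show "ennreal (\<bar>log_profile x0 \<epsilon> x\<bar> powr p) * indicator \<Omega> x
        \<le> ennreal K2 * (ennreal (norm (\<epsilon>, x - x0) powr (- ?N)) * indicator \<Omega> x)"
      proof (cases "x \<in> \<Omega>")
        case True
        then have "norm (\<epsilon>, x - x0) \<le> 1 + R"
          using norm_Pair_bounds(4)[OF \<epsilon>(1), of "x - x0"] R(1) \<epsilon>(2) by (auto simp: dist_norm norm_minus_commute subset_iff)
        then have "\<bar>log_profile x0 \<epsilon> x\<bar> powr p \<le> K2 * norm (\<epsilon>, x - x0) powr (- ?N)"
          unfolding K2_def log_profile_def abs_minus_cancel
          using s R(2) norm_Pair_bounds(1)[OF \<epsilon>(1)] by (intro abs_ln_powr_le) auto
        then show ?thesis using True K2 by (simp add: ennreal_mult[symmetric] ennreal_leI)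
      qed simp
    qed
    also have "\<dots> = ennreal K2 * ?I \<epsilon>" using \<rho>m by (intro nn_integral_cmult)
    also have "\<dots> \<le> ennreal K2 * ennreal (K0 * (1 + ln (1 / \<epsilon>)))"
      using I[OF \<epsilon>] by (intro mult_left_mono) auto
    also have "\<dots> = ennreal (K2 * K0 * (1 + ln (1 / \<epsilon>)))"
      using K2 K0 \<epsilon> by (simp add: ennreal_mult[symmetric] mult.assoc)
    finally show ?thesis .
  qed
  show thesis
  proof (cases "s < 1")
    case True
    obtain K1 where K1: "0 \<le> K1" "\<And>\<epsilon>. 0 < \<epsilon> \<Longrightarrow> gagliardo s p \<Omega> (log_profile x0 \<epsilon>) \<le> ennreal K1 * ?I \<epsilon>"
      using gagliardo_log_profile_le[OF \<Omega> s(1) True s(4)] by blast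
    have c: "0 < c_const CARD('n) s p" using s True by (intro c_const_pos) (auto simp: Suc_leI)
    show thesis
    proof (rule that[of "(c_const CARD('n) s p + 1) * ((K1 + K2) * K0)"])
      show "0 < (c_const CARD('n) s p + 1) * ((K1 + K2) * K0)" using c K0 K1 K2 by (simp add: add_nonneg_pos)
      fix \<epsilon> :: real assume \<epsilon>: "0 < \<epsilon>" "\<epsilon> \<le> 1"
      let ?A = "(K1 + K2) * K0 * (1 + ln (1 / \<epsilon>))"
      have L: "0 \<le> ln (1 / \<epsilon>)" using \<epsilon> by simp
      have "gagliardo s p \<Omega> (log_profile x0 \<epsilon>) \<le> ennreal K1 * ennreal (K0 * (1 + ln (1 / \<epsilon>)))"
        using K1(2)[OF \<epsilon>(1)] mult_left_mono[OF I[OF \<epsilon>], of "ennreal K1"] by (auto intro: order_trans)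
      also have "\<dots> = ennreal (K1 * K0 * (1 + ln (1 / \<epsilon>)))"
        using K1 K0 L by (simp add: ennreal_mult[symmetric] mult.assoc)
      also have "\<dots> \<le> ennreal ?A" using K1 K0 K2 L by (intro ennreal_leI mult_right_mono) auto
      finally have 1: "gagliardo s p \<Omega> (log_profile x0 \<epsilon>) \<le> ennreal ?A" .
      have "ennreal (K2 * K0 * (1 + ln (1 / \<epsilon>))) \<le> ennreal ?A"
        using K1 K0 K2 L by (intro ennreal_leI mult_right_mono) auto
      with Lp[OF \<epsilon>] have 2: "(\<integral>\<^sup>+ x. ennreal (\<bar>log_profile x0 \<epsilon> x\<bar> powr p) \<partial>lebesgue_on \<Omega>) \<le> ennreal ?A"
        by (rule order_trans)
      have "0 \<le> ?A" using K1 K0 K2 L by simp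
      from sobolev_norm_fractional_le[OF s(1) True s(3) this u[OF \<epsilon>(1)] 1 2]
      show "log_profile x0 \<epsilon> \<in> sobolev_space s (ereal p) \<Omega> \<and> sobolev_norm s (ereal p) \<Omega> (log_profile x0 \<epsilon>)
         \<le> ennreal (((c_const CARD('n) s p + 1) * ((K1 + K2) * K0) * (1 + ln (1 / \<epsilon>))) powr (1 / p))"
        by (simp only: mult.assoc)
    qed
  next
    case False
    \<comment> \<open>For order 1 the critical relation gives p = N, and the gradient is at most 1 /
      \<rho>; its p-th power is again \<rho> powr (- N).\<close>
    then have s1: "s = 1" "p = ?N" using s by auto
    show thesis
    proof (rule that[of "2 * ((1 + K2) * K0)"])
      show "0 < 2 * ((1 + K2) * K0)" using K0 K2 by (simp add: add_pos_pos)
      fix \<epsilon> :: real assume \<epsilon>: "0 < \<epsilon>" "\<epsilon> \<le> 1"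
      let ?A = "(1 + K2) * K0 * (1 + ln (1 / \<epsilon>))"
      let ?G = "\<lambda>x. (- 1 / (norm (\<epsilon>, x - x0))\<^sup>2) *\<^sub>R (x - x0)"
      have L: "0 \<le> ln (1 / \<epsilon>)" using \<epsilon> by simp
      have "(\<integral>\<^sup>+ x. ennreal (norm (?G x) powr p) \<partial>lebesgue_on \<Omega>) \<le> ?I \<epsilon>"
        unfolding nn_integral_lebesgue_on_eq[OF \<Omega>L]
      proof (intro nn_integral_mono mult_right_mono ennreal_leI)
        fix x
        note b = norm_Pair_bounds[OF \<epsilon>(1), of "x - x0"]
        have "norm (?G x) \<le> 1 / norm (\<epsilon>, x - x0)"
        proof -
          have "norm (?G x) = (1 / (norm (\<epsilon>, x - x0))\<^sup>2) * norm (x - x0)"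
            unfolding norm_scaleR by simp
          also have "\<dots> \<le> (1 / (norm (\<epsilon>, x - x0))\<^sup>2) * norm (\<epsilon>, x - x0)"
            using b(3) by (rule mult_left_mono) simp
          also have "\<dots> = 1 / norm (\<epsilon>, x - x0)" by (simp add: power2_eq_square)
          finally show ?thesis .
        qed
        then have "norm (?G x) powr p \<le> (1 / norm (\<epsilon>, x - x0)) powr p"
          using s by (intro powr_mono2) auto
        also have "\<dots> = norm (\<epsilon>, x - x0) powr (- ?N)"
          using b s1 by (simp add: powr_divide powr_minus_divide)
        finally show "norm (?G x) powr p \<le> norm (\<epsilon>, x - x0) powr (- ?N)" .
      qed simp
      also note I[OF \<epsilon>]
      also have "ennreal (K0 * (1 + ln (1 / \<epsilon>))) \<le> ennreal ?A"
        using K0 K2 L by (intro ennreal_leI mult_right_mono) auto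
      finally have 1: "(\<integral>\<^sup>+ x. ennreal (norm (?G x) powr p) \<partial>lebesgue_on \<Omega>) \<le> ennreal ?A" .
      have "ennreal (K2 * K0 * (1 + ln (1 / \<epsilon>))) \<le> ennreal ?A"
        using K0 K2 L by (intro ennreal_leI mult_right_mono) auto
      with Lp[OF \<epsilon>] have 2: "(\<integral>\<^sup>+ x. ennreal (\<bar>log_profile x0 \<epsilon> x\<bar> powr p) \<partial>lebesgue_on \<Omega>) \<le> ennreal ?A"
        by (rule order_trans)
      have "0 \<le> ?A" using K0 K2 L by simp
      from sobolev_norm_gradient_le[OF s(3) this u[OF \<epsilon>(1)] _ 1 2]
        weak_gradient_of_C1[OF \<Omega>L log_profile_has_derivative[OF \<epsilon>(1)] continuous_on_log_profile_gradient[OF \<epsilon>(1)]]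
      show "log_profile x0 \<epsilon> \<in> sobolev_space s (ereal p) \<Omega> \<and> sobolev_norm s (ereal p) \<Omega> (log_profile x0 \<epsilon>)
         \<le> ennreal ((2 * ((1 + K2) * K0) * (1 + ln (1 / \<epsilon>))) powr (1 / p))"
        unfolding s1(1) by (simp only: mult.assoc)
    qed
  qed
qed

section \<open>Powers and logarithms compared at infinity, and tools for lower bounds\<close>

text \<open>A positive power of X beats every power of 1 + ln X. The root 1 / p is irrelevant here
  and is removed by y powr (1 / p) \<le> 1 + y.\<close>

lemma powr_not_le_log_power:
  fixes a c C K p q X0 :: real
  assumes "0 < a" "0 < c" "0 \<le> C" "0 \<le> K" "1 \<le> p" "0 < q"
    and le: "\<And>X. X0 \<le> X \<Longrightarrow> 1 \<le> X \<Longrightarrow> c * X powr a \<le> (C * (K * (1 + ln X)) powr (1 / p) + 1) powr q"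
  shows False
proof -
  define C' where "C' = C * (1 + K) + 1"
  have C': "0 < C'" using assms by (simp add: C'_def add_nonneg_pos)
  have bound: "c / C' powr q \<le> (1 + ln X) powr q / X powr a" if X: "X0 \<le> X" "1 \<le> X" for X
  proof -
    have L: "0 \<le> ln X" using X by simp
    have 1: "y powr (1 / p) \<le> 1 + y" if "0 \<le> y" for y :: real
    proof (cases "y \<le> 1")
      case True
      then have "y powr (1 / p) \<le> 1" using that assms by (intro powr_le1) auto
      then show ?thesis using that by simp
    next
      case False
      then have "y powr (1 / p) \<le> y powr 1" using assms by (intro powr_mono) auto
      then show ?thesis using False by simp
    qed
    have "C * (K * (1 + ln X)) powr (1 / p) + 1 \<le> C * (1 + K * (1 + ln X)) + 1"
      using assms L by (intro add_right_mono mult_left_mono 1) auto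
    also have "\<dots> \<le> C' * (1 + ln X)"
      using assms L by (simp add: C'_def algebra_simps)
    finally have "(C * (K * (1 + ln X)) powr (1 / p) + 1) powr q \<le> (C' * (1 + ln X)) powr q"
      using assms by (intro powr_mono2) auto
    with le[OF X] have "c * X powr a \<le> C' powr q * (1 + ln X) powr q"
      using C' L by (simp add: powr_mult)
    then show ?thesis using C' X by (simp add: field_simps)
  qed
  have "((\<lambda>X. (1 + ln X) powr q / X powr a) \<longlongrightarrow> 0) at_top"
    using assms(1,6) by real_asymp
  then have "eventually (\<lambda>X. (1 + ln X) powr q / X powr a < c / C' powr q) at_top"
    by (rule order_tendstoD) (use C' assms in simp)
  then have "eventually (\<lambda>X::real. False) at_top"
    using eventually_ge_at_top[of X0] eventually_ge_at_top[of 1]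
    by eventually_elim (use bound in force)
  then show False by simp
qed

text \<open>Here the root is decisive: (1 + ln X) powr (1 / p) is of smaller order than ln X only
  because p > 1. It serves exponent infinity with p itself and the case s' = s with p / q in its
  place.\<close>

lemma ln_not_le_root_of_log:
  fixes C K p d X0 :: real
  assumes "1 < p" "0 \<le> C" "0 \<le> K"
    and le: "\<And>X. X0 \<le> X \<Longrightarrow> 1 \<le> X \<Longrightarrow> ln X - d \<le> C * (K * (1 + ln X)) powr (1 / p)"
  shows False
proof -
  define e where "e = 1 / p"
  have e: "e < 1" "0 < e" using assms(1) by (auto simp: e_def)
  define C' where "C' = C * K powr e"
  have "((\<lambda>X. C' * ((1 + ln X) powr e / (ln X - d))) \<longlongrightarrow> C' * 0) at_top"
    using e by (intro tendsto_mult tendsto_const) real_asymp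
  then have "eventually (\<lambda>X. C' * ((1 + ln X) powr e / (ln X - d)) < 1) at_top"
    by (intro order_tendstoD) auto
  moreover have "eventually (\<lambda>X. ln X - d > 0) at_top" by real_asymp
  ultimately have "eventually (\<lambda>X::real. False) at_top"
    using eventually_ge_at_top[of X0] eventually_ge_at_top[of 1]
  proof eventually_elim
    case (elim X)
    have "ln X - d \<le> C' * (1 + ln X) powr e"
      using le[OF elim(3,4)] assms elim(4) by (simp add: C'_def e_def powr_mult)
    with elim(1,2) show ?case by (simp add: field_simps)
  qed
  then show False by simp
qed

lemma unit_ball_vol_neq_0: "0 \<le> n \<Longrightarrow> unit_ball_vol n \<noteq> 0"
  using unit_ball_vol_pos[of n] by (rule less_imp_neq[THEN not_sym])

lemma AE_imp_ex_in_cball: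
  fixes \<Omega> :: "'a::euclidean_space set"
  assumes "AE x in lebesgue_on \<Omega>. P x" "\<Omega> \<in> sets lebesgue" "cball a r \<subseteq> \<Omega>" "0 < r"
  shows "\<exists>x\<in>cball a r. P x"
proof (rule ccontr)
  assume "\<not> (\<exists>x\<in>cball a r. P x)"
  then have n: "x \<in> cball a r \<Longrightarrow> \<not> P x" for x by blast
  have "AE x in lebesgue. x \<in> \<Omega> \<longrightarrow> P x"
    using assms(1,2) by (simp add: AE_restrict_space_iff)
  then have "AE x in lebesgue. x \<notin> cball a r"
    by eventually_elim (use n assms(3) in blast)
  then have "AE x in lborel. x \<notin> cball a r" by (simp only: AE_completion_iff)
  then have "cball a r \<in> null_sets lborel"
    by (subst (asm) AE_iff_null_sets[symmetric]) auto
  then have "emeasure lborel (cball a r) = 0" by auto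
  then show False using assms(4) by (simp add: emeasure_cball unit_ball_vol_neq_0)
qed

lemma continuous_supported_integral:
  fixes F :: "real^'n::finite \<Rightarrow> real"
  assumes \<Omega>: "\<Omega> \<in> sets lebesgue" "cball z r \<subseteq> \<Omega>" and F: "continuous_on UNIV F" and 0: "\<And>x. x \<notin> cball z r \<Longrightarrow> F x = 0"
  shows "integrable (lebesgue_on \<Omega>) F"
    and "0 \<le> r \<Longrightarrow> (\<And>x. 0 \<le> F x) \<Longrightarrow> (\<And>x. x \<in> cball z (r / 2) \<Longrightarrow> m \<le> F x) \<Longrightarrow>
      m * (unit_ball_vol (real CARD('n)) * (r / 2) ^ CARD('n)) \<le> (LINT x|lebesgue_on \<Omega>. F x)"
proof -
  have m [measurable]: "F \<in> borel_measurable borel" using F by (rule borel_measurable_continuous_onI)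
  have z0: "F x = 0" if "x \<notin> \<Omega>" for x using 0 \<Omega>(2) that by blast
  have "integrable lborel (\<lambda>x. indicator (cball z r) x *\<^sub>R F x)"
    using F by (intro borel_integrable_compact) (auto intro: continuous_on_subset)
  moreover have "(\<lambda>x. indicator (cball z r) x *\<^sub>R F x) = F"
    using 0 by (auto simp: indicator_def fun_eq_iff)
  ultimately have i: "integrable lborel F" by (simp only:)
  then have "integrable lebesgue F" by (simp add: integrable_completion)
  moreover have "(\<lambda>x. indicator \<Omega> x *\<^sub>R F x) = F"
    using z0 by (auto simp: indicator_def fun_eq_iff)
  moreover have "\<Omega> \<inter> space lebesgue \<in> sets lebesgue" using \<Omega>(1) by simp
  ultimately show "integrable (lebesgue_on \<Omega>) F"
    by (simp only: integrable_restrict_space)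
  assume r: "0 \<le> r" and nn: "\<And>x. 0 \<le> F x" and ge: "\<And>x. x \<in> cball z (r / 2) \<Longrightarrow> m \<le> F x"
  have fin: "emeasure lborel (cball z (r / 2)) < \<infinity>" by (rule emeasure_lborel_cball_finite)
  have "m * (unit_ball_vol (real CARD('n)) * (r / 2) ^ CARD('n)) = (LINT x|lborel. indicator (cball z (r / 2)) x *\<^sub>R m)"
    using r by (simp add: content_cball)
  also have "\<dots> \<le> (LINT x|lborel. F x)"
  proof (rule integral_mono)
    show "integrable lborel (\<lambda>x. indicator (cball z (r / 2)) x *\<^sub>R m)"
      by (intro borel_integrable_compact) auto
    show "indicator (cball z (r / 2)) x *\<^sub>R m \<le> F x" for x
      using nn[of x] ge[of x] by (auto split: split_indicator)
  qed (rule i)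
  also have "\<dots> = (LINT x|lebesgue_on \<Omega>. F x)"
    by (intro lebesgue_on_integral_of_support[symmetric] m \<Omega>(1) z0)
  finally show "m * (unit_ball_vol (real CARD('n)) * (r / 2) ^ CARD('n)) \<le> (LINT x|lebesgue_on \<Omega>. F x)" .
qed

text \<open>The choice t = c / 2 absorbs half of the left-hand side; up to a constant this is the
  optimal level and gives what Hoelder's inequality would.\<close>

lemma test_functional_lower_bound:
  fixes B V S q c r :: real
  assumes le: "\<And>t. 0 < t \<Longrightarrow> c * V \<le> t * V + t powr (1 - q) * B" and "0 < c" "0 < V"
  shows "(c / 2) powr q * V \<le> B"
proof -
  have "c * V \<le> c / 2 * V + (c / 2) powr (1 - q) * B" using assms by (intro le) simp
  then have "c / 2 * V \<le> (c / 2) powr (1 - q) * B" by simp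
  then have "(c / 2) powr (q - 1) * (c / 2 * V) \<le> (c / 2) powr (q - 1) * ((c / 2) powr (1 - q) * B)"
    by (intro mult_left_mono) auto
  also have "\<dots> = B" using assms by (simp add: mult.assoc[symmetric] powr_add[symmetric])
  also have "(c / 2) powr (q - 1) * (c / 2 * V) = (c / 2) powr q * V"
    using assms powr_mult_base[of "c / 2" "q - 1"] by (simp add: mult_ac)
  finally show ?thesis .
qed

section \<open>Exponent infinity and supercritical targets\<close>

lemma log_profile_embedding_bound:
  fixes \<Omega> :: "(real^'n::finite) set"
  assumes \<Omega>: "open \<Omega>" "bounded \<Omega>" and s: "0 < s" "s \<le> 1" "1 \<le> p" "s * p = real CARD('n)"
    and emb: "continuously_embedded \<Omega> s (ereal p) s' p'"
  obtains C K where "0 \<le> C" "0 \<le> K" "\<And>\<epsilon>. 0 < \<epsilon> \<Longrightarrow> \<epsilon> \<le> 1 \<Longrightarrow> \<exists>v\<in>sobolev_space s' p' \<Omega>.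
    (AE x in lebesgue_on \<Omega>. v x = log_profile x0 \<epsilon> x) \<and>
    sobolev_norm s' p' \<Omega> v \<le> ennreal (C * (K * (1 + ln (1 / \<epsilon>))) powr (1 / p))"
proof -
  obtain K where K: "0 < K" "\<And>\<epsilon>. 0 < \<epsilon> \<Longrightarrow> \<epsilon> \<le> 1 \<Longrightarrow> log_profile x0 \<epsilon> \<in> sobolev_space s (ereal p) \<Omega> \<and>
    sobolev_norm s (ereal p) \<Omega> (log_profile x0 \<epsilon>) \<le> ennreal ((K * (1 + ln (1 / \<epsilon>))) powr (1 / p))"
    using log_profile_source_bound[OF \<Omega> s] by blast
  obtain C where C: "0 \<le> C" "\<And>u B. u \<in> sobolev_space s (ereal p) \<Omega> \<Longrightarrow> sobolev_norm s (ereal p) \<Omega> u \<le> ennreal B \<Longrightarrow> 0 \<le> B \<Longrightarrow>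
    \<exists>v\<in>sobolev_space s' p' \<Omega>. (AE x in lebesgue_on \<Omega>. v x = u x) \<and> sobolev_norm s' p' \<Omega> v \<le> ennreal (C * B)"
    using continuously_embeddedE[OF emb] by blast
  show thesis
    using that[of C K] C K by simp
qed

text \<open>On the ball of radius \<epsilon> about x0 the radius is at most 2 \<epsilon>, so with X
  = 1 / \<epsilon> the profile is at least ln X - ln 2. An almost-everywhere bound applies at some
  point of that ball.\<close>

lemma not_embedded_infinity:
  fixes \<Omega> :: "(real^'n::finite) set"
  assumes \<Omega>: "open \<Omega>" "bounded \<Omega>" "\<Omega> \<noteq> {}" and s: "0 < s" "s \<le> 1" "1 < p" "s * p = real CARD('n)"
  shows "\<not> continuously_embedded \<Omega> s (ereal p) s' \<infinity>"
proof
  assume emb: "continuously_embedded \<Omega> s (ereal p) s' \<infinity>"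
  obtain x0 where "x0 \<in> \<Omega>" using \<Omega>(3) by blast
  then obtain r where r: "0 < r" "cball x0 r \<subseteq> \<Omega>" using \<Omega>(1) open_contains_cball by blast
  have \<Omega>L: "\<Omega> \<in> sets lebesgue" using \<Omega>(1) by simp
  obtain C K where CK: "0 \<le> C" "0 \<le> K" "\<And>\<epsilon>. 0 < \<epsilon> \<Longrightarrow> \<epsilon> \<le> 1 \<Longrightarrow> \<exists>v\<in>sobolev_space s' \<infinity> \<Omega>.
    (AE x in lebesgue_on \<Omega>. v x = log_profile x0 \<epsilon> x) \<and>
    sobolev_norm s' \<infinity> \<Omega> v \<le> ennreal (C * (K * (1 + ln (1 / \<epsilon>))) powr (1 / p))"
    by (rule log_profile_embedding_bound[OF \<Omega>(1,2) s(1,2) less_imp_le[OF s(3)] s(4) emb, of x0]) (rule that)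
  show False
  proof (rule ln_not_le_root_of_log[of p C K "1 / r" "ln 2"])
    fix X assume X: "1 / r \<le> X" "1 \<le> X"
    define \<epsilon> where "\<epsilon> = 1 / X"
    have \<epsilon>: "0 < \<epsilon>" "\<epsilon> \<le> 1" "\<epsilon> \<le> r" "1 / \<epsilon> = X"
      using X r by (auto simp: \<epsilon>_def field_simps)
    let ?B = "C * (K * (1 + ln X)) powr (1 / p)"
    obtain v where v: "AE x in lebesgue_on \<Omega>. v x = log_profile x0 \<epsilon> x" "sobolev_norm s' \<infinity> \<Omega> v \<le> ennreal ?B"
      using CK(3)[OF \<epsilon>(1,2)] \<epsilon>(4) by auto
    have "0 \<le> ?B" using CK by simp
    then have "AE x in lebesgue_on \<Omega>. \<bar>v x\<bar> \<le> ?B"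
      using v(2) by (rule AE_le_of_sobolev_norm_infinity_le)
    with v(1) have "AE x in lebesgue_on \<Omega>. \<bar>log_profile x0 \<epsilon> x\<bar> \<le> ?B"
      by eventually_elim simp
    moreover have "cball x0 \<epsilon> \<subseteq> \<Omega>" using \<epsilon>(3) r(2) by (meson order_trans subset_cball)
    ultimately obtain x where x: "x \<in> cball x0 \<epsilon>" "\<bar>log_profile x0 \<epsilon> x\<bar> \<le> ?B"
      using AE_imp_ex_in_cball[OF _ \<Omega>L] \<epsilon>(1) by blast
    have "norm (\<epsilon>, x - x0) \<le> 2 * \<epsilon>"
      using norm_Pair_bounds(4)[OF \<epsilon>(1), of "x - x0"] x(1) by (simp add: dist_norm norm_minus_commute)
    then have "ln (norm (\<epsilon>, x - x0)) \<le> ln (2 * \<epsilon>)"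
      using norm_Pair_bounds(1)[OF \<epsilon>(1), of "x - x0"] by (intro ln_mono) auto
    also have "\<dots> = ln 2 - ln X" using X by (simp add: \<epsilon>_def ln_div)
    finally show "ln X - ln 2 \<le> ?B" using x(2) by (simp add: log_profile_def)
  qed (use s CK in auto)
qed

text \<open>Two balls of radius \<epsilon> at mutual distance of order \<epsilon> suffice: the
  profile differs between them by a constant, so the energy is at least of order \<epsilon> powr (2
  N) / \<epsilon> powr (N + s' q), a negative power of \<epsilon>.\<close>

lemma not_embedded_supercritical_fractional:
  fixes \<Omega> :: "(real^'n::finite) set"
  assumes \<Omega>: "open \<Omega>" "bounded \<Omega>" "\<Omega> \<noteq> {}" and s: "0 < s" "s \<le> 1" "1 \<le> p" "s * p = real CARD('n)"
    and s': "0 < s'" "s' < 1" "1 \<le> q" "real CARD('n) < s' * q"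
  shows "\<not> continuously_embedded \<Omega> s (ereal p) s' (ereal q)"
proof
  assume emb: "continuously_embedded \<Omega> s (ereal p) s' (ereal q)"
  let ?N = "real CARD('n)" and ?V = "unit_ball_vol (real CARD('n))"
  obtain x0 where "x0 \<in> \<Omega>" using \<Omega>(3) by blast
  then obtain r where r: "0 < r" "cball x0 r \<subseteq> \<Omega>" using \<Omega>(1) open_contains_cball by blast
  obtain C K where CK: "0 \<le> C" "0 \<le> K" "\<And>\<epsilon>. 0 < \<epsilon> \<Longrightarrow> \<epsilon> \<le> 1 \<Longrightarrow> \<exists>v\<in>sobolev_space s' (ereal q) \<Omega>.
    (AE x in lebesgue_on \<Omega>. v x = log_profile x0 \<epsilon> x) \<and>
    sobolev_norm s' (ereal q) \<Omega> v \<le> ennreal (C * (K * (1 + ln (1 / \<epsilon>))) powr (1 / p))"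
    by (rule log_profile_embedding_bound[OF \<Omega>(1,2) s emb, of x0]) (rule that)
  have c: "0 < c_const CARD('n) s' q" using s' by (intro c_const_pos) (auto simp: Suc_leI)
  define c0 where "c0 = ln (3 / 2) powr q * ?V\<^sup>2 * 6 powr (- (?N + s' * q)) * c_const CARD('n) s' q"
  show False
  proof (rule powr_not_le_log_power[of "s' * q - ?N" c0 C K p q "5 / r"])
    show "0 < c0" unfolding c0_def using c unit_ball_vol_pos[of ?N] by (intro mult_pos_pos) (auto simp: unit_ball_vol_neq_0)
    fix X assume X: "5 / r \<le> X" "1 \<le> X"
    define \<epsilon> where "\<epsilon> = 1 / X"
    have \<epsilon>: "0 < \<epsilon>" "\<epsilon> \<le> 1" "5 * \<epsilon> \<le> r" "1 / \<epsilon> = X"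
      using X r by (auto simp: \<epsilon>_def field_simps)
    let ?B = "C * (K * (1 + ln X)) powr (1 / p)"
    have B: "0 \<le> ?B" using CK by simp
    let ?w = "log_profile x0 \<epsilon>"
    obtain v where v: "v \<in> sobolev_space s' (ereal q) \<Omega>" "AE x in lebesgue_on \<Omega>. v x = ?w x" "sobolev_norm s' (ereal q) \<Omega> v \<le> ennreal ?B"
      using CK(3)[OF \<epsilon>(1,2)] \<epsilon>(4) by auto
    have w: "?w \<in> borel_measurable (lebesgue_on \<Omega>)"
      using log_profile_has_derivative[OF \<epsilon>(1)]
      by (intro measurable_lebesgue_on_of_borel borel_measurable_continuous_onI continuous_at_imp_continuous_on)
         (auto intro: has_derivative_continuous)
    have "gagliardo s' q \<Omega> ?w = gagliardo s' q \<Omega> v"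
      using v(1,2) w \<Omega> by (intro gagliardo_cong_AE[symmetric]) (auto simp: sobolev_space_def)
    also have "\<dots> \<le> ennreal (?B powr q / c_const CARD('n) s' q)"
      by (rule gagliardo_le_of_sobolev_norm_le[OF s'(1,2,3) B v(3)])
    finally have up: "gagliardo s' q \<Omega> ?w \<le> ennreal (?B powr q / c_const CARD('n) s' q)" .
    define k :: 'n where "k = undefined"
    \<comment> \<open>With centres 4 \<epsilon> apart, the radius is at most 2 \<epsilon> on the
      first ball and at least 3 \<epsilon> on the second, whence ln (3 / 2); pairs are at most 6
      \<epsilon> apart, and both balls lie within 5 \<epsilon> of x0.\<close>
    define b where "b = x0 + (4 * \<epsilon>) *\<^sub>R axis k 1"
    have nb: "norm (b - x0) = 4 * \<epsilon>" using \<epsilon>(1) by (simp add: b_def)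
    let ?m = "ln (3 / 2) powr q / (6 * \<epsilon>) powr (?N + s' * q)"
    have low: "ennreal (?m * (?V * \<epsilon> ^ CARD('n))\<^sup>2) \<le> gagliardo s' q \<Omega> ?w"
    proof (rule gagliardo_ge_on_cballs[OF \<Omega>(1,2)])
      show "cball x0 \<epsilon> \<subseteq> \<Omega>"
        using subset_cball[of \<epsilon> r x0] \<epsilon> r(2) by auto
      show "cball b \<epsilon> \<subseteq> \<Omega>"
      proof -
        have "cball b \<epsilon> \<subseteq> cball x0 (5 * \<epsilon>)"
          using nb by (auto simp: cball_subset_cball_iff dist_norm)
        also have "\<dots> \<subseteq> cball x0 r" using \<epsilon>(3) by (rule subset_cball)
        finally show ?thesis using r(2) by blast
      qed
      fix x y assume x: "x \<in> cball x0 \<epsilon>" and y: "y \<in> cball b \<epsilon>"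
      have nx: "norm (x - x0) \<le> \<epsilon>" and ny: "norm (y - b) \<le> \<epsilon>"
        using x y by (simp_all add: dist_norm norm_minus_commute)
      have ny0: "3 * \<epsilon> \<le> norm (y - x0)"
        using norm_triangle_ineq[of "y - x0" "b - y"] nb ny by (simp add: norm_minus_commute)
      have xy: "norm (x - y) \<le> 6 * \<epsilon>"
        using norm_triangle_ineq[of "x - x0" "x0 - b"] norm_triangle_ineq[of "x - b" "b - y"] nb nx ny
        by (simp add: norm_minus_commute)
      have xy0: "x \<noteq> y" using nx ny0 \<epsilon>(1) by auto
      note bx = norm_Pair_bounds[OF \<epsilon>(1), of "x - x0"] and by' = norm_Pair_bounds[OF \<epsilon>(1), of "y - x0"]
      have "3 / 2 \<le> norm (\<epsilon>, y - x0) / norm (\<epsilon>, x - x0)"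
        using bx by' nx ny0 by (simp add: field_simps)
      then have "ln (3 / 2) \<le> ln (norm (\<epsilon>, y - x0) / norm (\<epsilon>, x - x0))"
        by (intro ln_mono) auto
      also have "\<dots> = ?w x - ?w y"
        using bx by' by (simp add: log_profile_def ln_div)
      finally have "ln (3 / 2) powr q \<le> \<bar>?w x - ?w y\<bar> powr q"
        using s' by (intro powr_mono2) auto
      moreover have "norm (x - y) powr (?N + s' * q) \<le> (6 * \<epsilon>) powr (?N + s' * q)"
        using xy s' by (intro powr_mono2) auto
      ultimately show "?m \<le> \<bar>?w x - ?w y\<bar> powr q / norm (x - y) powr (?N + s' * q)"
        using xy0 by (intro frac_le) auto
    qed (use \<epsilon> in auto)
    have "ennreal (?m * (?V * \<epsilon> ^ CARD('n))\<^sup>2) \<le> ennreal (?B powr q / c_const CARD('n) s' q)"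
      using low up by (rule order_trans)
    then have "?m * (?V * \<epsilon> ^ CARD('n))\<^sup>2 \<le> ?B powr q / c_const CARD('n) s' q"
      using c by (subst (asm) ennreal_le_iff) auto
    then have "?m * (?V * \<epsilon> ^ CARD('n))\<^sup>2 * c_const CARD('n) s' q \<le> ?B powr q"
      using c by (simp add: field_simps)
    also have "?m * (?V * \<epsilon> ^ CARD('n))\<^sup>2 * c_const CARD('n) s' q = c0 * X powr (s' * q - ?N)"
    proof -
      have sq: "(\<epsilon> ^ CARD('n))\<^sup>2 = \<epsilon> powr (2 * ?N)"
        using powr_realpow[OF \<epsilon>(1), of "CARD('n) * 2"] by (simp add: power_mult mult.commute)
      have "?m * (?V * \<epsilon> ^ CARD('n))\<^sup>2 = ln (3 / 2) powr q * ?V\<^sup>2 * 6 powr (- (?N + s' * q)) * (\<epsilon> powr (2 * ?N) / \<epsilon> powr (?N + s' * q))"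
      proof -
        have 1: "(6 * \<epsilon>) powr (?N + s' * q) = 6 powr (?N + s' * q) * \<epsilon> powr (?N + s' * q)"
          by (rule powr_mult)
        have 2: "a / (b * c) * (v * w) = a * v * (1 / b) * (w / c)" for a b c v w :: real by simp
        show ?thesis
          unfolding 1 power_mult_distrib sq powr_minus_divide by (rule 2)
      qed
      also have "\<epsilon> powr (2 * ?N) / \<epsilon> powr (?N + s' * q) = \<epsilon> powr (- (s' * q - ?N))"
        by (simp add: powr_diff[symmetric])
      also have "\<dots> = X powr (s' * q - ?N)"
      proof -
        have "(1 / X) powr (- a) = X powr a" for a
          unfolding powr_divide powr_minus_divide[of X a] by simp
        then show ?thesis unfolding \<epsilon>_def .
      qed
      finally show ?thesis by (simp add: c0_def)
    qed
    also have "?B powr q \<le> (?B + 1) powr q" using B s' by (intro powr_mono2) auto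
    finally show "c0 * X powr (s' * q - ?N) \<le> (?B + 1) powr q" .
  qed (use s s' CK in auto)
qed

text \<open>The gradient has size 1 / \<epsilon> on a ball of radius \<epsilon>, so its q-th power
  has integral of order \<epsilon> powr (N - q).\<close>

lemma not_embedded_supercritical_gradient:
  fixes \<Omega> :: "(real^'n::finite) set"
  assumes \<Omega>: "open \<Omega>" "bounded \<Omega>" "\<Omega> \<noteq> {}" and s: "0 < s" "s \<le> 1" "1 \<le> p" "s * p = real CARD('n)"
    and q: "1 \<le> q" "real CARD('n) < q"
  shows "\<not> continuously_embedded \<Omega> s (ereal p) 1 (ereal q)"
proof
  assume emb: "continuously_embedded \<Omega> s (ereal p) 1 (ereal q)"
  let ?N = "real CARD('n)" and ?V = "unit_ball_vol (real CARD('n))"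
  have \<Omega>L: "\<Omega> \<in> sets lebesgue" using \<Omega>(1) by simp
  obtain x0 where "x0 \<in> \<Omega>" using \<Omega>(3) by blast
  then obtain r where r: "0 < r" "cball x0 r \<subseteq> \<Omega>" using \<Omega>(1) open_contains_cball by blast
  obtain C K where CK: "0 \<le> C" "0 \<le> K" "\<And>\<epsilon>. 0 < \<epsilon> \<Longrightarrow> \<epsilon> \<le> 1 \<Longrightarrow> \<exists>v\<in>sobolev_space 1 (ereal q) \<Omega>.
    (AE x in lebesgue_on \<Omega>. v x = log_profile x0 \<epsilon> x) \<and>
    sobolev_norm 1 (ereal q) \<Omega> v \<le> ennreal (C * (K * (1 + ln (1 / \<epsilon>))) powr (1 / p))"
    by (rule log_profile_embedding_bound[OF \<Omega>(1,2) s emb, of x0]) (rule that)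
  \<comment> \<open>Bump height on the half ball, the bound 1 / (16 \<epsilon>) for the gradient
    component, and the volume loss from halving the radius.\<close>
  define c1 :: real where "c1 = exp (- 4 / 3) / 16 / 2 ^ CARD('n)"
  have c1: "0 < c1" by (simp add: c1_def)
  have V: "0 < ?V" by simp
  define c0 where "c0 = (c1 / 2) powr q * ?V"
  show False
  proof (rule powr_not_le_log_power[of "q - ?N" c0 C K p q "3 / r"])
    show "0 < c0" using c1 V by (auto simp: c0_def intro!: mult_pos_pos)
    fix X assume X: "3 / r \<le> X" "1 \<le> X"
    define \<epsilon> where "\<epsilon> = 1 / X"
    have \<epsilon>: "0 < \<epsilon>" "\<epsilon> \<le> 1" "3 * \<epsilon> \<le> r" "1 / \<epsilon> = X"
      using X r by (auto simp: \<epsilon>_def field_simps)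
    let ?B = "C * (K * (1 + ln X)) powr (1 / p)"
    have B: "0 \<le> ?B" using CK by simp
    obtain v where v: "v \<in> sobolev_space 1 (ereal q) \<Omega>" "AE x in lebesgue_on \<Omega>. v x = log_profile x0 \<epsilon> x"
      "sobolev_norm 1 (ereal q) \<Omega> v \<le> ennreal ?B"
      using CK(3)[OF \<epsilon>(1,2)] \<epsilon>(4) by auto
    have vm: "v \<in> borel_measurable (lebesgue_on \<Omega>)" using v(1) by (simp add: sobolev_space_def)
    obtain g where g: "weak_gradient \<Omega> v g"
      "(\<integral>\<^sup>+ x. ennreal (norm (g x) powr q) \<partial>lebesgue_on \<Omega>) \<le> ennreal ((?B + 1) powr q)"
      by (rule weak_gradient_of_sobolev_norm_le[OF q(1) B v(3)]) (rule that)
    define k :: 'n where "k = undefined"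
    \<comment> \<open>The bump is placed off centre: about x0 the gradient component is odd and its
      integral against the bump would vanish. On this ball the k-th coordinate of x - x0 is at least
      \<epsilon> and the radius at most 4 \<epsilon>.\<close>
    define z where "z = x0 + (2 * \<epsilon>) *\<^sub>R axis k 1"
    have nz: "norm (z - x0) = 2 * \<epsilon>" using \<epsilon>(1) by (simp add: z_def)
    have sub: "cball z \<epsilon> \<subseteq> \<Omega>"
    proof -
      have "cball z \<epsilon> \<subseteq> cball x0 (3 * \<epsilon>)" using nz by (auto simp: cball_subset_cball_iff dist_norm)
      also have "\<dots> \<subseteq> cball x0 r" using \<epsilon>(3) by (rule subset_cball)
      finally show ?thesis using r(2) by blast
    qed
    let ?\<phi> = "bump z \<epsilon>" and ?G = "\<lambda>x. (- 1 / (norm (\<epsilon>, x - x0))\<^sup>2) *\<^sub>R (x - x0)"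
    have \<phi>: "test_function \<Omega> ?\<phi>"
      using bump_eq_0[OF \<epsilon>(1)] by (intro test_functionI[OF smooth_expr_bump sub])
    have \<phi>0: "?\<phi> x = 0" if "x \<notin> cball z \<epsilon>" for x
      using that by (intro bump_eq_0[OF \<epsilon>(1)]) (simp add: dist_norm norm_minus_commute)
    have \<phi>1: "\<bar>?\<phi> x\<bar> \<le> 1" for x using bump_bounds[of z \<epsilon> x] by simp
    note G = log_profile_has_derivative[OF \<epsilon>(1), of x0] continuous_on_log_profile_gradient[OF \<epsilon>(1), of x0]
    have up: "\<bar>LINT x|lebesgue_on \<Omega>. ?G x $ k * ?\<phi> x\<bar> \<le> t * (?V * \<epsilon> ^ CARD('n)) + t powr (1 - q) * (?B + 1) powr q"
      if "0 < t" for t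
      using weak_gradient_test_bound[OF \<Omega>L G vm v(2) g(1,2) _ \<phi> \<phi>1 \<phi>0 sub \<epsilon>(1) q(1) that] by simp
    have Gk: "1 / (16 * \<epsilon>) \<le> - ?G x $ k" if x: "x \<in> cball z \<epsilon>" for x
    proof -
      have nx: "norm (x - z) \<le> \<epsilon>" using x by (simp add: dist_norm norm_minus_commute)
      have "\<bar>(x - z) $ k\<bar> \<le> \<epsilon>" using component_le_norm_cart[of "x - z" k] nx by linarith
      then have xk: "\<epsilon> \<le> (x - x0) $ k" by (simp add: z_def)
      have "norm (x - x0) \<le> 3 * \<epsilon>" using norm_triangle_ineq[of "x - z" "z - x0"] nx nz by simp
      then have \<rho>: "norm (\<epsilon>, x - x0) \<le> 4 * \<epsilon>" using norm_Pair_bounds(4)[OF \<epsilon>(1), of "x - x0"] by simp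
      have "1 / (16 * \<epsilon>) = \<epsilon> / (4 * \<epsilon>)\<^sup>2" using \<epsilon>(1) by (simp add: power2_eq_square)
      also have "\<dots> \<le> (x - x0) $ k / (norm (\<epsilon>, x - x0))\<^sup>2"
      proof (rule frac_le[OF _ xk])
        show "0 \<le> (x - x0) $ k" using xk \<epsilon>(1) by linarith
        show "0 < (norm (\<epsilon>, x - x0))\<^sup>2" using norm_Pair_bounds(1)[OF \<epsilon>(1), of "x - x0"] by (rule zero_less_power)
        show "(norm (\<epsilon>, x - x0))\<^sup>2 \<le> (4 * \<epsilon>)\<^sup>2" using \<rho> by (rule power_mono) simp
      qed
      also have "\<dots> = - ?G x $ k" by simp
      finally show ?thesis .
    qed
    have "c1 / \<epsilon> * (?V * \<epsilon> ^ CARD('n)) = exp (- 4 / 3) / (16 * \<epsilon>) * (?V * (\<epsilon> / 2) ^ CARD('n))"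
      by (simp add: c1_def power_divide)
    also have "\<dots> \<le> (LINT x|lebesgue_on \<Omega>. - ?G x $ k * ?\<phi> x)"
    proof (rule continuous_supported_integral(2)[OF \<Omega>L sub])
      show "continuous_on UNIV (\<lambda>x. - ?G x $ k * ?\<phi> x)"
        using G(2) test_function_has_derivative(1)[OF \<phi>]
        by (intro continuous_on_mult continuous_on_minus continuous_on_component)
      show "- ?G x $ k * ?\<phi> x = 0" if "x \<notin> cball z \<epsilon>" for x using \<phi>0[OF that] by simp
      show "0 \<le> - ?G x $ k * ?\<phi> x" for x
      proof (cases "x \<in> cball z \<epsilon>")
        case True
        have "0 \<le> 1 / (16 * \<epsilon>)" using \<epsilon>(1) by simp
        also note Gk[OF True]
        finally show ?thesis using bump_bounds(1)[of z \<epsilon> x] by (rule mult_nonneg_nonneg)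
      qed (simp add: \<phi>0)
      fix x assume x: "x \<in> cball z (\<epsilon> / 2)"
      have 1: "exp (- 4 / 3) \<le> ?\<phi> x"
        using x by (intro bump_ge[OF \<epsilon>(1)]) (simp add: dist_norm norm_minus_commute)
      have 2: "1 / (16 * \<epsilon>) \<le> - ?G x $ k"
        using x \<epsilon>(1) subset_cball[of "\<epsilon> / 2" \<epsilon> z] by (intro Gk) auto
      have "1 / (16 * \<epsilon>) * exp (- 4 / 3) \<le> - ?G x $ k * ?\<phi> x"
      proof (rule mult_mono[OF 2 1])
        have "0 \<le> 1 / (16 * \<epsilon>)" using \<epsilon>(1) by simp
        then show "0 \<le> - ?G x $ k" using 2 by (rule order_trans)
      qed simp
      then show "exp (- 4 / 3) / (16 * \<epsilon>) \<le> - ?G x $ k * ?\<phi> x" by simp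
    qed (use \<epsilon> in auto)
    also have "\<dots> = - (LINT x|lebesgue_on \<Omega>. ?G x $ k * ?\<phi> x)"
      by (subst integral_minus[symmetric]) (simp only: mult_minus_left)
    also have "\<dots> \<le> \<bar>LINT x|lebesgue_on \<Omega>. ?G x $ k * ?\<phi> x\<bar>" by simp
    finally have low: "c1 / \<epsilon> * (?V * \<epsilon> ^ CARD('n)) \<le> \<bar>LINT x|lebesgue_on \<Omega>. ?G x $ k * ?\<phi> x\<bar>" .
    have "(c1 / \<epsilon> / 2) powr q * (?V * \<epsilon> ^ CARD('n)) \<le> (?B + 1) powr q"
      using low up c1 \<epsilon>(1) V by (intro test_functional_lower_bound) (auto intro: order_trans)
    also have "(c1 / \<epsilon> / 2) powr q * (?V * \<epsilon> ^ CARD('n)) = c0 * X powr (q - ?N)"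
    proof -
      have 1: "\<epsilon> ^ CARD('n) = 1 / X powr ?N"
        using X powr_realpow[of X "CARD('n)"] by (simp add: \<epsilon>_def power_divide)
      have "c1 / \<epsilon> / 2 = c1 / 2 * X" by (simp add: \<epsilon>_def)
      then have 2: "(c1 / \<epsilon> / 2) powr q = (c1 / 2) powr q * X powr q" by (simp only: powr_mult)
      show ?thesis
        unfolding 1 2 c0_def powr_diff by simp
    qed
    finally show "c0 * X powr (q - ?N) \<le> (?B + 1) powr q" .
  qed (use s q CK in auto)
qed

section \<open>Oscillating functions\<close>

text \<open>Up to the wavelength 1 / \<Lambda> the Lipschitz bound gives a contribution in which all
  powers of \<Lambda> cancel. Beyond it the Hoelder bound leaves the critical exponent - N, and
  integrating from 1 / \<Lambda> to R produces ln \<Lambda>.\<close>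

lemma nn_integral_oscillation_kernel_le:
  fixes p A \<Lambda> R :: real
  assumes "real CARD('n::finite) < p" "0 \<le> A" "1 \<le> \<Lambda>" "1 \<le> R"
  shows "(\<integral>\<^sup>+h. (if norm h \<le> 1 / \<Lambda> then ennreal (A * \<Lambda> powr (p - real CARD('n)) * norm h powr (p - 2 * real CARD('n)))
      else ennreal (A * norm h powr (- real CARD('n)))) * indicator {..R} (norm h) \<partial>(lborel :: (real^'n) measure))
    \<le> ennreal (A * unit_ball_vol (real CARD('n)) * (real CARD('n) / (p - real CARD('n)) + 1 + real CARD('n) * ln R + real CARD('n)) * (1 + ln \<Lambda>))"
proof -
  let ?N = "real CARD('n)" and ?V = "unit_ball_vol (real CARD('n))"
  have \<Lambda>: "0 < 1 / \<Lambda>" "1 / \<Lambda> \<le> R" using assms by (auto simp: field_simps intro: order_trans)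
  have L: "0 \<le> ln \<Lambda>" "0 \<le> ln R" using assms by auto
  have "(\<integral>\<^sup>+h. (if norm h \<le> 1 / \<Lambda> then ennreal (A * \<Lambda> powr (p - ?N) * norm h powr (p - 2 * ?N))
      else ennreal (A * norm h powr (- ?N))) * indicator {..R} (norm h) \<partial>(lborel :: (real^'n) measure))
   \<le> (\<integral>\<^sup>+h. ennreal (A * \<Lambda> powr (p - ?N)) * (ennreal (norm h powr ((p - ?N) - ?N)) * indicator {..1 / \<Lambda>} (norm h))
      + ennreal A * (ennreal (max (1 / \<Lambda>) (norm h) powr (- ?N)) * indicator {..R} (norm h)) \<partial>(lborel :: (real^'n) measure))"
    using assms by (intro nn_integral_mono) (auto simp: ennreal_mult max_def split: split_indicator)
  also have "\<dots> = ennreal (A * \<Lambda> powr (p - ?N)) * ennreal (?N * ?V * (1 / \<Lambda>) powr (p - ?N) / (p - ?N))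
      + ennreal A * (\<integral>\<^sup>+h. ennreal (max (1 / \<Lambda>) (norm h) powr (- ?N)) * indicator {..R} (norm h) \<partial>(lborel :: (real^'n) measure))"
    using nn_integral_norm_powr_near_0[where ?'a = "real^'n" and a = "p - ?N" and r = "1 / \<Lambda>"] assms
    by (subst nn_integral_add) (simp_all add: nn_integral_cmult)
  also have "\<dots> \<le> ennreal (A * \<Lambda> powr (p - ?N)) * ennreal (?N * ?V * (1 / \<Lambda>) powr (p - ?N) / (p - ?N))
      + ennreal A * ennreal (?V * (1 + ?N * ln (R / (1 / \<Lambda>))))"
    using nn_integral_truncated_norm_powr_le[OF \<Lambda>, where ?'a = "real^'n"]
    by (intro add_left_mono mult_left_mono) auto
  also have "\<dots> = ennreal (A * \<Lambda> powr (p - ?N) * (?N * ?V * (1 / \<Lambda>) powr (p - ?N) / (p - ?N)) + A * (?V * (1 + ?N * ln (R / (1 / \<Lambda>)))))"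
    using assms by (simp add: ennreal_mult[symmetric] ennreal_plus[symmetric] ln_mult del: ennreal_plus)
  also have "A * \<Lambda> powr (p - ?N) * (?N * ?V * (1 / \<Lambda>) powr (p - ?N) / (p - ?N))
      = A * ?V * (?N / (p - ?N)) * (\<Lambda> powr (p - ?N) * (1 / \<Lambda>) powr (p - ?N))" by simp
  also have "\<Lambda> powr (p - ?N) * (1 / \<Lambda>) powr (p - ?N) = 1"
    unfolding powr_mult[symmetric] using assms by simp
  also have "A * (?V * (1 + ?N * ln (R / (1 / \<Lambda>)))) = A * ?V * (1 + ?N * ln R + ?N * ln \<Lambda>)"
    using assms by (simp add: ln_mult algebra_simps)
  also have "A * ?V * (?N / (p - ?N)) * 1 + A * ?V * (1 + ?N * ln R + ?N * ln \<Lambda>)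
     = A * ?V * (?N / (p - ?N) + 1 + ?N * ln R + ?N * ln \<Lambda>)" by (simp add: distrib_left)
  \<comment> \<open>From a + N L to (a + N) (1 + L), with L = ln \<Lambda> and a the terms without
    \<Lambda>.\<close>
  also have "\<dots> \<le> A * ?V * ((?N / (p - ?N) + 1 + ?N * ln R + ?N) * (1 + ln \<Lambda>))"
  proof (rule mult_left_mono)
    have "0 \<le> (?N / (p - ?N) + 1 + ?N * ln R) * ln \<Lambda>" using assms L by simp
    then show "?N / (p - ?N) + 1 + ?N * ln R + ?N * ln \<Lambda> \<le> (?N / (p - ?N) + 1 + ?N * ln R + ?N) * (1 + ln \<Lambda>)"
      by (simp add: distrib_left distrib_right)
  qed (use assms in simp)
  finally show ?thesis by (simp add: mult.assoc ennreal_leI)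
qed

text \<open>What single waves and lacunary sums with frequencies up to \<Lambda> have in common: a
  wave of frequency \<Lambda> and amplitude \<Lambda> powr (- s) has Lipschitz constant \<Lambda>
  powr (1 - s). The source estimate uses nothing else.\<close>

definition oscillating :: "real \<Rightarrow> real \<Rightarrow> real \<Rightarrow> ('a::real_normed_vector \<Rightarrow> real) \<Rightarrow> bool" where
  "oscillating s A \<Lambda> u \<longleftrightarrow> continuous_on UNIV u \<and> (\<forall>x. \<bar>u x\<bar> \<le> A) \<and>
    (\<forall>x y. \<bar>u x - u y\<bar> \<le> A * norm (x - y) powr s) \<and>
    (\<forall>x y. \<bar>u x - u y\<bar> \<le> A * \<Lambda> powr (1 - s) * norm (x - y))"

text \<open>The majorant depends on the distance alone, so the outer integral contributes only the
  measure of \<Omega> and the logarithm comes entirely from the kernel.\<close>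

lemma oscillation_source_bound:
  fixes \<Omega> :: "(real^'n::finite) set" and A :: real
  assumes \<Omega>: "open \<Omega>" "bounded \<Omega>" and s: "0 < s" "s < 1" "1 \<le> p" "s * p = real CARD('n)" and A: "0 \<le> A"
  obtains K where "0 \<le> K" "\<And>u \<Lambda>. 1 \<le> \<Lambda> \<Longrightarrow> oscillating s A \<Lambda> u \<Longrightarrow>
    u \<in> sobolev_space s (ereal p) \<Omega> \<and> sobolev_norm s (ereal p) \<Omega> u \<le> ennreal ((K * (1 + ln \<Lambda>)) powr (1 / p))"
proof -
  let ?N = "real CARD('n)" and ?V = "unit_ball_vol (real CARD('n))"
  have N: "0 < ?N" by simp
  have pN: "?N < p" using s mult_strict_right_mono[of s 1 p] by simp
  have \<Omega>L: "\<Omega> \<in> sets lebesgue" using \<Omega>(1) by simp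
  obtain D where D: "\<forall>x\<in>\<Omega>. \<forall>y\<in>\<Omega>. dist x y \<le> D"
    using \<Omega>(2) unfolding bounded_two_points by blast
  define R where "R = max D 1"
  have R: "\<And>x y. x \<in> \<Omega> \<Longrightarrow> y \<in> \<Omega> \<Longrightarrow> norm (x - y) \<le> R" "1 \<le> R"
    using D by (force simp: R_def dist_norm)+
  have "emeasure lborel \<Omega> < \<infinity>" using \<Omega>(2) by (rule emeasure_bounded_finite)
  then obtain M where M: "0 \<le> M" "emeasure lborel \<Omega> = ennreal M"
    by (cases "emeasure lborel \<Omega>") auto
  define K1 where "K1 = A powr p * ?V * (?N / (p - ?N) + 1 + ?N * ln R + ?N)"
  have K1: "0 \<le> K1" using pN R(2) by (auto simp: K1_def intro!: mult_nonneg_nonneg add_nonneg_nonneg)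
  define K2 where "K2 = 2 * K1 * M + A powr p * M"
  have K2: "0 \<le> K2" using K1 M by (simp add: K2_def)
  have c: "0 < c_const CARD('n) s p" using s by (intro c_const_pos) (auto simp: Suc_leI)
  show thesis
  proof (rule that[of "(c_const CARD('n) s p + 1) * K2"])
    show "0 \<le> (c_const CARD('n) s p + 1) * K2" using c K2 by simp
    fix u :: "real^'n \<Rightarrow> real" and \<Lambda> :: real
    assume \<Lambda>: "1 \<le> \<Lambda>" and osc: "oscillating s A \<Lambda> u"
    have cont: "continuous_on UNIV u" and bd: "\<And>x. \<bar>u x\<bar> \<le> A"
      and hoel: "\<And>x y. \<bar>u x - u y\<bar> \<le> A * norm (x - y) powr s"
      and lip: "\<And>x y. \<bar>u x - u y\<bar> \<le> A * \<Lambda> powr (1 - s) * norm (x - y)"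
      using osc by (auto simp: oscillating_def)
    have L: "0 \<le> ln \<Lambda>" using \<Lambda> by simp
    define H where "H x r = (if r \<le> 1 / \<Lambda> then ennreal (A powr p * \<Lambda> powr (p - ?N) * r powr (p - 2 * ?N))
      else ennreal (A powr p * r powr (- ?N)))" for x :: "real^'n" and r
    have Hm: "(\<lambda>(x, r). H x r) \<in> borel_measurable borel"
      unfolding H_def case_prod_beta' borel_prod[symmetric] by measurable
    have le: "ennreal (\<bar>u x - u y\<bar> powr p / norm (x - y) powr (?N + s * p)) \<le> H x (norm (x - y))"
      if "x \<noteq> y" for x y
    proof -
      have r: "0 < norm (x - y)" using that by simp
      show ?thesis
      proof (cases "norm (x - y) \<le> 1 / \<Lambda>")
        case True
        have "\<bar>u x - u y\<bar> powr p \<le> (A * \<Lambda> powr (1 - s) * norm (x - y)) powr p"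
          using lip s by (intro powr_mono2) auto
        also have "\<dots> = A powr p * \<Lambda> powr ((1 - s) * p) * norm (x - y) powr p"
          by (simp add: powr_mult powr_powr)
        also have "(1 - s) * p = p - ?N" using s by (simp add: algebra_simps)
        finally have "\<bar>u x - u y\<bar> powr p / norm (x - y) powr (?N + s * p)
            \<le> A powr p * \<Lambda> powr (p - ?N) * norm (x - y) powr p / norm (x - y) powr (2 * ?N)"
          using s by (simp add: divide_right_mono)
        also have "\<dots> = A powr p * \<Lambda> powr (p - ?N) * norm (x - y) powr (p - 2 * ?N)"
          unfolding powr_diff by simp
        finally show ?thesis using True by (simp add: H_def ennreal_leI)
      next
        case False
        have "\<bar>u x - u y\<bar> powr p \<le> (A * norm (x - y) powr s) powr p"
          using hoel s by (intro powr_mono2) auto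
        also have "\<dots> = A powr p * norm (x - y) powr ?N"
          using s by (simp add: powr_mult powr_powr)
        finally have "\<bar>u x - u y\<bar> powr p / norm (x - y) powr (?N + s * p)
            \<le> A powr p * norm (x - y) powr ?N / norm (x - y) powr (2 * ?N)"
          using s by (simp add: divide_right_mono)
        also have "\<dots> = A powr p * norm (x - y) powr (?N - 2 * ?N)"
          unfolding powr_diff by simp
        finally show ?thesis using False by (simp add: H_def ennreal_leI)
      qed
    qed
    have "gagliardo s p \<Omega> u \<le> 2 * (\<integral>\<^sup>+x. (\<integral>\<^sup>+h. H x (norm (h::real^'n)) * indicator {..R} (norm h) \<partial>lborel) * indicator \<Omega> x \<partial>lborel)"
      using le by (intro gagliardo_le[OF \<Omega> R(1) Hm]) (auto intro: add_increasing2)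
    also have "\<dots> \<le> 2 * (\<integral>\<^sup>+x. ennreal (K1 * (1 + ln \<Lambda>)) * indicator \<Omega> x \<partial>lborel)"
      unfolding H_def K1_def
      by (intro mult_left_mono nn_integral_mono mult_right_mono nn_integral_oscillation_kernel_le pN \<Lambda> R(2)) auto
    also have "\<dots> = ennreal (2 * K1 * M * (1 + ln \<Lambda>))"
      using M K1 L \<Omega>(1) by (subst nn_integral_cmult_indicator) (auto simp: ennreal_mult[symmetric] mult_ac simp flip: ennreal_numeral)
    also have "\<dots> \<le> ennreal (K2 * (1 + ln \<Lambda>))"
      using M L by (intro ennreal_leI mult_right_mono) (auto simp: K2_def)
    finally have 1: "gagliardo s p \<Omega> u \<le> ennreal (K2 * (1 + ln \<Lambda>))" .
    have "(\<integral>\<^sup>+ x. ennreal (\<bar>u x\<bar> powr p) \<partial>lebesgue_on \<Omega>) \<le> (\<integral>\<^sup>+ x. ennreal (A powr p) * indicator \<Omega> x \<partial>lborel)"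
      unfolding nn_integral_lebesgue_on_eq[OF \<Omega>L]
      using bd s by (intro nn_integral_mono mult_right_mono ennreal_leI powr_mono2) auto
    also have "\<dots> = ennreal (A powr p * M)"
      using M \<Omega>(1) by (subst nn_integral_cmult_indicator) (auto simp: ennreal_mult[symmetric])
    also have "\<dots> \<le> ennreal (K2 * (1 + ln \<Lambda>))"
    proof (rule ennreal_leI)
      have "A powr p * M \<le> K2 * 1" using K1 M by (simp add: K2_def)
      also have "\<dots> \<le> K2 * (1 + ln \<Lambda>)" using K2 L by (intro mult_left_mono) auto
      finally show "A powr p * M \<le> K2 * (1 + ln \<Lambda>)" .
    qed
    finally have 2: "(\<integral>\<^sup>+ x. ennreal (\<bar>u x\<bar> powr p) \<partial>lebesgue_on \<Omega>) \<le> ennreal (K2 * (1 + ln \<Lambda>))" .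
    have um: "u \<in> borel_measurable (lebesgue_on \<Omega>)"
      using cont by (intro measurable_lebesgue_on_of_borel borel_measurable_continuous_onI)
    have "0 \<le> K2 * (1 + ln \<Lambda>)" using K2 L by simp
    from sobolev_norm_fractional_le[OF s(1-3) this um 1 2]
    show "u \<in> sobolev_space s (ereal p) \<Omega> \<and> sobolev_norm s (ereal p) \<Omega> u
        \<le> ennreal (((c_const CARD('n) s p + 1) * K2 * (1 + ln \<Lambda>)) powr (1 / p))"
      by (simp only: mult.assoc)
  qed
qed

lemma oscillation_embedding_bound:
  fixes \<Omega> :: "(real^'n::finite) set" and A :: real
  assumes \<Omega>: "open \<Omega>" "bounded \<Omega>" and s: "0 < s" "s < 1" "1 \<le> p" "s * p = real CARD('n)" and A: "0 \<le> A"
    and emb: "continuously_embedded \<Omega> s (ereal p) s' p'"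
  obtains C K where "0 \<le> C" "0 \<le> K" "\<And>u \<Lambda>. 1 \<le> \<Lambda> \<Longrightarrow> oscillating s A \<Lambda> u \<Longrightarrow>
    \<exists>v\<in>sobolev_space s' p' \<Omega>. (AE x in lebesgue_on \<Omega>. v x = u x) \<and>
      sobolev_norm s' p' \<Omega> v \<le> ennreal (C * (K * (1 + ln \<Lambda>)) powr (1 / p))"
proof -
  obtain K where K: "0 \<le> K" "\<And>u \<Lambda>. 1 \<le> \<Lambda> \<Longrightarrow> oscillating s A \<Lambda> u \<Longrightarrow>
    u \<in> sobolev_space s (ereal p) \<Omega> \<and> sobolev_norm s (ereal p) \<Omega> u \<le> ennreal ((K * (1 + ln \<Lambda>)) powr (1 / p))"
    by (rule oscillation_source_bound[OF \<Omega> s A]) (rule that)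
  obtain C where C: "0 \<le> C" "\<And>u B. u \<in> sobolev_space s (ereal p) \<Omega> \<Longrightarrow> sobolev_norm s (ereal p) \<Omega> u \<le> ennreal B \<Longrightarrow> 0 \<le> B \<Longrightarrow>
    \<exists>v\<in>sobolev_space s' p' \<Omega>. (AE x in lebesgue_on \<Omega>. v x = u x) \<and> sobolev_norm s' p' \<Omega> v \<le> ennreal (C * B)"
    by (rule continuously_embeddedE[OF emb]) (rule that)
  show thesis
  proof (rule that[OF C(1) K(1)])
    fix u :: "real^'n \<Rightarrow> real" and \<Lambda> :: real
    assume a: "1 \<le> \<Lambda>" "oscillating s A \<Lambda> u"
    show "\<exists>v\<in>sobolev_space s' p' \<Omega>. (AE x in lebesgue_on \<Omega>. v x = u x) \<and>
      sobolev_norm s' p' \<Omega> v \<le> ennreal (C * (K * (1 + ln \<Lambda>)) powr (1 / p))"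
      using K(2)[OF a] by (intro C(2)) auto
  qed
qed

section \<open>Single waves and targets of order one\<close>

text \<open>The Hoelder bound interpolates: below the wavelength the Lipschitz bound is multiplied
  out as (\<Lambda> d) powr (1 - s) * d powr s with \<Lambda> d \<le> 1, and above it the amplitude
  bound is enlarged by the factor (\<Lambda> d) powr s, which is at least 1.\<close>

lemma single_frequency_bounds:
  fixes c :: "real \<Rightarrow> real"
  assumes c: "\<And>t. \<bar>c t\<bar> \<le> 1" "\<And>t t'. \<bar>c t - c t'\<bar> \<le> \<bar>t - t'\<bar>" and s: "0 < s" "s < 1" and \<Lambda>: "1 \<le> \<Lambda>"
  shows "\<bar>\<Lambda> powr (- s) * c (\<Lambda> * t)\<bar> \<le> 1"
    and "\<bar>\<Lambda> powr (- s) * c (\<Lambda> * t) - \<Lambda> powr (- s) * c (\<Lambda> * t')\<bar> \<le> \<Lambda> powr (1 - s) * \<bar>t - t'\<bar>"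
    and "\<bar>\<Lambda> powr (- s) * c (\<Lambda> * t) - \<Lambda> powr (- s) * c (\<Lambda> * t')\<bar> \<le> 2 * \<bar>t - t'\<bar> powr s"
proof -
  have pos: "0 \<le> \<Lambda> powr (- s)" by simp
  have "\<Lambda> powr (- s) \<le> \<Lambda> powr 0" using s \<Lambda> by (intro powr_mono) auto
  then have le1: "\<Lambda> powr (- s) \<le> 1" using \<Lambda> by simp
  show "\<bar>\<Lambda> powr (- s) * c (\<Lambda> * t)\<bar> \<le> 1"
    using mult_mono[OF le1 c(1)[of "\<Lambda> * t"]] by (simp add: abs_mult)
  have eq: "\<bar>\<Lambda> powr (- s) * c (\<Lambda> * t) - \<Lambda> powr (- s) * c (\<Lambda> * t')\<bar> = \<Lambda> powr (- s) * \<bar>c (\<Lambda> * t) - c (\<Lambda> * t')\<bar>"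
    by (simp add: abs_mult right_diff_distrib[symmetric])
  have "\<bar>c (\<Lambda> * t) - c (\<Lambda> * t')\<bar> \<le> \<bar>\<Lambda> * t - \<Lambda> * t'\<bar>" by (rule c(2))
  also have "\<dots> = \<Lambda> * \<bar>t - t'\<bar>" using \<Lambda> by (simp add: abs_mult right_diff_distrib[symmetric])
  finally have 1: "\<bar>c (\<Lambda> * t) - c (\<Lambda> * t')\<bar> \<le> \<Lambda> * \<bar>t - t'\<bar>" .
  have \<Lambda>1: "\<Lambda> powr (- s) * \<Lambda> = \<Lambda> powr (1 - s)"
    using \<Lambda> powr_add[of \<Lambda> "- s" 1] by simp
  show 2: "\<bar>\<Lambda> powr (- s) * c (\<Lambda> * t) - \<Lambda> powr (- s) * c (\<Lambda> * t')\<bar> \<le> \<Lambda> powr (1 - s) * \<bar>t - t'\<bar>"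
    unfolding eq \<Lambda>1[symmetric] mult.assoc using 1 by (rule mult_left_mono) simp
  show "\<bar>\<Lambda> powr (- s) * c (\<Lambda> * t) - \<Lambda> powr (- s) * c (\<Lambda> * t')\<bar> \<le> 2 * \<bar>t - t'\<bar> powr s"
  proof (cases "\<Lambda> * \<bar>t - t'\<bar> \<le> 1")
    case True
    have "\<Lambda> powr (1 - s) * \<bar>t - t'\<bar> = (\<Lambda> * \<bar>t - t'\<bar>) powr (1 - s) * \<bar>t - t'\<bar> powr s"
      unfolding powr_mult mult.assoc powr_add[symmetric] by simp
    also have "\<dots> \<le> 1 * \<bar>t - t'\<bar> powr s"
      using True s \<Lambda> by (intro mult_right_mono powr_le1) auto
    finally show ?thesis using 2 by simp
  next
    case False
    have "\<bar>c (\<Lambda> * t) - c (\<Lambda> * t')\<bar> \<le> 2" using c(1)[of "\<Lambda> * t"] c(1)[of "\<Lambda> * t'"] by linarith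
    then have "\<Lambda> powr (- s) * \<bar>c (\<Lambda> * t) - c (\<Lambda> * t')\<bar> \<le> \<Lambda> powr (- s) * 2" by (rule mult_left_mono) simp
    also have "\<dots> \<le> (\<Lambda> * \<bar>t - t'\<bar>) powr s * (\<Lambda> powr (- s) * 2)"
      using mult_right_mono[OF ge_one_powr_ge_zero[of "\<Lambda> * \<bar>t - t'\<bar>" s], of "\<Lambda> powr (- s) * 2"] False s by simp
    also have "\<dots> = 2 * \<bar>t - t'\<bar> powr s * (\<Lambda> powr s * \<Lambda> powr (- s))" unfolding powr_mult by simp
    also have "\<Lambda> powr s * \<Lambda> powr (- s) = 1" using \<Lambda> by (simp flip: powr_add)
    finally show ?thesis unfolding eq by simp
  qed
qed

lemma abs_cos_diff_le: "\<bar>cos (t::real) - cos t'\<bar> \<le> \<bar>t - t'\<bar>"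
  and abs_sin_diff_le: "\<bar>sin (t::real) - sin t'\<bar> \<le> \<bar>t - t'\<bar>"
proof -
  have "\<bar>cos t - cos t'\<bar> = 2 * \<bar>sin ((t + t') / 2)\<bar> * \<bar>sin ((t' - t) / 2)\<bar>"
    unfolding cos_diff_cos by (simp add: abs_mult)
  also have "\<dots> \<le> 2 * 1 * \<bar>(t' - t) / 2\<bar>" by (intro mult_mono abs_sin_x_le_abs_x) auto
  finally show "\<bar>cos t - cos t'\<bar> \<le> \<bar>t - t'\<bar>" by simp
  have "\<bar>sin t - sin t'\<bar> = 2 * \<bar>sin ((t - t') / 2)\<bar> * \<bar>cos ((t + t') / 2)\<bar>"
    unfolding sin_diff_sin by (simp add: abs_mult)
  also have "\<dots> \<le> 2 * \<bar>(t - t') / 2\<bar> * 1" by (intro mult_mono abs_sin_x_le_abs_x) auto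
  finally show "\<bar>sin t - sin t'\<bar> \<le> \<bar>t - t'\<bar>" by simp
qed

lemma single_frequency_oscillating:
  fixes c :: "real \<Rightarrow> real" and k :: "'n::finite"
  assumes c: "\<And>t. \<bar>c t\<bar> \<le> 1" "\<And>t t'. \<bar>c t - c t'\<bar> \<le> \<bar>t - t'\<bar>" "continuous_on UNIV c"
    and s: "0 < s" "s < 1" and \<Lambda>: "1 \<le> \<Lambda>"
  shows "oscillating s 2 \<Lambda> (\<lambda>x::real^'n. \<Lambda> powr (- s) * c (\<Lambda> * x $ k))"
  unfolding oscillating_def
proof (intro conjI allI)
  note b = single_frequency_bounds[OF c(1,2) s \<Lambda>]
  have comp: "\<bar>x $ k - y $ k\<bar> \<le> norm (x - y)" for x y :: "real^'n"
    using component_le_norm_cart[of "x - y" k] by simp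
  show "continuous_on UNIV (\<lambda>x::real^'n. \<Lambda> powr (- s) * c (\<Lambda> * x $ k))"
    by (intro continuous_on_mult continuous_on_const continuous_on_compose2[OF c(3)] continuous_on_component continuous_on_id) auto
  fix x y :: "real^'n"
  show "\<bar>\<Lambda> powr (- s) * c (\<Lambda> * x $ k)\<bar> \<le> 2" using b(1)[of "x $ k"] by simp
  show "\<bar>\<Lambda> powr (- s) * c (\<Lambda> * x $ k) - \<Lambda> powr (- s) * c (\<Lambda> * y $ k)\<bar> \<le> 2 * norm (x - y) powr s"
    using comp s by (intro order_trans[OF b(3)] mult_left_mono powr_mono2) auto
  have "\<Lambda> powr (1 - s) * \<bar>x $ k - y $ k\<bar> \<le> 2 * \<Lambda> powr (1 - s) * norm (x - y)"
    using comp by (intro mult_mono) auto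
  then show "\<bar>\<Lambda> powr (- s) * c (\<Lambda> * x $ k) - \<Lambda> powr (- s) * c (\<Lambda> * y $ k)\<bar> \<le> 2 * \<Lambda> powr (1 - s) * norm (x - y)"
    using b(2) by (rule order_trans[rotated])
qed

text \<open>The sine wave is tested with a bump times cosine and the cosine wave with the same bump
  times sine. The two pairings differ by \<Lambda> powr (1 - s) times the integral of the bump, so
  one of them is at least half of it in absolute value and no oscillatory integral is estimated. The
  power \<Lambda> powr ((1 - s) q) then beats the logarithm.\<close>

lemma not_embedded_oscillation_gradient:
  fixes \<Omega> :: "(real^'n::finite) set"
  assumes \<Omega>: "open \<Omega>" "bounded \<Omega>" "\<Omega> \<noteq> {}" and s: "0 < s" "s < 1" "1 \<le> p" "s * p = real CARD('n)"
    and q: "1 \<le> q"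
  shows "\<not> continuously_embedded \<Omega> s (ereal p) 1 (ereal q)"
proof
  assume emb: "continuously_embedded \<Omega> s (ereal p) 1 (ereal q)"
  let ?V = "unit_ball_vol (real CARD('n))"
  have \<Omega>L: "\<Omega> \<in> sets lebesgue" using \<Omega>(1) by simp
  obtain z where "z \<in> \<Omega>" using \<Omega>(3) by blast
  then obtain r where r: "0 < r" and sub: "cball z r \<subseteq> \<Omega>" using \<Omega>(1) open_contains_cball by blast
  obtain C K where CK: "0 \<le> C" "0 \<le> K" "\<And>u \<Lambda>. 1 \<le> \<Lambda> \<Longrightarrow> oscillating s 2 \<Lambda> u \<Longrightarrow>
    \<exists>v\<in>sobolev_space 1 (ereal q) \<Omega>. (AE x in lebesgue_on \<Omega>. v x = u x) \<and>
      sobolev_norm 1 (ereal q) \<Omega> v \<le> ennreal (C * (K * (1 + ln \<Lambda>)) powr (1 / p))"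
    by (rule oscillation_embedding_bound[OF \<Omega>(1,2) s _ emb, of 2]) (simp, rule that)
  define k :: 'n where "k = undefined"
  \<comment> \<open>The final 1 / 2 accounts for the two pairings that share the lower
    bound.\<close>
  define c1 :: real where "c1 = exp (- 4 / 3) / 2 ^ CARD('n) / 2"
  have c1: "0 < c1" by (simp add: c1_def)
  have V: "0 < ?V" by simp
  define W where "W = ?V * r ^ CARD('n)"
  have W: "0 < W" using V r by (simp add: W_def del: V)
  show False
  proof (rule powr_not_le_log_power[of "(1 - s) * q" "(c1 / 2) powr q * W" C K p q 1])
    show "0 < (c1 / 2) powr q * W" using c1 W by simp
    fix \<Lambda> :: real assume \<Lambda>: "1 \<le> \<Lambda>"
    let ?B = "C * (K * (1 + ln \<Lambda>)) powr (1 / p)"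
    let ?b = "\<Lambda> powr (- s)" and ?\<eta> = "bump z r"
    have B: "0 \<le> ?B" using CK by simp
    have b\<Lambda>: "?b * \<Lambda> = \<Lambda> powr (1 - s)" using \<Lambda> powr_add[of \<Lambda> "- s" 1] by simp
    \<comment> \<open>Stated for a general wave c with derivative c' and modulation e, to serve both
      pairings.\<close>
    have up: "\<bar>LINT x|lebesgue_on \<Omega>. (?b * \<Lambda> * c' (\<Lambda> * x $ k)) * (?\<eta> x * e (\<Lambda> * x $ k))\<bar> \<le> t * W + t powr (1 - q) * (?B + 1) powr q"
      if "0 < t" and c: "\<And>t. \<bar>c t\<bar> \<le> 1" "\<And>t t'. \<bar>c t - c t'\<bar> \<le> \<bar>t - t'\<bar>" "\<And>t. (c has_real_derivative c' t) (at t)"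
        "continuous_on UNIV c'" and e: "smooth_expr (\<lambda>x::real^'n. e (\<Lambda> * x $ k))" "\<And>t. \<bar>e t\<bar> \<le> 1"
      for t and c c' e :: "real \<Rightarrow> real"
    proof -
      let ?u = "\<lambda>x::real^'n. ?b * c (\<Lambda> * x $ k)" and ?G = "\<lambda>x::real^'n. (?b * \<Lambda> * c' (\<Lambda> * x $ k)) *\<^sub>R axis k (1::real)"
      let ?\<phi> = "\<lambda>x. ?\<eta> x * e (\<Lambda> * x $ k)"
      have cc: "continuous_on UNIV c"
        using c(3) by (auto intro!: continuous_at_imp_continuous_on DERIV_isCont)
      obtain v where v: "v \<in> sobolev_space 1 (ereal q) \<Omega>" "AE x in lebesgue_on \<Omega>. v x = ?u x"
        "sobolev_norm 1 (ereal q) \<Omega> v \<le> ennreal ?B"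
        using CK(3)[OF \<Lambda> single_frequency_oscillating[OF c(1,2) cc s(1,2) \<Lambda>]] by blast
      have vm: "v \<in> borel_measurable (lebesgue_on \<Omega>)" using v(1) by (simp add: sobolev_space_def)
      obtain g where g: "weak_gradient \<Omega> v g"
        "(\<integral>\<^sup>+ x. ennreal (norm (g x) powr q) \<partial>lebesgue_on \<Omega>) \<le> ennreal ((?B + 1) powr q)"
        by (rule weak_gradient_of_sobolev_norm_le[OF q B v(3)]) (rule that)
      have lin: "((\<lambda>x::real^'n. \<Lambda> * x $ k) has_derivative (\<lambda>h. \<Lambda> * h $ k)) (at x)" for x
        by (intro has_derivative_mult_right bounded_linear_imp_has_derivative bounded_linear_vec_nth)
      have du: "(?u has_derivative (\<lambda>h. ?G x \<bullet> h)) (at x)" for x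
      proof -
        have "(?u has_derivative (\<lambda>h. ?b * (\<Lambda> * h $ k * c' (\<Lambda> * x $ k)))) (at x)"
          by (intro has_derivative_mult_right DERIV_compose_FDERIV[OF c(3) lin])
        moreover have "(\<lambda>h. ?b * (\<Lambda> * h $ k * c' (\<Lambda> * x $ k))) = (\<lambda>h. ?G x \<bullet> h)"
          by (simp add: fun_eq_iff inner_axis' mult_ac)
        ultimately show ?thesis by (simp only:)
      qed
      have cG: "continuous_on UNIV ?G"
        by (intro continuous_on_scaleR continuous_on_mult continuous_on_const continuous_on_compose2[OF c(4)]
            continuous_on_component continuous_on_id) auto
      have \<phi>0: "?\<phi> x = 0" if "x \<notin> cball z r" for x
        using that bump_eq_0[OF r, of x z] by (simp add: dist_norm norm_minus_commute)
      have \<phi>: "test_function \<Omega> ?\<phi>"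
        by (intro test_functionI[OF smooth_expr.mult[OF smooth_expr_bump e(1)] sub]) (simp add: bump_eq_0[OF r])
      have \<phi>1: "\<bar>?\<phi> x\<bar> \<le> 1" for x
        using mult_mono[OF bump_bounds(2)[of z r x] e(2)[of "\<Lambda> * x $ k"]] bump_bounds(1)[of z r x] by (simp add: abs_mult)
      have "\<bar>LINT x|lebesgue_on \<Omega>. ?G x $ k * ?\<phi> x\<bar> \<le> t * W + t powr (1 - q) * (?B + 1) powr q"
        unfolding W_def
        by (rule weak_gradient_test_bound[OF \<Omega>L du cG vm v(2) g(1,2) _ \<phi> \<phi>1 \<phi>0 sub r q \<open>0 < t\<close>]) simp
      then show ?thesis by simp
    qed
    have sm: "smooth_expr (\<lambda>x::real^'n. \<Lambda> * x $ k)" by (intro smooth_expr.intros)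
    have cont_\<eta>: "continuous_on UNIV ?\<eta>"
      using smooth_expr_imp_C_k[OF smooth_expr_bump, of 0 z r] by simp
    have \<eta>0: "?\<eta> x = 0" if "x \<notin> cball z r" for x
      using that bump_eq_0[OF r, of x z] by (simp add: dist_norm norm_minus_commute)
    let ?F1 = "\<lambda>x. (?b * \<Lambda> * cos (\<Lambda> * x $ k)) * (?\<eta> x * cos (\<Lambda> * x $ k))"
    let ?F2 = "\<lambda>x. (?b * \<Lambda> * (- sin (\<Lambda> * x $ k))) * (?\<eta> x * sin (\<Lambda> * x $ k))"
    have up1: "\<bar>LINT x|lebesgue_on \<Omega>. ?F1 x\<bar> \<le> t * W + t powr (1 - q) * (?B + 1) powr q" if "0 < t" for t
      by (rule up[OF that, of sin cos cos]) (auto intro!: abs_sin_diff_le derivative_eq_intros continuous_intros smooth_expr.cos sm)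
    have up2: "\<bar>LINT x|lebesgue_on \<Omega>. ?F2 x\<bar> \<le> t * W + t powr (1 - q) * (?B + 1) powr q" if "0 < t" for t
      by (rule up[OF that, of cos "\<lambda>t. - sin t" sin]) (auto intro!: abs_cos_diff_le derivative_eq_intros continuous_intros smooth_expr.sin sm)
    have cF: "continuous_on UNIV ?F1" "continuous_on UNIV ?F2"
      using cont_\<eta> by (auto intro!: continuous_intros)
    have i1: "integrable (lebesgue_on \<Omega>) ?F1"
      by (rule continuous_supported_integral(1)[OF \<Omega>L sub cF(1)]) (simp add: \<eta>0)
    have i2: "integrable (lebesgue_on \<Omega>) ?F2"
      by (rule continuous_supported_integral(1)[OF \<Omega>L sub cF(2)]) (simp add: \<eta>0)
    have "2 * (\<Lambda> powr (1 - s) * c1 * W) = ?b * \<Lambda> * exp (- 4 / 3) * (?V * (r / 2) ^ CARD('n))"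
      unfolding b\<Lambda> by (simp add: c1_def W_def power_divide)
    also have "\<dots> \<le> (LINT x|lebesgue_on \<Omega>. ?b * \<Lambda> * ?\<eta> x)"
    proof (rule continuous_supported_integral(2)[OF \<Omega>L sub])
      show "continuous_on UNIV (\<lambda>x. ?b * \<Lambda> * ?\<eta> x)" using cont_\<eta> by (intro continuous_intros)
      show "?b * \<Lambda> * ?\<eta> x = 0" if "x \<notin> cball z r" for x using \<eta>0[OF that] by simp
      show "0 \<le> ?b * \<Lambda> * ?\<eta> x" for x using \<Lambda> bump_bounds(1)[of z r x] by simp
      show "?b * \<Lambda> * exp (- 4 / 3) \<le> ?b * \<Lambda> * ?\<eta> x" if "x \<in> cball z (r / 2)" for x
        using that \<Lambda> by (intro mult_left_mono bump_ge[OF r]) (auto simp: dist_norm norm_minus_commute)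
    qed (use r in simp)
    also have "(\<lambda>x. ?b * \<Lambda> * ?\<eta> x) = (\<lambda>x. ?F1 x - ?F2 x)"
    proof
      fix x
      have "(B * c) * (e * c) - (B * (- d)) * (e * d) = B * e * (c\<^sup>2 + d\<^sup>2)" for B c d e :: real
        by (simp add: power2_eq_square algebra_simps)
      then show "?b * \<Lambda> * ?\<eta> x = ?F1 x - ?F2 x"
        by (simp only: sin_cos_squared_add2 mult_1_right)
    qed
    also have "(LINT x|lebesgue_on \<Omega>. ?F1 x - ?F2 x) = (LINT x|lebesgue_on \<Omega>. ?F1 x) - (LINT x|lebesgue_on \<Omega>. ?F2 x)"
      by (rule Bochner_Integration.integral_diff[OF i1 i2])
    finally have low: "2 * (\<Lambda> powr (1 - s) * c1 * W) \<le> (LINT x|lebesgue_on \<Omega>. ?F1 x) - (LINT x|lebesgue_on \<Omega>. ?F2 x)" .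
    have "(\<Lambda> powr (1 - s) * c1 / 2) powr q * W \<le> (?B + 1) powr q"
    proof (rule test_functional_lower_bound)
      fix t :: real assume "0 < t"
      from up1[OF this] up2[OF this] low show "\<Lambda> powr (1 - s) * c1 * W \<le> t * W + t powr (1 - q) * (?B + 1) powr q"
        by linarith
    qed (use c1 W \<Lambda> in auto)
    also have "\<Lambda> powr (1 - s) * c1 / 2 = c1 / 2 * \<Lambda> powr (1 - s)" by simp
    also have "(c1 / 2 * \<Lambda> powr (1 - s)) powr q = (c1 / 2) powr q * \<Lambda> powr ((1 - s) * q)"
      unfolding powr_mult powr_powr ..
    finally show "(c1 / 2) powr q * W * \<Lambda> powr ((1 - s) * q) \<le> (?B + 1) powr q" by (simp only: mult_ac)
  qed (use s q CK in auto)
qed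

section \<open>Lacunary sums: boundedness and Hoelder continuity\<close>

definition lacunary :: "(real \<Rightarrow> real) \<Rightarrow> real \<Rightarrow> real \<Rightarrow> nat \<Rightarrow> real \<Rightarrow> real" where
  "lacunary c b l J t = (\<Sum>i<J. b ^ i * c (l ^ i * t))"

text \<open>Self-similarity: without its lowest frequency the sum is a rescaled copy of a shorter
  one. All upper bounds are inductions along this identity.\<close>

lemma lacunary_Suc: "lacunary c b l (Suc J) t = c t + b * lacunary c b l J (l * t)"
  unfolding lacunary_def sum.lessThan_Suc_shift sum_distrib_left by (simp add: mult_ac)

lemma lacunary_bounds:
  fixes c :: "real \<Rightarrow> real"
  assumes c: "\<And>t. \<bar>c t\<bar> \<le> 1" "\<And>t t'. \<bar>c t - c t'\<bar> \<le> \<bar>t - t'\<bar>"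
    and b: "0 < b" "b \<le> 1 / 2" and l: "0 < l" "2 \<le> b * l"
  shows "\<bar>lacunary c b l J t\<bar> \<le> 2"
    and "\<bar>lacunary c b l J t - lacunary c b l J t'\<bar> \<le> (b * l) ^ J * \<bar>t - t'\<bar>"
proof -
  show "\<bar>lacunary c b l J t\<bar> \<le> 2"
  proof (induction J arbitrary: t)
    case (Suc J)
    have "\<bar>lacunary c b l (Suc J) t\<bar> \<le> \<bar>c t\<bar> + b * \<bar>lacunary c b l J (l * t)\<bar>"
      unfolding lacunary_Suc using b abs_triangle_ineq[of "c t" "b * lacunary c b l J (l * t)"] by (simp add: abs_mult)
    also have "\<dots> \<le> 1 + 1 / 2 * 2" using b by (intro add_mono c mult_mono Suc) auto
    finally show ?case by simp
  qed (simp add: lacunary_def)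
  \<comment> \<open>The strengthening by - 1 carries the induction: the new frequency adds 1, while
    - 1 becomes - b l, and b l is at least 2.\<close>
  have "\<bar>lacunary c b l J t - lacunary c b l J t'\<bar> \<le> ((b * l) ^ J - 1) * \<bar>t - t'\<bar>"
  proof (induction J arbitrary: t t')
    case (Suc J)
    have "\<bar>lacunary c b l (Suc J) t - lacunary c b l (Suc J) t'\<bar>
      = \<bar>(c t - c t') + b * (lacunary c b l J (l * t) - lacunary c b l J (l * t'))\<bar>"
      unfolding lacunary_Suc by (simp add: algebra_simps)
    also have "\<dots> \<le> \<bar>c t - c t'\<bar> + b * \<bar>lacunary c b l J (l * t) - lacunary c b l J (l * t')\<bar>"
      using b abs_triangle_ineq[of "c t - c t'" "b * (lacunary c b l J (l * t) - lacunary c b l J (l * t'))"] by (simp add: abs_mult)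
    also have "\<dots> \<le> \<bar>t - t'\<bar> + b * (((b * l) ^ J - 1) * \<bar>l * t - l * t'\<bar>)"
      using b by (intro add_mono c mult_left_mono Suc) auto
    also have "\<bar>l * t - l * t'\<bar> = l * \<bar>t - t'\<bar>" using l by (simp add: abs_mult right_diff_distrib[symmetric])
    also have "\<bar>t - t'\<bar> + b * (((b * l) ^ J - 1) * (l * \<bar>t - t'\<bar>)) = ((b * l) ^ Suc J - (b * l - 1)) * \<bar>t - t'\<bar>"
      by (simp add: algebra_simps)
    also have "\<dots> \<le> ((b * l) ^ Suc J - 1) * \<bar>t - t'\<bar>"
      using l by (intro mult_right_mono) auto
    finally show ?case .
  qed (simp add: lacunary_def)
  also have "\<dots> \<le> (b * l) ^ J * \<bar>t - t'\<bar>" by (intro mult_right_mono) auto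
  finally show "\<bar>lacunary c b l J t - lacunary c b l J t'\<bar> \<le> (b * l) ^ J * \<bar>t - t'\<bar>" .
qed

text \<open>Since b * l powr s = 1, the Hoelder bound is invariant under passing from t to l t with
  weight b, so it survives the recursion while l d \<le> 1, where d is the distance. Once l d > 1,
  the rescaled rest is at most 4 in oscillation and b \<le> d powr s.\<close>

lemma lacunary_hoelder:
  fixes c :: "real \<Rightarrow> real"
  assumes c: "\<And>t. \<bar>c t\<bar> \<le> 1" "\<And>t t'. \<bar>c t - c t'\<bar> \<le> \<bar>t - t'\<bar>"
    and b: "b = l powr (- s)" "b \<le> 1 / 2" and l: "0 < l" "2 \<le> b * l" and s: "0 < s" "s \<le> 1"
  shows "\<bar>lacunary c b l J t - lacunary c b l J t'\<bar> \<le> 6 * \<bar>t - t'\<bar> powr s"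
proof -
  have b0: "0 < b" using b l by simp
  have bl: "b * l powr s = 1" using b l by (simp flip: powr_add)
  note bd = lacunary_bounds(1)[OF c b0 b(2) l]
  \<comment> \<open>The term \<open>- \<bar>t - t'\<bar>\<close> absorbs the contribution of the lowest frequency in the induction step.\<close>
  have small: "\<bar>lacunary c b l J t - lacunary c b l J t'\<bar> \<le> 6 * \<bar>t - t'\<bar> powr s - \<bar>t - t'\<bar>" if "\<bar>t - t'\<bar> \<le> 1" for t t'
    using that
  proof (induction J arbitrary: t t')
    case 0
    have "\<bar>t - t'\<bar> powr 1 \<le> \<bar>t - t'\<bar> powr s" using 0 s by (intro powr_mono') auto
    then have "\<bar>t - t'\<bar> \<le> \<bar>t - t'\<bar> powr s" by simp
    moreover have "0 \<le> \<bar>t - t'\<bar> powr s" by simp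
    ultimately have "\<bar>t - t'\<bar> \<le> 6 * \<bar>t - t'\<bar> powr s" by linarith
    then show ?case by (simp add: lacunary_def)
  next
    case (Suc J)
    let ?d = "\<bar>t - t'\<bar>" and ?L = "\<bar>lacunary c b l J (l * t) - lacunary c b l J (l * t')\<bar>"
    have "?d powr 1 \<le> ?d powr s" using Suc.prems s by (intro powr_mono') auto
    then have ds: "?d \<le> ?d powr s" by simp
    have "\<bar>lacunary c b l (Suc J) t - lacunary c b l (Suc J) t'\<bar>
      = \<bar>(c t - c t') + b * (lacunary c b l J (l * t) - lacunary c b l J (l * t'))\<bar>"
      unfolding lacunary_Suc by (simp add: algebra_simps)
    also have "\<dots> \<le> \<bar>c t - c t'\<bar> + b * ?L"
      using b0 abs_triangle_ineq[of "c t - c t'" "b * (lacunary c b l J (l * t) - lacunary c b l J (l * t'))"] by (simp add: abs_mult)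
    also have "\<dots> \<le> ?d + b * ?L" by (intro add_right_mono c)
    finally have le: "\<bar>lacunary c b l (Suc J) t - lacunary c b l (Suc J) t'\<bar> \<le> ?d + b * ?L" .
    have ld: "\<bar>l * t - l * t'\<bar> = l * ?d" using l by (simp add: abs_mult right_diff_distrib[symmetric])
    show ?case
    proof (cases "l * ?d \<le> 1")
      case True
      have "?L \<le> 6 * (l * ?d) powr s - l * ?d"
        using Suc.IH[of "l * t" "l * t'"] True unfolding ld by simp
      then have "b * ?L \<le> b * (6 * (l * ?d) powr s - l * ?d)" using b0 by (intro mult_left_mono) auto
      also have "\<dots> = 6 * (b * l powr s) * ?d powr s - (b * l) * ?d"
        unfolding powr_mult by (simp add: algebra_simps)
      also have "\<dots> \<le> 6 * ?d powr s - 2 * ?d"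
        unfolding bl using mult_right_mono[OF l(2), of ?d] by simp
      finally have "b * ?L \<le> 6 * ?d powr s - 2 * ?d" .
      moreover have "x \<le> 6 * e - d" if "x \<le> d + y" "y \<le> 6 * e - 2 * d" for x y d e :: real
        using that by linarith
      ultimately show ?thesis using le by blast
    next
      case False
      have "?L \<le> 4" using bd[of J "l * t"] bd[of J "l * t'"] by linarith
      then have L4: "b * ?L \<le> b * 4" using b0 by (intro mult_left_mono) auto
      have "b * 1 \<le> b * (l * ?d) powr s" using False s b0 by (intro mult_left_mono ge_one_powr_ge_zero) auto
      then have bd': "b \<le> ?d powr s" unfolding powr_mult mult.assoc[symmetric] bl by simp
      \<comment> \<open>The constant 6 is forced here: 4 from the oscillation of the rest, and 2
        from the two terms d, each at most e = d powr s.\<close>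
      have "x \<le> 6 * e - d" if "x \<le> d + y" "y \<le> b * 4" "b \<le> e" "d \<le> e" for x y d e :: real
        using that by linarith
      from this[OF le L4 bd' ds] show ?thesis .
    qed
  qed
  show ?thesis
  proof (cases "\<bar>t - t'\<bar> \<le> 1")
    case True
    from small[OF this] show ?thesis by linarith
  next
    case False
    then have "1 \<le> \<bar>t - t'\<bar> powr s" using s by (intro ge_one_powr_ge_zero) auto
    moreover have "\<bar>lacunary c b l J t - lacunary c b l J t'\<bar> \<le> 4" using bd[of J t] bd[of J t'] by linarith
    ultimately show ?thesis by linarith
  qed
qed

lemma lacunary_oscillating:
  fixes c :: "real \<Rightarrow> real" and k :: "'n::finite"
  assumes c: "\<And>t. \<bar>c t\<bar> \<le> 1" "\<And>t t'. \<bar>c t - c t'\<bar> \<le> \<bar>t - t'\<bar>" "continuous_on UNIV c"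
    and b: "b = l powr (- s)" "b \<le> 1 / 2" and l: "0 < l" "2 \<le> b * l" and s: "0 < s" "s \<le> 1"
  shows "oscillating s 6 (l ^ J) (\<lambda>x::real^'n. lacunary c b l J (x $ k))"
  unfolding oscillating_def
proof (intro conjI allI)
  have b0: "0 < b" using b l by simp
  note bd = lacunary_bounds[OF c(1,2) b0 b(2) l]
  have comp: "\<bar>x $ k - y $ k\<bar> \<le> norm (x - y)" for x y :: "real^'n"
    using component_le_norm_cart[of "x - y" k] by simp
  show "continuous_on UNIV (\<lambda>x::real^'n. lacunary c b l J (x $ k))"
    unfolding lacunary_def
    by (intro continuous_on_sum continuous_on_mult continuous_on_const continuous_on_compose2[OF c(3)] continuous_on_component continuous_on_id) auto
  fix x y :: "real^'n"
  show "\<bar>lacunary c b l J (x $ k)\<bar> \<le> 6" using bd(1)[of J "x $ k"] by simp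
  show "\<bar>lacunary c b l J (x $ k) - lacunary c b l J (y $ k)\<bar> \<le> 6 * norm (x - y) powr s"
    using comp s by (intro order_trans[OF lacunary_hoelder[OF c(1,2) b l s]] mult_left_mono powr_mono2) auto
  \<comment> \<open>The Lipschitz constant (b l) ^ J is the one that the top frequency l ^ J
    prescribes.\<close>
  have "b * l = l powr (1 - s)" using b l powr_add[of l "- s" 1] by simp
  then have "(b * l) ^ J = (l powr (1 - s)) powr real J" using l by (simp add: powr_realpow)
  also have "\<dots> = (l ^ J) powr (1 - s)"
    using l by (simp add: powr_powr mult.commute flip: powr_realpow)
  finally have eq: "(b * l) ^ J = (l ^ J) powr (1 - s)" .
  have "(b * l) ^ J * \<bar>x $ k - y $ k\<bar> \<le> 6 * (b * l) ^ J * norm (x - y)"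
    using comp l b0 by (intro mult_mono) auto
  then show "\<bar>lacunary c b l J (x $ k) - lacunary c b l J (y $ k)\<bar> \<le> 6 * (l ^ J) powr (1 - s) * norm (x - y)"
    using bd(2)[of J "x $ k" "y $ k", unfolded eq] unfolding eq by (rule order_trans[rotated])
qed

section \<open>Lacunary sums: lower bounds for increments and energies\<close>

lemma sum_power_lessThan_le:
  fixes a :: real
  assumes "25 \<le> a"
  shows "(\<Sum>i<j. a ^ i) \<le> (a ^ j - 1) / 24"
proof (induction j)
  case (Suc j)
  have "25 * a ^ j \<le> a * a ^ j" using assms by (intro mult_right_mono) auto
  with Suc show ?case by simp
qed simp

text \<open>The subtracted b ^ m makes the bound inductive: the new term b ^ (m + 1) fits since 25 b
  \<le> 1.\<close>

lemma sum_power_tail_le: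
  fixes b :: real
  assumes "0 < b" "b \<le> 1 / 25" "j \<le> m"
  shows "(\<Sum>i\<in>{Suc j..m}. b ^ i) \<le> (b ^ j - b ^ m) / 24"
  using \<open>j \<le> m\<close>
proof (induction m rule: dec_induct)
  case (step m)
  have "b * b ^ m \<le> 1 / 25 * b ^ m" using assms by (intro mult_right_mono) auto
  with step show ?case by simp
qed simp

text \<open>The increments are the components of a chord of the unit circle with squared length 2 -
  2 cos \<eta>. As \<eta> lies between pi / 2 and pi, this is at least 2 for every phase
  \<phi>.\<close>

lemma cos_sin_increment_ge_1:
  fixes \<phi> \<eta> :: real
  assumes "2 \<le> \<eta>" "\<eta> \<le> 3"
  shows "1 \<le> \<bar>cos (\<phi> + \<eta>) - cos \<phi>\<bar> + \<bar>sin (\<phi> + \<eta>) - sin \<phi>\<bar>"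
proof -
  let ?x = "cos (\<phi> + \<eta>) - cos \<phi>" and ?y = "sin (\<phi> + \<eta>) - sin \<phi>"
  have "0 \<le> cos (pi - \<eta>)"
    using assms pi_gt3 pi_half_less_two by (intro cos_ge_zero) auto
  then have c: "cos \<eta> \<le> 0" by simp
  have c1: "(cos t)\<^sup>2 + (sin t)\<^sup>2 = 1" for t :: real by simp
  have c2: "cos (\<phi> + \<eta>) * cos \<phi> + sin (\<phi> + \<eta>) * sin \<phi> = cos \<eta>"
    using cos_diff[of "\<phi> + \<eta>" \<phi>] by simp
  have "?x\<^sup>2 + ?y\<^sup>2 = ((cos (\<phi> + \<eta>))\<^sup>2 + (sin (\<phi> + \<eta>))\<^sup>2) + ((cos \<phi>)\<^sup>2 + (sin \<phi>)\<^sup>2)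
      - 2 * (cos (\<phi> + \<eta>) * cos \<phi> + sin (\<phi> + \<eta>) * sin \<phi>)"
    unfolding power2_eq_square by (simp add: algebra_simps)
  then have "?x\<^sup>2 + ?y\<^sup>2 = 2 - 2 * cos \<eta>" unfolding c1 c2 by simp
  then have "1 \<le> ?x\<^sup>2 + ?y\<^sup>2" using c by simp
  also have "\<dots> \<le> (\<bar>?x\<bar> + \<bar>?y\<bar>)\<^sup>2" by (simp add: power2_sum)
  finally have "1\<^sup>2 \<le> (\<bar>?x\<bar> + \<bar>?y\<bar>)\<^sup>2" by simp
  then show ?thesis by (rule power2_le_imp_le) simp
qed

text \<open>At shift \<delta> of order l powr (- j) only scale j matters. It contributes at least b
  ^ j. Lower frequencies contribute at most 6 / 24 of that by their Lipschitz bounds, higher ones at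
  most 4 / 24 by their size; the threshold 25 makes both geometric sums this small, so more than
  half remains.\<close>

lemma lacunary_increment_ge:
  fixes b l t \<delta> :: real
  assumes b: "0 < b" "b \<le> 1 / 25" and l: "0 < l" "25 \<le> b * l" and j: "j < J"
    and \<delta>: "2 / l ^ j \<le> \<delta>" "\<delta> \<le> 3 / l ^ j"
  shows "b ^ j / 2 \<le> \<bar>lacunary cos b l J (t + \<delta>) - lacunary cos b l J t\<bar> + \<bar>lacunary sin b l J (t + \<delta>) - lacunary sin b l J t\<bar>"
proof -
  define C where "C i = cos (l ^ i * (t + \<delta>)) - cos (l ^ i * t)" for i
  define S where "S i = sin (l ^ i * (t + \<delta>)) - sin (l ^ i * t)" for i
  have lp: "0 < l ^ i" for i using l by simp
  have \<delta>0: "0 \<le> \<delta>" using \<delta>(1) lp[of j] by (smt (verit) divide_nonneg_pos)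
  have main: "1 \<le> \<bar>C j\<bar> + \<bar>S j\<bar>"
  proof -
    have "2 \<le> l ^ j * \<delta>" "l ^ j * \<delta> \<le> 3" using \<delta> lp[of j] by (auto simp: field_simps)
    from cos_sin_increment_ge_1[OF this, of "l ^ j * t"] show ?thesis
      by (simp add: C_def S_def distrib_left)
  qed
  have low: "\<bar>C i\<bar> + \<bar>S i\<bar> \<le> 6 * l ^ i / l ^ j" for i
  proof -
    have eq: "\<bar>l ^ i * (t + \<delta>) - l ^ i * t\<bar> = l ^ i * \<delta>" using lp[of i] \<delta>0 by (simp add: distrib_left)
    have "\<bar>C i\<bar> + \<bar>S i\<bar> \<le> l ^ i * \<delta> + l ^ i * \<delta>"
      unfolding C_def S_def eq[symmetric] by (intro add_mono abs_cos_diff_le abs_sin_diff_le)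
    also have "\<dots> = 2 * (l ^ i * \<delta>)" by simp
    also have "\<dots> \<le> 2 * (l ^ i * (3 / l ^ j))" using \<delta>(2) lp[of i] by (intro mult_left_mono) auto
    finally show ?thesis by simp
  qed
  have high: "\<bar>C i\<bar> + \<bar>S i\<bar> \<le> 4" for i
    using abs_cos_le_one[of "l ^ i * (t + \<delta>)"] abs_cos_le_one[of "l ^ i * t"]
      abs_sin_le_one[of "l ^ i * (t + \<delta>)"] abs_sin_le_one[of "l ^ i * t"]
    unfolding C_def S_def by linarith
  \<comment> \<open>Since j < J, the upper index J - 1 is a genuine predecessor.\<close>
  have split: "{..<J} = insert j ({..<j} \<union> {Suc j..J - 1})" using j by auto
  have sum_split: "(\<Sum>i<J. f i) = f j + ((\<Sum>i<j. f i) + (\<Sum>i\<in>{Suc j..J - 1}. f i))" for f :: "nat \<Rightarrow> real"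
    unfolding split by (subst sum.insert) (auto intro: sum.union_disjoint)
  have "(\<Sum>i<j. b ^ i * (\<bar>C i\<bar> + \<bar>S i\<bar>)) \<le> (\<Sum>i<j. b ^ i * (6 * l ^ i / l ^ j))"
    using b by (intro sum_mono mult_left_mono low) auto
  also have "\<dots> = 6 / l ^ j * (\<Sum>i<j. (b * l) ^ i)"
    unfolding sum_distrib_left by (intro sum.cong) (auto simp: power_mult_distrib)
  also have "\<dots> \<le> 6 / l ^ j * (((b * l) ^ j - 1) / 24)"
    using lp[of j] by (intro mult_left_mono sum_power_lessThan_le l) auto
  also have "\<dots> \<le> 6 / l ^ j * ((b * l) ^ j / 24)"
    using lp[of j] by (intro mult_left_mono) auto
  also have "\<dots> = b ^ j / 4" using l by (simp add: power_mult_distrib)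
  finally have 1: "(\<Sum>i<j. b ^ i * (\<bar>C i\<bar> + \<bar>S i\<bar>)) \<le> b ^ j / 4" .
  have "(\<Sum>i\<in>{Suc j..J - 1}. b ^ i * (\<bar>C i\<bar> + \<bar>S i\<bar>)) \<le> (\<Sum>i\<in>{Suc j..J - 1}. b ^ i * 4)"
    using b by (intro sum_mono mult_left_mono high) auto
  also have "\<dots> = 4 * (\<Sum>i\<in>{Suc j..J - 1}. b ^ i)" by (simp add: sum_distrib_left mult.commute)
  also have "\<dots> \<le> 4 * ((b ^ j - b ^ (J - 1)) / 24)"
    using j by (intro mult_left_mono sum_power_tail_le b) auto
  also have "\<dots> \<le> 4 * (b ^ j / 24)" using b by (intro mult_left_mono) auto
  finally have 2: "(\<Sum>i\<in>{Suc j..J - 1}. b ^ i * (\<bar>C i\<bar> + \<bar>S i\<bar>)) \<le> b ^ j / 6" by simp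
  have diff: "\<bar>b ^ j * D j\<bar> \<le> \<bar>\<Sum>i<J. b ^ i * D i\<bar> + ((\<Sum>i<j. b ^ i * \<bar>D i\<bar>) + (\<Sum>i\<in>{Suc j..J - 1}. b ^ i * \<bar>D i\<bar>))" for D
  proof -
    have "\<bar>\<Sum>i\<in>I. b ^ i * D i\<bar> \<le> (\<Sum>i\<in>I. b ^ i * \<bar>D i\<bar>)" for I
      using sum_abs[of "\<lambda>i. b ^ i * D i" I] b by (simp add: abs_mult)
    from this[of "{..<j}"] this[of "{Suc j..J - 1}"] show ?thesis
      unfolding sum_split[of "\<lambda>i. b ^ i * D i"] by linarith
  qed
  have eqC: "lacunary cos b l J (t + \<delta>) - lacunary cos b l J t = (\<Sum>i<J. b ^ i * C i)"
    and eqS: "lacunary sin b l J (t + \<delta>) - lacunary sin b l J t = (\<Sum>i<J. b ^ i * S i)"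
    by (simp_all add: lacunary_def C_def S_def sum_subtractf right_diff_distrib)
  have "b ^ j * 1 \<le> b ^ j * (\<bar>C j\<bar> + \<bar>S j\<bar>)" using b main by (intro mult_left_mono) auto
  then have "b ^ j \<le> \<bar>b ^ j * C j\<bar> + \<bar>b ^ j * S j\<bar>" using b by (simp add: abs_mult distrib_left)
  also have "\<dots> \<le> (\<bar>\<Sum>i<J. b ^ i * C i\<bar> + ((\<Sum>i<j. b ^ i * \<bar>C i\<bar>) + (\<Sum>i\<in>{Suc j..J - 1}. b ^ i * \<bar>C i\<bar>)))
     + (\<bar>\<Sum>i<J. b ^ i * S i\<bar> + ((\<Sum>i<j. b ^ i * \<bar>S i\<bar>) + (\<Sum>i\<in>{Suc j..J - 1}. b ^ i * \<bar>S i\<bar>)))"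
    by (intro add_mono diff)
  also have "\<dots> = \<bar>\<Sum>i<J. b ^ i * C i\<bar> + \<bar>\<Sum>i<J. b ^ i * S i\<bar>
     + ((\<Sum>i<j. b ^ i * (\<bar>C i\<bar> + \<bar>S i\<bar>)) + (\<Sum>i\<in>{Suc j..J - 1}. b ^ i * (\<bar>C i\<bar> + \<bar>S i\<bar>)))"
    by (simp add: distrib_left sum.distrib)
  finally have "b ^ j \<le> \<bar>\<Sum>i<J. b ^ i * C i\<bar> + \<bar>\<Sum>i<J. b ^ i * S i\<bar>
     + ((\<Sum>i<j. b ^ i * (\<bar>C i\<bar> + \<bar>S i\<bar>)) + (\<Sum>i\<in>{Suc j..J - 1}. b ^ i * (\<bar>C i\<bar> + \<bar>S i\<bar>)))" .
  moreover have "0 \<le> b ^ j" using b by simp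
  moreover have "B / 2 \<le> X" if "B \<le> X + (P + Q)" "P \<le> B / 4" "Q \<le> B / 6" "0 \<le> B" for B X P Q :: real
    using that by linarith
  ultimately show ?thesis
    unfolding eqC eqS using 1 2 by blast
qed

text \<open>Pairs of points are sorted by their difference. Disjoint balls of differences give
  disjoint sets of pairs, so the contributions of all scales add up. Only the sum of the two
  integrands is bounded from below, since either of them may vanish at a given pair.\<close>

lemma gagliardo_pair_ge:
  fixes u w :: "real^'n::finite \<Rightarrow> real" and a :: "nat \<Rightarrow> real^'n" and \<rho> m :: "nat \<Rightarrow> real"
  assumes \<Omega>: "open \<Omega>" "bounded \<Omega>" and sub: "cball x0 r \<subseteq> \<Omega>" and r: "0 \<le> r"
    and cont: "continuous_on UNIV u" "continuous_on UNIV w" and I: "finite I"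
    and disj: "\<And>i j. i \<in> I \<Longrightarrow> j \<in> I \<Longrightarrow> i \<noteq> j \<Longrightarrow> cball (a i) (\<rho> i) \<inter> cball (a j) (\<rho> j) = {}"
    and pos: "\<And>j. j \<in> I \<Longrightarrow> 0 \<le> \<rho> j" "\<And>j. j \<in> I \<Longrightarrow> 0 \<le> m j"
    and shift: "\<And>x h j. x \<in> cball x0 r \<Longrightarrow> j \<in> I \<Longrightarrow> h \<in> cball (a j) (\<rho> j) \<Longrightarrow> x + h \<in> \<Omega>"
    and ge: "\<And>x h j. x \<in> cball x0 r \<Longrightarrow> j \<in> I \<Longrightarrow> h \<in> cball (a j) (\<rho> j) \<Longrightarrow>
      m j \<le> \<bar>u x - u (x + h)\<bar> powr p / norm h powr (real CARD('n) + s * p) + \<bar>w x - w (x + h)\<bar> powr p / norm h powr (real CARD('n) + s * p)"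
  shows "ennreal (unit_ball_vol (real CARD('n)) * r ^ CARD('n) * (\<Sum>j\<in>I. m j * (unit_ball_vol (real CARD('n)) * \<rho> j ^ CARD('n))))
    \<le> gagliardo s p \<Omega> u + gagliardo s p \<Omega> w"
proof -
  let ?L = "lebesgue_on \<Omega>" and ?V = "unit_ball_vol (real CARD('n))"
  let ?e = "\<lambda>u z. ennreal (\<bar>u (fst z) - u (snd z)\<bar> powr p / norm (fst z - snd z) powr (real CARD('n) + s * p))"
  interpret S: sigma_finite_measure ?L using \<Omega> by (rule sigma_finite_lebesgue_on)
  have \<Omega>L: "\<Omega> \<in> sets lebesgue" using \<Omega>(1) by simp
  have em: "?e u \<in> borel_measurable (?L \<Otimes>\<^sub>M ?L)" if "continuous_on UNIV u" for u :: "real^'n \<Rightarrow> real"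
  proof -
    have [measurable]: "u \<in> borel_measurable ?L"
      using that by (intro measurable_lebesgue_on_of_borel borel_measurable_continuous_onI)
    have [measurable]: "(\<lambda>z. norm (fst z - snd z)) \<in> borel_measurable (?L \<Otimes>\<^sub>M ?L)"
      by (rule measurable_pair_lebesgue_on_of_borel) (intro borel_measurable_continuous_onI continuous_intros)
    show ?thesis by measurable
  qed
  define T where "T j = {z. fst z \<in> cball x0 r \<and> snd z - fst z \<in> cball (a j) (\<rho> j)}" for j
  have Tc: "closed (T j)" for j
  proof -
    have "T j = (fst -` cball x0 r) \<inter> ((\<lambda>z. snd z - fst z) -` cball (a j) (\<rho> j))" by (auto simp: T_def)
    then show ?thesis by (auto intro!: closed_Int continuous_closed_vimage continuous_intros)
  qed
  have Tm: "indicator (T j) \<in> borel_measurable (?L \<Otimes>\<^sub>M ?L)" for j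
    using Tc by (intro measurable_pair_lebesgue_on_of_borel borel_measurable_indicator borel_closed)
  have meas: "(\<integral>\<^sup>+z. ennreal (m j) * indicator (T j) z \<partial>(?L \<Otimes>\<^sub>M ?L))
      = ennreal (?V * r ^ CARD('n) * (m j * (?V * \<rho> j ^ CARD('n))))" if j: "j \<in> I" for j
  proof -
    \<comment> \<open>By \<open>shift\<close> the constraint that y lies in \<Omega> cuts nothing
      off, so each slice has the full volume of the ball of differences.\<close>
    have inner: "(\<integral>\<^sup>+y. indicator (T j) (x, y) \<partial>?L) = ennreal (?V * \<rho> j ^ CARD('n)) * indicator (cball x0 r) x" for x
    proof (cases "x \<in> cball x0 r")
      case True
      have "(\<integral>\<^sup>+y. indicator (T j) (x, y) \<partial>?L) = (\<integral>\<^sup>+y. indicator (cball (a j) (\<rho> j)) (y - x) \<partial>lborel)"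
        unfolding nn_integral_lebesgue_on_eq[OF \<Omega>L]
      proof (intro nn_integral_cong)
        fix y
        have "y - x \<in> cball (a j) (\<rho> j) \<Longrightarrow> y \<in> \<Omega>" using shift[OF True j, of "y - x"] by simp
        moreover have "(x, y) \<in> T j \<longleftrightarrow> y - x \<in> cball (a j) (\<rho> j)" using True unfolding T_def by simp
        ultimately show "indicator (T j) (x, y) * indicator \<Omega> y = (indicator (cball (a j) (\<rho> j)) (y - x) :: ennreal)"
          unfolding indicator_def by auto
      qed
      also have "\<dots> = (\<integral>\<^sup>+y. indicator (cball (a j) (\<rho> j)) y \<partial>lborel)"
        by (rule nn_integral_lborel_translation) (rule borel_measurable_indicator, simp)
      also have "\<dots> = ennreal (?V * \<rho> j ^ CARD('n))"
        using pos(1)[OF j] by (simp add: emeasure_cball)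
      finally show ?thesis using True by simp
    qed (simp add: T_def)
    have "(\<integral>\<^sup>+z. ennreal (m j) * indicator (T j) z \<partial>(?L \<Otimes>\<^sub>M ?L)) = ennreal (m j) * (\<integral>\<^sup>+z. indicator (T j) z \<partial>(?L \<Otimes>\<^sub>M ?L))"
      using Tm by (intro nn_integral_cmult)
    also have "(\<integral>\<^sup>+z. indicator (T j) z \<partial>(?L \<Otimes>\<^sub>M ?L)) = (\<integral>\<^sup>+x. \<integral>\<^sup>+y. indicator (T j) (x, y) \<partial>?L \<partial>?L)"
      using S.nn_integral_fst[OF Tm] by simp
    also have "\<dots> = (\<integral>\<^sup>+x. ennreal (?V * \<rho> j ^ CARD('n)) * indicator (cball x0 r) x \<partial>lborel)"
      unfolding inner nn_integral_lebesgue_on_eq[OF \<Omega>L] using sub by (intro nn_integral_cong) (auto simp: indicator_def)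
    also have "\<dots> = ennreal (?V * \<rho> j ^ CARD('n)) * ennreal (?V * r ^ CARD('n))"
      using r by (subst nn_integral_cmult_indicator) (auto simp: emeasure_cball)
    finally show ?thesis
      using pos[OF j] r by (simp add: ennreal_mult[symmetric] mult_ac)
  qed
  have "ennreal (?V * r ^ CARD('n) * (\<Sum>j\<in>I. m j * (?V * \<rho> j ^ CARD('n))))
      = (\<Sum>j\<in>I. \<integral>\<^sup>+z. ennreal (m j) * indicator (T j) z \<partial>(?L \<Otimes>\<^sub>M ?L))"
  proof -
    have "ennreal (?V * r ^ CARD('n) * (\<Sum>j\<in>I. m j * (?V * \<rho> j ^ CARD('n))))
        = (\<Sum>j\<in>I. ennreal (?V * r ^ CARD('n) * (m j * (?V * \<rho> j ^ CARD('n)))))"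
      unfolding sum_distrib_left using pos r by (intro sum_ennreal[symmetric]) auto
    also have "\<dots> = (\<Sum>j\<in>I. \<integral>\<^sup>+z. ennreal (m j) * indicator (T j) z \<partial>(?L \<Otimes>\<^sub>M ?L))"
      by (intro sum.cong refl meas[symmetric])
    finally show ?thesis .
  qed
  also have "\<dots> = (\<integral>\<^sup>+z. (\<Sum>j\<in>I. ennreal (m j) * indicator (T j) z) \<partial>(?L \<Otimes>\<^sub>M ?L))"
  proof (rule nn_integral_sum[symmetric])
    note Tm [measurable]
    show "(\<lambda>z. ennreal (m j) * indicator (T j) z) \<in> borel_measurable (?L \<Otimes>\<^sub>M ?L)" for j by measurable
  qed
  also have "\<dots> \<le> (\<integral>\<^sup>+z. ?e u z + ?e w z \<partial>(?L \<Otimes>\<^sub>M ?L))"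
  proof (intro nn_integral_mono)
    fix z
    show "(\<Sum>j\<in>I. ennreal (m j) * indicator (T j) z) \<le> ?e u z + ?e w z"
    proof (cases "\<exists>j\<in>I. z \<in> T j")
      case True
      then obtain j where j: "j \<in> I" "z \<in> T j" by blast
      \<comment> \<open>By disjointness z lies in no other T i, so the sum of indicators is a single
        term.\<close>
      have "(\<Sum>i\<in>I. ennreal (m i) * indicator (T i) z) = (\<Sum>i\<in>I. if i = j then ennreal (m j) else 0)"
      proof (intro sum.cong refl)
        fix i assume "i \<in> I"
        have "z \<notin> T i" if "i \<noteq> j"
          using disj[OF \<open>i \<in> I\<close> j(1) that] j(2) unfolding T_def by blast
        then show "ennreal (m i) * indicator (T i) z = (if i = j then ennreal (m j) else 0)"
          using j(2) by (cases "i = j") simp_all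
      qed
      also have "\<dots> = ennreal (m j)" using j I by simp
      also have "\<dots> \<le> ?e u z + ?e w z"
        using ge[of "fst z" j "snd z - fst z"] j
        by (simp add: T_def ennreal_plus[symmetric] norm_minus_commute ennreal_leI del: ennreal_plus)
      finally show ?thesis .
    next
      case False
      then have "(\<Sum>j\<in>I. ennreal (m j) * indicator (T j) z) = 0" by (intro sum.neutral) auto
      then show ?thesis by simp
    qed
  qed
  also have "\<dots> = (\<integral>\<^sup>+z. ?e u z \<partial>(?L \<Otimes>\<^sub>M ?L)) + (\<integral>\<^sup>+z. ?e w z \<partial>(?L \<Otimes>\<^sub>M ?L))"
    by (intro nn_integral_add em cont)
  finally show ?thesis by (simp add: gagliardo_def case_prod_beta')
qed

text \<open>With L = l ^ j the amplitude gives the power - s q, the kernel n + t q and the volume -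
  n. Their sum (t - s) q is the weight of scale j: growing for t > s, constant for t = s.\<close>

lemma lacunary_scale_weight:
  fixes L s t q V :: real and n :: nat
  assumes "0 < L"
  shows "(L powr (- s) / 4) powr q / (3 / L) powr (real n + t * q) * (V * (1 / (2 * L)) ^ n)
    = V / (4 powr q * 3 powr (real n + t * q) * 2 ^ n) * L powr ((t - s) * q)"
proof -
  let ?E = "real n + t * q"
  have "L powr (- s * q) * L powr ?E = L powr ((t - s) * q + real n)"
    unfolding powr_add[symmetric] by (simp add: algebra_simps)
  also have "\<dots> = L powr ((t - s) * q) * L ^ n"
    using assms by (simp add: powr_add powr_realpow)
  finally have key: "L powr (- s * q) * L powr ?E = L powr ((t - s) * q) * L ^ n" .
  have "A / Q / (T / D) * (V * (1 / (P * F))) = V / (Q * T * P) * (A * D / F)" for A Q T D P F :: real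
    by (simp add: mult_ac)
  then have "(L powr (- s) / 4) powr q / (3 / L) powr ?E * (V * (1 / (2 * L)) ^ n)
    = V / (4 powr q * 3 powr ?E * 2 ^ n) * (L powr (- s * q) * L powr ?E / L ^ n)"
    unfolding powr_divide powr_powr power_one_over power_mult_distrib power_divide power_one by blast
  also have "L powr (- s * q) * L powr ?E / L ^ n = L powr ((t - s) * q)"
    unfolding key using assms by simp
  finally show ?thesis .
qed

text \<open>The sum starts at j = 1 because scale 0 would need shifts of length about 3, which may
  leave \<Omega>; from j = 1 on they are at most 3 / l \<le> r.\<close>

lemma gagliardo_lacunary_ge:
  fixes \<Omega> :: "(real^'n::finite) set" and k :: 'n
  assumes \<Omega>: "open \<Omega>" "bounded \<Omega>" and sub: "cball x0 (2 * r) \<subseteq> \<Omega>" and r: "0 < r"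
    and t: "0 < t" "1 \<le> q" and b: "b = l powr (- s)" "b \<le> 1 / 25" and l: "0 < l" "25 \<le> b * l" "3 \<le> r * l"
  shows "ennreal (unit_ball_vol (real CARD('n)) * r ^ CARD('n) *
      (unit_ball_vol (real CARD('n)) / (4 powr q * 3 powr (real CARD('n) + t * q) * 2 ^ CARD('n))) * (\<Sum>j\<in>{1..<J}. (l powr ((t - s) * q)) ^ j))
    \<le> gagliardo t q \<Omega> (\<lambda>x. lacunary cos b l J (x $ k)) + gagliardo t q \<Omega> (\<lambda>x. lacunary sin b l J (x $ k))"
proof -
  let ?V = "unit_ball_vol (real CARD('n))" and ?E = "real CARD('n) + t * q"
  have b0: "0 < b" using b l by simp
  have "b * l \<le> 1 / 25 * l" using b l by (intro mult_right_mono) auto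
  then have l25: "25 \<le> l" using l by linarith
  have lp: "0 < l ^ j" for j using l by simp
  \<comment> \<open>Centre 5 / 2 and radius 1 / 2 in units of 1 / l ^ j put the k-th coordinate
    between 2 and 3, the window of \<open>cos_sin_increment_ge_1\<close>, and keep the norm below
    3.\<close>
  define a where "a j = (5 / (2 * l ^ j)) *\<^sub>R (axis k 1 :: real^'n)" for j
  define \<rho> where "\<rho> j = 1 / (2 * l ^ j)" for j
  define m where "m j = (b ^ j / 4) powr q / (3 / l ^ j) powr ?E" for j
  have hk: "2 / l ^ j \<le> h $ k" "h $ k \<le> 3 / l ^ j" "norm h \<le> 3 / l ^ j" if "h \<in> cball (a j) (\<rho> j)" for h j
  proof -
    have d: "norm (h - a j) \<le> 1 / (2 * l ^ j)" using that by (simp add: \<rho>_def dist_norm norm_minus_commute)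
    have ak: "a j $ k = 5 / (2 * l ^ j)" and an: "norm (a j) = 5 / (2 * l ^ j)" using lp[of j] by (simp_all add: a_def)
    have "\<bar>h $ k - a j $ k\<bar> \<le> 1 / (2 * l ^ j)" using component_le_norm_cart[of "h - a j" k] d by simp
    then have "5 / (2 * l ^ j) - 1 / (2 * l ^ j) \<le> h $ k" "h $ k \<le> 5 / (2 * l ^ j) + 1 / (2 * l ^ j)"
      unfolding ak by linarith+
    moreover have "5 / (2 * l ^ j) - 1 / (2 * l ^ j) = 2 / l ^ j" "5 / (2 * l ^ j) + 1 / (2 * l ^ j) = 3 / l ^ j"
      using lp[of j] by (simp_all add: field_simps)
    moreover have "norm h \<le> 5 / (2 * l ^ j) + 1 / (2 * l ^ j)"
      using norm_triangle_ineq[of "a j" "h - a j"] an d by simp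
    ultimately show "2 / l ^ j \<le> h $ k" "h $ k \<le> 3 / l ^ j" "norm h \<le> 3 / l ^ j" by simp_all
  qed
  have cont: "continuous_on UNIV (\<lambda>x::real^'n. lacunary c b l J (x $ k))" if "continuous_on UNIV c" for c :: "real \<Rightarrow> real"
    unfolding lacunary_def
    by (intro continuous_on_sum continuous_on_mult continuous_on_const continuous_on_compose2[OF that] continuous_on_component continuous_on_id) auto
  \<comment> \<open>The windows of the k-th coordinate at different scales are disjoint because l is
    at least 25.\<close>
  have disj: False if "h \<in> cball (a i) (\<rho> i)" "h \<in> cball (a j) (\<rho> j)" "i < j" for h i j
  proof -
    have "2 / l ^ i \<le> 3 / l ^ j" using hk(1)[OF that(1)] hk(2)[OF that(2)] by simp
    then have "2 * l ^ j \<le> 3 * l ^ i" using lp[of i] lp[of j] by (simp add: field_simps)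
    moreover have "l ^ Suc i \<le> l ^ j" using that(3) l25 by (intro power_increasing) auto
    moreover have "25 * l ^ i \<le> l * l ^ i" using l25 lp[of i] by (intro mult_right_mono) auto
    ultimately show False using lp[of i] by simp
  qed
  have "ennreal (?V * r ^ CARD('n) * (\<Sum>j\<in>{1..<J}. m j * (?V * \<rho> j ^ CARD('n))))
    \<le> gagliardo t q \<Omega> (\<lambda>x. lacunary cos b l J (x $ k)) + gagliardo t q \<Omega> (\<lambda>x. lacunary sin b l J (x $ k))"
  proof (rule gagliardo_pair_ge[OF \<Omega>])
    show "cball x0 r \<subseteq> \<Omega>" using subset_cball[of r "2 * r" x0] r sub by auto
    show "cball (a i) (\<rho> i) \<inter> cball (a j) (\<rho> j) = {}" if "i \<noteq> j" for i j
      using disj[of _ i j] disj[of _ j i] that by (metis disjoint_iff linorder_neqE_nat)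
    show "0 \<le> \<rho> j" "0 \<le> m j" for j using lp[of j] by (simp_all add: \<rho>_def m_def)
    fix x h :: "real^'n" and j assume x: "x \<in> cball x0 r" and j: "j \<in> {1..<J}" and h: "h \<in> cball (a j) (\<rho> j)"
    have "l ^ 1 \<le> l ^ j" using j l25 by (intro power_increasing) auto
    then have "3 / l ^ j \<le> 3 / l" using l by (intro divide_left_mono) auto
    also have "\<dots> \<le> r" using l by (simp add: field_simps)
    finally have "norm h \<le> r" using hk(3)[OF h] by simp
    then have "norm ((x - x0) + h) \<le> 2 * r"
      using norm_triangle_ineq[of "x - x0" h] x by (simp add: dist_norm norm_minus_commute)
    then have "x + h \<in> cball x0 (2 * r)"
      by (simp add: dist_norm norm_minus_commute[of x0] algebra_simps)
    then show "x + h \<in> \<Omega>" using sub by blast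
    let ?C = "\<bar>lacunary cos b l J (x $ k) - lacunary cos b l J ((x + h) $ k)\<bar>"
      and ?S = "\<bar>lacunary sin b l J (x $ k) - lacunary sin b l J ((x + h) $ k)\<bar>"
    have "b ^ j / 2 \<le> ?C + ?S"
      using lacunary_increment_ge[OF b0 b(2) l(1,2) _ hk(1,2)[OF h], of J "x $ k"] j
      by (simp add: abs_minus_commute)
    \<comment> \<open>One of the two increments carries at least half, whence b ^ j / 4.\<close>
    then consider "b ^ j / 4 \<le> ?C" | "b ^ j / 4 \<le> ?S" by linarith
    then have "(b ^ j / 4) powr q \<le> ?C powr q + ?S powr q"
    proof cases
      case 1
      then have "(b ^ j / 4) powr q \<le> ?C powr q" using b0 t by (intro powr_mono2) auto
      then show ?thesis by (rule add_increasing2[rotated]) simp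
    next
      case 2
      then have "(b ^ j / 4) powr q \<le> ?S powr q" using b0 t by (intro powr_mono2) auto
      then show ?thesis by (rule add_increasing[rotated]) simp
    qed
    moreover have "norm h powr ?E \<le> (3 / l ^ j) powr ?E"
      using hk(3)[OF h] t by (intro powr_mono2) auto
    moreover have "h \<noteq> 0"
    proof
      assume "h = 0"
      then show False using hk(1)[OF h] lp[of j] by (simp add: divide_le_0_iff)
    qed
    ultimately have "m j \<le> (?C powr q + ?S powr q) / norm h powr ?E"
      unfolding m_def by (intro frac_le) auto
    then show "m j \<le> ?C powr q / norm h powr ?E + ?S powr q / norm h powr ?E"
      by (simp only: add_divide_distrib)
  qed (use r in \<open>auto intro!: cont continuous_intros\<close>)
  also have "(\<Sum>j\<in>{1..<J}. m j * (?V * \<rho> j ^ CARD('n)))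
    = (\<Sum>j\<in>{1..<J}. ?V / (4 powr q * 3 powr ?E * 2 ^ CARD('n)) * (l powr ((t - s) * q)) ^ j)"
  proof (intro sum.cong refl)
    fix j
    have pw: "(l powr e) ^ j = (l ^ j) powr e" for e
    proof -
      have "(l powr e) ^ j = (l powr e) powr real j" using l by (simp add: powr_realpow)
      also have "\<dots> = (l powr real j) powr e" unfolding powr_powr by (simp only: mult.commute)
      also have "\<dots> = (l ^ j) powr e" using l by (simp add: powr_realpow)
      finally show ?thesis .
    qed
    show "m j * (?V * \<rho> j ^ CARD('n)) = ?V / (4 powr q * 3 powr ?E * 2 ^ CARD('n)) * (l powr ((t - s) * q)) ^ j"
      unfolding m_def \<rho>_def b(1) pw by (rule lacunary_scale_weight[OF lp])
  qed
  finally show ?thesis by (simp only: sum_distrib_left mult.assoc)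
qed

lemma lacunary_embedding_bound:
  fixes \<Omega> :: "(real^'n::finite) set"
  assumes \<Omega>: "open \<Omega>" "bounded \<Omega>" "\<Omega> \<noteq> {}" and s: "0 < s" "s < 1" "1 \<le> p" "s * p = real CARD('n)"
    and t: "0 < t" "t < 1" "1 \<le> q" and emb: "continuously_embedded \<Omega> s (ereal p) t (ereal q)"
  obtains c C K l where "0 < c" "0 \<le> C" "0 \<le> K" "1 < l"
    "\<And>J. c * (\<Sum>j\<in>{1..<J}. (l powr ((t - s) * q)) ^ j) \<le> (C * (K * (1 + ln (l ^ J))) powr (1 / p)) powr q"
proof -
  let ?V = "unit_ball_vol (real CARD('n))"
  obtain x0 where "x0 \<in> \<Omega>" using \<Omega>(3) by blast
  then obtain R where R: "0 < R" "cball x0 R \<subseteq> \<Omega>" using \<Omega>(1) open_contains_cball by blast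
  define r where "r = R / 2"
  have r: "0 < r" "cball x0 (2 * r) \<subseteq> \<Omega>" using R by (simp_all add: r_def)
  \<comment> \<open>Both thresholds 25 can be met at once exactly because - s < 0 < 1 - s; l also
    has to be large against 1 / r.\<close>
  have "eventually (\<lambda>l::real. l powr (- s) \<le> 1 / 25) at_top"
    using s(1) by real_asymp
  moreover have "eventually (\<lambda>l::real. 25 \<le> l powr (1 - s)) at_top"
    using s(2) by real_asymp
  ultimately have "eventually (\<lambda>l::real. l powr (- s) \<le> 1 / 25 \<and> 25 \<le> l powr (1 - s) \<and> 3 / r \<le> l \<and> 2 \<le> l) at_top"
    using eventually_ge_at_top[of "3 / r"] eventually_ge_at_top[of 2] by eventually_elim simp
  then obtain l :: real where l: "l powr (- s) \<le> 1 / 25" "25 \<le> l powr (1 - s)" "3 / r \<le> l" "2 \<le> l"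
    by (auto dest: eventually_happens)
  define b where "b = l powr (- s)"
  have b0: "0 < b" using l by (simp add: b_def)
  have bl: "25 \<le> b * l" using l powr_add[of l "- s" 1] by (simp add: b_def)
  have rl: "3 \<le> r * l" using l(3) r(1) by (simp add: field_simps)
  obtain C K where CK: "0 \<le> C" "0 \<le> K" "\<And>u \<Lambda>. 1 \<le> \<Lambda> \<Longrightarrow> oscillating s 6 \<Lambda> u \<Longrightarrow>
    \<exists>v\<in>sobolev_space t (ereal q) \<Omega>. (AE x in lebesgue_on \<Omega>. v x = u x) \<and>
      sobolev_norm t (ereal q) \<Omega> v \<le> ennreal (C * (K * (1 + ln \<Lambda>)) powr (1 / p))"
    by (rule oscillation_embedding_bound[OF \<Omega>(1,2) s _ emb, of 6]) (simp, rule that)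
  have cc: "0 < c_const CARD('n) t q" using t by (intro c_const_pos) (auto simp: Suc_leI)
  define k :: 'n where "k = undefined"
  define c0 where "c0 = ?V * r ^ CARD('n) * (?V / (4 powr q * 3 powr (real CARD('n) + t * q) * 2 ^ CARD('n)))"
  have "0 < ?V" by simp
  then have c0: "0 < c0" unfolding c0_def using r(1) by (intro mult_pos_pos divide_pos_pos zero_less_power) auto
  show thesis
  proof (rule that[of "c0 * c_const CARD('n) t q / 2" C K l])
    show "0 < c0 * c_const CARD('n) t q / 2" using c0 cc by simp
    fix J
    let ?B = "C * (K * (1 + ln (l ^ J))) powr (1 / p)" and ?\<Sigma> = "\<Sum>j\<in>{1..<J}. (l powr ((t - s) * q)) ^ j"
    have l1: "1 \<le> l ^ J" using l by (intro one_le_power) auto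
    have B: "0 \<le> ?B" using CK by simp
    have up: "gagliardo t q \<Omega> (\<lambda>x. lacunary c b l J (x $ k)) \<le> ennreal (?B powr q / c_const CARD('n) t q)"
      if c: "\<And>t. \<bar>c t\<bar> \<le> 1" "\<And>t t'. \<bar>c t - c t'\<bar> \<le> \<bar>t - t'\<bar>" "continuous_on UNIV c" for c :: "real \<Rightarrow> real"
    proof -
      let ?u = "\<lambda>x::real^'n. lacunary c b l J (x $ k)"
      have osc: "oscillating s 6 (l ^ J) ?u"
        using l s bl by (intro lacunary_oscillating[OF c b_def]) (auto simp: b_def)
      obtain v where v: "v \<in> sobolev_space t (ereal q) \<Omega>" "AE x in lebesgue_on \<Omega>. v x = ?u x"
        "sobolev_norm t (ereal q) \<Omega> v \<le> ennreal ?B"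
        using CK(3)[OF l1 osc] by blast
      have vm: "v \<in> borel_measurable (lebesgue_on \<Omega>)" using v(1) by (simp add: sobolev_space_def)
      have um: "?u \<in> borel_measurable (lebesgue_on \<Omega>)"
        using osc by (intro measurable_lebesgue_on_of_borel borel_measurable_continuous_onI) (simp add: oscillating_def)
      show ?thesis
        using gagliardo_le_of_sobolev_norm_le[OF t B v(3)] gagliardo_cong_AE[OF \<Omega>(1,2) vm um v(2), of t q] by simp
    qed
    have "ennreal (c0 * ?\<Sigma>) \<le> gagliardo t q \<Omega> (\<lambda>x. lacunary cos b l J (x $ k)) + gagliardo t q \<Omega> (\<lambda>x. lacunary sin b l J (x $ k))"
      unfolding c0_def
      by (rule gagliardo_lacunary_ge[OF \<Omega>(1,2) r(2,1) t(1,3) b_def _ _ bl rl]) (use l in \<open>auto simp: b_def\<close>)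
    \<comment> \<open>Cosine and sine sums satisfy the same upper bound, which costs a factor
      2.\<close>
    also have "\<dots> \<le> ennreal (?B powr q / c_const CARD('n) t q) + ennreal (?B powr q / c_const CARD('n) t q)"
      by (intro add_mono up abs_cos_diff_le abs_sin_diff_le) (auto intro: continuous_intros)
    also have "\<dots> = ennreal (2 * (?B powr q / c_const CARD('n) t q))"
      using cc by (simp flip: ennreal_plus)
    finally have "c0 * ?\<Sigma> \<le> 2 * (?B powr q / c_const CARD('n) t q)"
      using cc by (subst (asm) ennreal_le_iff) auto
    then show "c0 * c_const CARD('n) t q / 2 * ?\<Sigma> \<le> ?B powr q"
      using cc by (simp add: field_simps)
  qed (use CK l in auto)
qed

lemma ex_power_scale:
  fixes l X :: real
  assumes "1 < l" "1 \<le> X"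
  obtains J :: nat where "l ^ J \<le> X" "X < l ^ Suc J"
proof -
  define J where "J = nat \<lfloor>log l X\<rfloor>"
  have "0 \<le> log l X" using assms by simp
  then have J: "real J \<le> log l X" "log l X < real (Suc J)" unfolding J_def by linarith+
  have "l powr real J \<le> X" using J(1) assms by (subst (asm) le_log_iff) auto
  moreover have "X < l powr real (Suc J)" using J(2) assms by (subst (asm) log_less_iff) auto
  ultimately show thesis using that[of J] assms by (simp add: powr_realpow del: of_nat_Suc power_Suc)
qed

text \<open>For s < t the top scale J - 1 alone grows like a power of l ^ J. For t = s all weights
  are 1, so the energy is of order J, that is of order ln X, against the power q / p < 1 of the
  logarithm on the other side.\<close>

lemma not_embedded_lacunary:
  fixes \<Omega> :: "(real^'n::finite) set"
  assumes \<Omega>: "open \<Omega>" "bounded \<Omega>" "\<Omega> \<noteq> {}" and s: "0 < s" "s < 1" "1 \<le> p" "s * p = real CARD('n)"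
    and t: "s \<le> t" "t < 1" "1 \<le> q" and tq: "s < t \<or> q < p"
  shows "\<not> continuously_embedded \<Omega> s (ereal p) t (ereal q)"
proof
  assume emb: "continuously_embedded \<Omega> s (ereal p) t (ereal q)"
  have t0: "0 < t" using s t by simp
  obtain c C K l where c: "0 < c" and CK: "0 \<le> C" "0 \<le> K" and l: "1 < l" and
    le: "\<And>J. c * (\<Sum>j\<in>{1..<J}. (l powr ((t - s) * q)) ^ j) \<le> (C * (K * (1 + ln (l ^ J))) powr (1 / p)) powr q"
    by (rule lacunary_embedding_bound[OF \<Omega> s t0 t(2,3) emb]) (rule that)
  have mono: "(C * (K * (1 + ln (l ^ J))) powr (1 / p)) powr q \<le> (C * (K * (1 + ln X)) powr (1 / p)) powr q"
    if "l ^ J \<le> X" for J X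
  proof -
    have "1 \<le> l ^ J" using l by (intro one_le_power) auto
    then have "0 \<le> ln (l ^ J)" "ln (l ^ J) \<le> ln X" using that by auto
    then show ?thesis
      using CK s t by (intro powr_mono2 mult_left_mono add_left_mono) auto
  qed
  show False
  proof (cases "s < t")
    case True
    define a where "a = (t - s) * q"
    have a: "0 < a" using True t by (simp add: a_def)
    show False
    \<comment> \<open>X lies below l ^ (J + 1) and the top term has index J - 1; the gap of two
      scales costs (l powr a)^2.\<close>
    proof (rule powr_not_le_log_power[of a "c / (l powr a)\<^sup>2" C K p q "l\<^sup>2"])
      show "0 < c / (l powr a)\<^sup>2" using c l by simp
      fix X assume X: "l\<^sup>2 \<le> X" "1 \<le> X"
      obtain J where J: "l ^ J \<le> X" "X < l ^ Suc J" using ex_power_scale[OF l X(2)] by blast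
      have "l ^ 2 < l ^ Suc J" using X(1) J(2) by simp
      \<comment> \<open>Needed for J - 1 to be an index of the sum.\<close>
      then have J2: "2 \<le> J" using power_less_imp_less_exp[OF l, of 2 "Suc J"] by simp
      have "X powr a \<le> (l ^ Suc J) powr a" using J(2) X a by (intro powr_mono2) auto
      also have "\<dots> = (l powr a) ^ Suc J"
      proof -
        have "(l ^ Suc J) powr a = (l powr real (Suc J)) powr a" using l by (simp only: powr_realpow)
        also have "\<dots> = (l powr a) powr real (Suc J)" unfolding powr_powr by (simp only: mult.commute)
        also have "\<dots> = (l powr a) ^ Suc J" using l by (intro powr_realpow) simp
        finally show ?thesis .
      qed
      also have "Suc J = (J - 1) + 2" using J2 by simp
      finally have "X powr a \<le> (l powr a) ^ (J - 1) * (l powr a)\<^sup>2" by (simp only: power_add)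
      then have "c / (l powr a)\<^sup>2 * X powr a \<le> c * (l powr a) ^ (J - 1)"
        using c l by (simp add: field_simps)
      also have "(l powr a) ^ (J - 1) \<le> (\<Sum>j\<in>{1..<J}. (l powr a) ^ j)"
        using J2 by (intro member_le_sum) auto
      then have "c * (l powr a) ^ (J - 1) \<le> c * (\<Sum>j\<in>{1..<J}. (l powr a) ^ j)"
        using c by (intro mult_left_mono) auto
      also have "\<dots> \<le> (C * (K * (1 + ln (l ^ J))) powr (1 / p)) powr q" unfolding a_def by (rule le)
      also have "\<dots> \<le> (C * (K * (1 + ln X)) powr (1 / p)) powr q" by (rule mono[OF J(1)])
      also have "\<dots> \<le> (C * (K * (1 + ln X)) powr (1 / p) + 1) powr q"
        using CK t by (intro powr_mono2) auto
      finally show "c / (l powr a)\<^sup>2 * X powr a \<le> (C * (K * (1 + ln X)) powr (1 / p) + 1) powr q" .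
    qed (use a CK s t in auto)
  next
    case False
    then have st: "t = s" "q < p" using t tq by auto
    have ll: "0 < ln l" using l by simp
    show False
    \<comment> \<open>Raising the norm bound to the power q turns the root 1 / p into q / p = 1 / (p
      / q).\<close>
    proof (rule ln_not_le_root_of_log[of "p / q" "ln l / c * C powr q" K 1 "2 * ln l"])
      show "1 < p / q" using st t by simp
      fix X :: real assume X: "1 \<le> X"
      obtain J where J: "l ^ J \<le> X" "X < l ^ Suc J" using ex_power_scale[OF l X] by blast
      have "ln X \<le> ln (l ^ Suc J)" using J(2) X by (intro ln_mono) auto
      also have "\<dots> = real (Suc J) * ln l" using l by (simp only: ln_realpow)
      finally have "ln X - 2 * ln l \<le> (real J - 1) * ln l" by (simp add: algebra_simps)
      \<comment> \<open>The natural number J - 1 counts the terms of the sum; for J = 0 it is 0,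
        which still dominates - 1.\<close>
      also have "\<dots> \<le> real (J - 1) * ln l" using ll by (intro mult_right_mono) auto
      also have "real (J - 1) * ln l = ln l / c * (c * (\<Sum>j\<in>{1..<J}. (l powr ((t - s) * q)) ^ j))"
        using c l st by simp
      also have "\<dots> \<le> ln l / c * (C * (K * (1 + ln X)) powr (1 / p)) powr q"
        using c ll by (intro mult_left_mono order_trans[OF le mono[OF J(1)]]) auto
      also have "\<dots> = ln l / c * C powr q * (K * (1 + ln X)) powr (1 / (p / q))"
        unfolding powr_mult[of C] powr_powr by simp
      finally show "ln X - 2 * ln l \<le> ln l / c * C powr q * (K * (1 + ln X)) powr (1 / (p / q))" .
    qed (use c ll CK in auto)
  qed
qed

section \<open>Distribution of the excluded targets over the four failure results\<close>

theorem proposition2p12: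
  fixes \<Omega> :: "(real^'n) set" and s p s' :: real and p' :: ereal
  assumes "0 < s" "s \<le> 1" "1 \<le> p"
    and "s * p = real CARD('n)" "s \<noteq> p"
    and "bounded_lipschitz_domain \<Omega>"
    and "0 \<le> s'" "s' \<le> 1" "1 \<le> p'"
    and "(s', p') \<noteq> (s, ereal p)"
    and "\<not> (s' = s \<and> s = 1 \<and> 1 \<le> p' \<and> p' \<le> ereal p)"
    and "\<not> ((0 < s' \<and> s' < s \<and> 1 \<le> p' \<and> p' \<le> ereal (real CARD('n) / s')) \<or>
             (s' = 0 \<and> 1 \<le> p' \<and> p' < \<infinity>))"
  shows "\<not> continuously_embedded \<Omega> s (ereal p) s' p'"
proof -
  let ?N = "real CARD('n)"
  have \<Omega>: "open \<Omega>" "bounded \<Omega>" "\<Omega> \<noteq> {}"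
    using assms(6) by (auto simp: bounded_lipschitz_domain_def)
  have "1 \<le> ?N" by (simp add: Suc_leI)
  \<comment> \<open>With p = 1 the critical relation would give s = N, hence s = 1 = p, against
    \<open>s \<noteq> p\<close>.\<close>
  have p: "1 < p"
  proof (rule ccontr)
    assume "\<not> 1 < p"
    then have "p = 1" using assms(3) by simp
    then show False using assms(2,4,5) \<open>1 \<le> ?N\<close> by simp
  qed
  show ?thesis
  proof (cases p')
    case PInf
    then show ?thesis
      using not_embedded_infinity[OF \<Omega> assms(1,2) p assms(4)] by simp
  next
    case MInf
    then show ?thesis using assms(9) by simp
  next
    case (real q)
    have q: "1 \<le> q" using assms(9) real by simp
    \<comment> \<open>Order 0 with a finite exponent is the second admissible alternative, which is
      excluded.\<close>
    have s'0: "0 < s'" using assms(7,12) q real by (cases "s' = 0") auto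
    \<comment> \<open>For s' < s this is the failure of the first alternative; for s' = s and q > p
      it follows from s p = N.\<close>
    have super: "?N < s' * q" if "s' < s \<or> s' = s \<and> p < q"
    proof (cases "s' < s")
      case True
      then have "\<not> q \<le> ?N / s'" using assms(12) s'0 q real by simp
      then show ?thesis using s'0 by (simp add: field_simps)
    next
      case False
      then have "s' = s" "p < q" using that by auto
      then show ?thesis using assms(1,4) mult_strict_left_mono[of p q s] by simp
    qed
    \<comment> \<open>What is missing is excluded as trivial: s' = s with q = p, and s' = s = 1 with
      q \<le> p. So order 1 outside the first case forces s < 1.\<close>
    consider "s' < s \<or> s' = s \<and> p < q" | "s < 1" "s' = 1" | "s < 1" "s' < 1" "s < s' \<or> s' = s \<and> q < p"
      using assms(2,8,10,11) q real by fastforce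
    then show ?thesis
    proof cases
      case 1
      show ?thesis
      proof (cases "s' < 1")
        case True
        then show ?thesis
          using not_embedded_supercritical_fractional[OF \<Omega> assms(1-4) s'0 _ q super[OF 1]] real by simp
      next
        case False
        then have "s' = 1" using assms(8) by simp
        then show ?thesis
          using not_embedded_supercritical_gradient[OF \<Omega> assms(1-4) q] super[OF 1] real by simp
      qed
    next
      case 2
      then show ?thesis
        using not_embedded_oscillation_gradient[OF \<Omega> assms(1) _ assms(3,4) q] real by simp
    next
      case 3
      then show ?thesis
        using not_embedded_lacunary[OF \<Omega> assms(1) _ assms(3,4) _ _ q, of s'] real by auto
    qed
  qed
qed

end
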